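(* Let $G$ be a precompact abelian Arhangel'skiĭ group. Then $G$ is $ss$-characterized if and only if $G$ is metrizable and countable.
   Context: All topological groups are Hausdorff and abelian. "Countable" means finite or countably infinite. A topological group $G$ is an Arhangel'skiĭ group if its weight $w(G)$ (the least cardinality of a base of its topology) satisfies $w(G)\le|G|$. A group topology on $G$ is precompact if it is Hausdorff and for every neighborhood $U$ of $0$ there is a finite $F\subseteq G$ with $F+U=G$. A sequence $\mathbf{u}=(u_n)$ in an abelian group $G$ is a $TB$-sequence if there is a precompact group topology on $G$ in which $u_n\to0$; then $\tau_{\mathbf{u}}$ denotes the finest precompact group topology on $G$ in which $u_n\to 0$. A precompact group $(G,\tau)$ is $ss$-characterized if there is a $TB$-sequence $\mathbf{u}$ in $G$ with $\tau=\tau_{\mathbf{u}}$. *)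

theory Defs
  imports "HOL-Analysis.Analysis"
begin

unbundle cardinal_syntax

definition group_topology :: "'a::ab_group_add topology \<Rightarrow> bool" where
  "group_topology T \<longleftrightarrow> topspace T = UNIV \<and>
     continuous_map (prod_topology T T) T (\<lambda>(x, y). x + y) \<and>
     continuous_map T T uminus"

definition precompact_group_topology :: "'a::ab_group_add topology \<Rightarrow> bool" where
  "precompact_group_topology T \<longleftrightarrow> group_topology T \<and> Hausdorff_space T \<and>
     (\<forall>U. (\<exists>V. openin T V \<and> 0 \<in> V \<and> V \<subseteq> U) \<longrightarrow>
          (\<exists>F. finite F \<and> {f + x | f x. f \<in> F \<and> x \<in> U} = UNIV))"

definition base_of_topology :: "'a topology \<Rightarrow> 'a set set \<Rightarrow> bool" where
  "base_of_topology T B \<longleftrightarrow> (arbitrary union_of (\<lambda>U. U \<in> B)) = openin T"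

definition minimal_base :: "'a topology \<Rightarrow> 'a set set \<Rightarrow> bool" where
  "minimal_base T B \<longleftrightarrow> base_of_topology T B \<and>
     (\<forall>B'. base_of_topology T B' \<longrightarrow> |B| \<le>o |B'| )"

text \<open>Cardinals are represented by cardinal orders, so the weight is the cardinal order of
  some base of least cardinality; the choice of that base matters only up to \<open>=o\<close>.\<close>

definition weight :: "'a topology \<Rightarrow> 'a set rel" where
  "weight T = |SOME B. minimal_base T B|"

lemma base_of_topology_openin: "base_of_topology T {U. openin T U}"
  unfolding base_of_topology_def
  by (simp add: fun_eq_iff union_of_def arbitrary_def) (metis Sup_least cSup_singleton
      insert_subset empty_subsetI mem_Collect_eq openin_Union subsetD subset_refl)

lemma minimal_base_exists: "\<exists>B. minimal_base T B"
proof -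
  let ?R = "card_of ` {B. base_of_topology T B}"
  have "?R \<noteq> {}" using base_of_topology_openin by blast
  moreover have "\<forall>r \<in> ?R. Well_order r" by (auto intro: card_of_Well_order)
  ultimately obtain r where "r \<in> ?R" "\<forall>r' \<in> ?R. r \<le>o r'"
    using exists_minim_Well_order by meson
  then show ?thesis unfolding minimal_base_def by blast
qed

definition arhangelskii_group :: "'a::ab_group_add topology \<Rightarrow> bool" where
  "arhangelskii_group T \<longleftrightarrow> group_topology T \<and> Hausdorff_space T \<and> weight T \<le>o |UNIV :: 'a set|"

unbundle no cardinal_syntax

definition TB_sequence :: "(nat \<Rightarrow> 'a::ab_group_add) \<Rightarrow> bool" where
  "TB_sequence u \<longleftrightarrow> (\<exists>T. precompact_group_topology T \<and> limitin T u 0 sequentially)"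

text \<open>The finest precompact group topology making \<open>u\<close> a null sequence. It exists for every
  TB-sequence: the supremum of all such topologies is again one. For other sequences the value
  is unspecified.\<close>

definition tau :: "(nat \<Rightarrow> 'a::ab_group_add) \<Rightarrow> 'a topology" where
  "tau u = (THE T. precompact_group_topology T \<and> limitin T u 0 sequentially \<and>
     (\<forall>T'. precompact_group_topology T' \<and> limitin T' u 0 sequentially \<longrightarrow>
        (\<forall>U. openin T' U \<longrightarrow> openin T U)))"

definition ss_characterized :: "'a::ab_group_add topology \<Rightarrow> bool" where
  "ss_characterized T \<longleftrightarrow> (\<exists>u. TB_sequence u \<and> T = tau u)"

end

theory Submission
  imports Defs "HOL-Complex_Analysis.Great_Picard"
begin

text \<open>
  Characters are homomorphisms into the unit circle of the complex plane, and the whole argument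
  compares a precompact group topology with its group of continuous characters.

  A characterized group is countable. A character \<open>\<phi>\<close> with \<open>\<phi> (u n) \<longlonglongrightarrow> 1\<close> is continuous for \<open>tau u\<close>:
  making it continuous keeps the topology precompact and \<open>u\<close> a null sequence, and \<open>tau u\<close> is already
  the finest such topology (\<open>character_continuous_finest\<close>). In particular every character that
  is trivial on the range of \<open>u\<close> is continuous. An infinite precompact group of weight at most its
  cardinality has at most as many continuous characters as elements, because only finitely many
  characters stay close to 1 on a given neighbourhood of zero
  (\<open>continuous_characters_ordLeq\<close>). On the other hand an uncountable abelian group has more
  characters than elements, even among those that are trivial on a given countable set
  (\<open>many_annihilating_characters\<close>). Hence the group is countable, the weight condition makes its
  topology second countable, and a countable base of neighbourhoods of zero yields an invariant metric.

  A countable metrizable precompact group is characterized. Let \<open>W n\<close> be a decreasing base of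
  neighbourhoods of zero. The characters that stay close to 1 on \<open>W n\<close> form a finite set \<open>H n\<close>, and
  the union of the \<open>H n\<close> is the group of continuous characters. Compactness of the space of all
  characters gives finite sets \<open>S n \<subseteq> W n\<close> that test membership: a character close to 1 on \<open>S n\<close> is
  almost equal to an element of \<open>H n\<close> on a prescribed finite set. Since \<open>H n\<close> is finite, its elements
  cannot drift, so a character that is close to 1 on \<open>S n\<close> for all \<open>n \<ge> N\<close> lies in \<open>H N\<close>
  (\<open>characterizing_finite_sets\<close>). An enumeration \<open>u\<close> of all the \<open>S n\<close> is a null sequence,
  and every character that tends to 1 along it is continuous.

  To pass from characters back to topologies one needs that a precompact group topology is generated
  by its continuous characters (\<open>nbhd0_contains_Bohr_set\<close>), which is the abelian Peter--Weyl theorem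
  without Haar measure. Its proof uses almost periodic functions. A neighbourhood of zero supports a
  uniformly continuous bump function \<open>f\<close>; precompactness makes \<open>f\<close> almost periodic, and almost
  periodic functions have an invariant mean. The autocorrelation of \<open>f\<close> lives on the difference set of
  the support of \<open>f\<close>, and it is the uniform limit of nonnegative combinations of the characters
  that are not orthogonal to \<open>f\<close>, all of which are continuous (\<open>autocorrelation_approx\<close>,
  \<open>correlated_character_periods\<close>). Hence it does not vanish on some set where finitely many continuous
  characters are close to 1. That there are enough characters is the spectral theorem: correlating with
  a fixed hermitian function is a compact self-adjoint operator commuting with translations
  (\<open>eigenfunction_exists\<close>), and inside an eigenspace the function whose autocorrelation has the largest
  norm has a character as its autocorrelation (\<open>maximal_autocorrelation_is_character\<close>).
\<close>


section \<open>Almost periodic functions\<close>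

text \<open>Total boundedness of a neighbourhood of zero, phrased with covers by small sets instead of
  translates: in this form it passes to finite intersections.\<close>

definition finitely_covering :: "'a::ab_group_add set \<Rightarrow> bool" where
  "finitely_covering N \<longleftrightarrow>
     (\<exists>\<C>. finite \<C> \<and> \<Union>\<C> = UNIV \<and> (\<forall>C\<in>\<C>. \<forall>x\<in>C. \<forall>y\<in>C. x - y \<in> N))"

lemma finitely_covering_mono:
  "finitely_covering N \<Longrightarrow> N \<subseteq> N' \<Longrightarrow> finitely_covering N'"
  unfolding finitely_covering_def by (meson subsetD)

lemma finitely_covering_Int:
  assumes "finitely_covering M" "finitely_covering N"
  shows "finitely_covering (M \<inter> N)"
proof -
  obtain \<C> where C: "finite \<C>" "\<Union>\<C> = UNIV" "\<forall>C\<in>\<C>. \<forall>x\<in>C. \<forall>y\<in>C. x - y \<in> M"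
    using assms(1) unfolding finitely_covering_def by blast
  obtain \<D> where D: "finite \<D>" "\<Union>\<D> = UNIV" "\<forall>C\<in>\<D>. \<forall>x\<in>C. \<forall>y\<in>C. x - y \<in> N"
    using assms(2) unfolding finitely_covering_def by blast
  let ?E = "(\<lambda>(C, D). C \<inter> D) ` (\<C> \<times> \<D>)"
  have "finite ?E" using C D by blast
  moreover have "\<Union>?E = UNIV"
  proof -
    have "x \<in> \<Union>?E" for x
    proof -
      obtain C D where "C \<in> \<C>" "D \<in> \<D>" "x \<in> C" "x \<in> D" using C(2) D(2) by (metis UNIV_I UnionE)
      then show ?thesis by force
    qed
    then show ?thesis by blast
  qed
  moreover have "\<forall>E\<in>?E. \<forall>x\<in>E. \<forall>y\<in>E. x - y \<in> M \<inter> N" using C(3) D(3) by fastforce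
  ultimately show ?thesis unfolding finitely_covering_def by blast
qed

lemma finitely_covering_UNIV [simp]: "finitely_covering UNIV"
  unfolding finitely_covering_def by (rule exI[of _ "{UNIV}"]) auto

lemma finitely_covering_reps:
  assumes "finitely_covering N"
  obtains F where "finite F" "\<And>x. \<exists>g\<in>F. x - g \<in> N"
proof -
  obtain \<C> where C: "finite \<C>" "\<Union>\<C> = UNIV" "\<forall>C\<in>\<C>. \<forall>x\<in>C. \<forall>y\<in>C. x - y \<in> N"
    using assms(1) unfolding finitely_covering_def by blast
  let ?F = "(\<lambda>C. SOME x. x \<in> C) ` \<C>"
  show ?thesis
  proof
    show "finite ?F" using C(1) by simp
    fix x
    obtain A where A: "A \<in> \<C>" "x \<in> A" using C(2) by (metis UNIV_I UnionE)
    then have "(SOME x. x \<in> A) \<in> A" by (meson someI)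
    then show "\<exists>g\<in>?F. x - g \<in> N" using A C(3) by blast
  qed
qed

definition periods :: "('a::ab_group_add \<Rightarrow> complex) \<Rightarrow> real \<Rightarrow> 'a set" where
  "periods f \<epsilon> = {t. \<forall>x. cmod (f (x + t) - f x) \<le> \<epsilon>}"

lemma periodsD: "t \<in> periods f \<epsilon> \<Longrightarrow> cmod (f (x + t) - f x) \<le> \<epsilon>"
  by (simp add: periods_def)

lemma periods_uminus: "t \<in> periods f \<epsilon> \<Longrightarrow> - t \<in> periods f \<epsilon>"
  unfolding periods_def
  by (auto, metis add.inverse_inverse diff_minus_eq_add diff_add_cancel norm_minus_commute)

text \<open>Almost periodicity in the sense of von Neumann, on a group without topology: for every
  \<open>\<epsilon>\<close> finitely many translates are \<open>\<epsilon>\<close>-dense among all translates.\<close>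

definition almost_periodic :: "('a::ab_group_add \<Rightarrow> complex) \<Rightarrow> bool" where
  "almost_periodic f \<longleftrightarrow> (\<forall>\<epsilon>>0. finitely_covering (periods f \<epsilon>))"

text \<open>Every value differs by at most 1 from the value at one of finitely many points.\<close>

lemma almost_periodic_bounded:
  assumes "almost_periodic f"
  obtains B where "B > 0" "\<And>x. cmod (f x) \<le> B"
proof -
  obtain F where F: "finite F" "\<And>x. \<exists>g\<in>F. x - g \<in> periods f 1"
    using finitely_covering_reps assms unfolding almost_periodic_def by (metis zero_less_one)
  have "cmod (f x) \<le> 1 + (\<Sum>g\<in>F. cmod (f g))" for x
  proof -
    obtain g where g: "g \<in> F" "x - g \<in> periods f 1" using F by blast
    have "cmod (f (g + (x - g)) - f g) \<le> 1" using g(2) by (rule periodsD)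
    then have "cmod (f x) \<le> 1 + cmod (f g)" using norm_triangle_ineq2[of "f x" "f g"] by simp
    also have "cmod (f g) \<le> (\<Sum>g\<in>F. cmod (f g))" using g F by (intro member_le_sum) auto
    finally show ?thesis by simp
  qed
  moreover have "1 + (\<Sum>g\<in>F. cmod (f g)) > 0"
    by (smt (verit) norm_ge_zero sum_nonneg)
  ultimately show ?thesis using that by blast
qed

lemma almost_periodicI_periods:
  assumes "almost_periodic f" "\<And>\<epsilon>. \<epsilon> > 0 \<Longrightarrow> \<exists>\<delta>>0. periods f \<delta> \<subseteq> periods g \<epsilon>"
  shows "almost_periodic g"
  using assms finitely_covering_mono unfolding almost_periodic_def by metis

lemma almost_periodicI_periods2:
  assumes "almost_periodic f" "almost_periodic f'"
    and "\<And>\<epsilon>. \<epsilon> > 0 \<Longrightarrow> \<exists>\<delta>>0. periods f \<delta> \<inter> periods f' \<delta> \<subseteq> periods g \<epsilon>"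
  shows "almost_periodic g"
  using assms finitely_covering_mono finitely_covering_Int unfolding almost_periodic_def by metis

lemma almost_periodic_const [simp]: "almost_periodic (\<lambda>x. c)"
  unfolding almost_periodic_def periods_def by simp

lemma almost_periodic_add:
  assumes "almost_periodic f" "almost_periodic g"
  shows "almost_periodic (\<lambda>x. f x + g x)"
proof (rule almost_periodicI_periods2[OF assms])
  fix \<epsilon> :: real assume "\<epsilon> > 0"
  have "cmod ((f (x + t) + g (x + t)) - (f x + g x)) \<le> \<epsilon>"
    if "t \<in> periods f (\<epsilon>/2)" "t \<in> periods g (\<epsilon>/2)" for t x
    using periodsD[OF that(1), of x] periodsD[OF that(2), of x]
      norm_triangle_ineq[of "f (x+t) - f x" "g (x+t) - g x"] by (simp add: algebra_simps)
  then show "\<exists>\<delta>>0. periods f \<delta> \<inter> periods g \<delta> \<subseteq> periods (\<lambda>x. f x + g x) \<epsilon>"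
    using \<open>\<epsilon> > 0\<close> by (intro exI[of _ "\<epsilon>/2"]) (auto simp: periods_def)
qed

lemma almost_periodic_mult:
  assumes "almost_periodic f" "almost_periodic g"
  shows "almost_periodic (\<lambda>x. f x * g x)"
proof (rule almost_periodicI_periods2[OF assms])
  fix \<epsilon> :: real assume e: "\<epsilon> > 0"
  obtain A where A: "A > 0" "\<And>x. cmod (f x) \<le> A" using almost_periodic_bounded[OF assms(1)] by blast
  obtain B where B: "B > 0" "\<And>x. cmod (g x) \<le> B" using almost_periodic_bounded[OF assms(2)] by blast
  let ?d = "\<epsilon>/(A+B)"
  have "cmod (f (x + t) * g (x + t) - f x * g x) \<le> \<epsilon>"
    if "t \<in> periods f ?d" "t \<in> periods g ?d" for t x
  proof -
    have "f (x + t) * g (x + t) - f x * g x = f (x+t) * (g (x+t) - g x) + (f (x+t) - f x) * g x"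
      by (simp add: algebra_simps)
    then have "cmod (f (x + t) * g (x + t) - f x * g x)
        \<le> cmod (f (x+t)) * cmod (g (x+t) - g x) + cmod (f (x+t) - f x) * cmod (g x)"
      by (metis norm_mult norm_triangle_ineq)
    also have "\<dots> \<le> A * ?d + ?d * B"
      using periodsD[OF that(1), of x] periodsD[OF that(2), of x] A B e
      by (intro add_mono mult_mono) auto
    also have "\<dots> = (A + B) * ?d" by (simp only: distrib_right mult.commute)
    also have "\<dots> = \<epsilon>" using A B by simp
    finally show ?thesis .
  qed
  then show "\<exists>\<delta>>0. periods f \<delta> \<inter> periods g \<delta> \<subseteq> periods (\<lambda>x. f x * g x) \<epsilon>"
    using e A B by (intro exI[of _ ?d]) (auto simp: periods_def)
qed

lemma almost_periodic_cmult: "almost_periodic f \<Longrightarrow> almost_periodic (\<lambda>x. c * f x)"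
  by (rule almost_periodic_mult) simp_all

lemma almost_periodic_uminus: "almost_periodic f \<Longrightarrow> almost_periodic (\<lambda>x. - f x)"
  using almost_periodic_cmult[of f "-1"] by simp

lemma almost_periodic_diff:
  "almost_periodic f \<Longrightarrow> almost_periodic g \<Longrightarrow> almost_periodic (\<lambda>x. f x - g x)"
  using almost_periodic_add[OF _ almost_periodic_uminus, of f g] by simp

lemma almost_periodic_cnj: "almost_periodic f \<Longrightarrow> almost_periodic (\<lambda>x. cnj (f x))"
  by (rule almost_periodicI_periods[of f], assumption, rule exI, rule conjI)
     (auto simp: periods_def simp flip: complex_cnj_diff)

lemma almost_periodic_shift: "almost_periodic f \<Longrightarrow> almost_periodic (\<lambda>x. f (x + a))"
  by (rule almost_periodicI_periods[of f], assumption, rule exI, rule conjI)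
     (auto simp: periods_def add_ac)

lemma almost_periodic_sum:
  "(\<And>i. i \<in> I \<Longrightarrow> almost_periodic (f i)) \<Longrightarrow> almost_periodic (\<lambda>x. \<Sum>i\<in>I. f i x)"
  by (induction I rule: infinite_finite_induct) (simp_all add: almost_periodic_add)

lemma almost_periodic_uniform_approx:
  assumes "\<And>\<epsilon>. \<epsilon> > 0 \<Longrightarrow> \<exists>g. almost_periodic g \<and> (\<forall>x. cmod (f x - g x) \<le> \<epsilon>)"
  shows "almost_periodic f"
  unfolding almost_periodic_def
proof (intro allI impI)
  fix \<epsilon> :: real assume "\<epsilon> > 0"
  then obtain g where g: "almost_periodic g" "\<forall>x. cmod (f x - g x) \<le> \<epsilon>/3"
    using assms[of "\<epsilon>/3"] by auto
  have "cmod (f (x+t) - f x) \<le> \<epsilon>" if "t \<in> periods g (\<epsilon>/3)" for x t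
  proof -
    have "f (x+t) - f x = (f (x+t) - g (x+t)) + (g (x+t) - g x) - (f x - g x)" by simp
    also have "cmod \<dots> \<le> cmod (f (x+t) - g (x+t)) + cmod (g (x+t) - g x) + cmod (f x - g x)"
      by (meson add_mono norm_triangle_ineq norm_triangle_ineq4 order_refl order_trans)
    also have "\<dots> \<le> \<epsilon>/3 + \<epsilon>/3 + \<epsilon>/3"
      using periodsD[OF that, of x] g(2) by (intro add_mono) auto
    finally show ?thesis by simp
  qed
  then have "periods g (\<epsilon>/3) \<subseteq> periods f \<epsilon>" by (auto simp: periods_def)
  moreover have "finitely_covering (periods g (\<epsilon>/3))"
    using g(1) \<open>\<epsilon> > 0\<close> unfolding almost_periodic_def by simp
  ultimately show "finitely_covering (periods f \<epsilon>)"
    by (blast intro: finitely_covering_mono)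
qed

section \<open>The invariant mean\<close>

definition avg :: "'a::ab_group_add list \<Rightarrow> ('a \<Rightarrow> complex) \<Rightarrow> 'a \<Rightarrow> complex" where
  "avg xs f x = (\<Sum>s\<leftarrow>xs. f (x + s)) / of_nat (length xs)"

definition sums_list :: "'a::ab_group_add list \<Rightarrow> 'a list \<Rightarrow> 'a list" where
  "sums_list xs ys = concat (map (\<lambda>s. map (\<lambda>t. s + t) ys) xs)"

lemma length_sums_list: "length (sums_list xs ys) = length xs * length ys"
  unfolding sums_list_def by (induction xs) auto

lemma sums_list_nonempty: "xs \<noteq> [] \<Longrightarrow> ys \<noteq> [] \<Longrightarrow> sums_list xs ys \<noteq> []"
  by (metis length_0_conv length_sums_list mult_eq_0_iff)

lemma sum_list_sums_list: "(\<Sum>u\<leftarrow>sums_list xs ys. g u) = (\<Sum>s\<leftarrow>xs. \<Sum>t\<leftarrow>ys. g (s + t))"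
  for g :: "'a::ab_group_add \<Rightarrow> 'b::comm_monoid_add"
  unfolding sums_list_def by (induction xs) (simp_all add: o_def)

lemma sum_list_divide: "(\<Sum>s\<leftarrow>xs. g s / c) = (\<Sum>s\<leftarrow>xs. g s) / (c :: complex)"
  by (induction xs) (simp_all add: add_divide_distrib)

lemma avg_avg: "avg xs (avg ys f) x = avg (sums_list xs ys) f x"
  unfolding avg_def
  by (simp add: sum_list_sums_list sum_list_divide length_sums_list mult.commute add.assoc)

lemma sum_list_swap:
  "(\<Sum>s\<leftarrow>xs. \<Sum>t\<leftarrow>ys. g s t) = (\<Sum>t\<leftarrow>ys. \<Sum>s\<leftarrow>xs. g s t :: 'b::comm_monoid_add)"
  by (induction xs) (simp_all add: sum_list_addf)

text \<open>Averaging operators over finite families of translations commute because the group is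
  abelian. This is what makes the mean well defined, additive, and independent of choices.\<close>

lemma avg_commute: "avg xs (avg ys f) x = avg ys (avg xs f) x"
proof -
  have 1: "(\<Sum>s\<leftarrow>xs. \<Sum>t\<leftarrow>ys. f (x + (s + t))) = (\<Sum>t\<leftarrow>ys. \<Sum>s\<leftarrow>xs. f (x + (s + t)))"
    by (rule sum_list_swap)
  have 2: "\<dots> = (\<Sum>t\<leftarrow>ys. \<Sum>s\<leftarrow>xs. f (x + (t + s)))"
    by (intro arg_cong[of _ _ sum_list] map_cong refl arg_cong[of _ _ f] arg_cong[of _ _ "(+) x"] add.commute)
  have 3: "avg (sums_list xs ys) f x = avg (sums_list ys xs) f x"
    unfolding avg_def sum_list_sums_list length_sums_list 1 2
    by (subst mult.commute) (rule refl)
  show ?thesis unfolding avg_avg by (rule 3)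
qed

lemma norm_diff_triangle_half:
  "cmod (a - b) \<le> e / 2 \<Longrightarrow> cmod (b - c) \<le> e / 2 \<Longrightarrow> cmod (a - c) \<le> e"
  using norm_diff_triangle_le[of a b "e/2" c "e/2"] by simp

lemma avg_near:
  assumes "xs \<noteq> []" "\<And>x. cmod (f x - c) \<le> \<epsilon>"
  shows "cmod (avg xs f x - c) \<le> \<epsilon>"
proof -
  have "cmod ((\<Sum>s\<leftarrow>ys. f (x + s)) - of_nat (length ys) * c) \<le> real (length ys) * \<epsilon>" for ys
  proof (induction ys)
    case (Cons a ys)
    have "(\<Sum>s\<leftarrow>a # ys. f (x + s)) - of_nat (length (a # ys)) * c
       = (f (x + a) - c) + ((\<Sum>s\<leftarrow>ys. f (x + s)) - of_nat (length ys) * c)"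
      by (simp add: algebra_simps)
    also have "cmod \<dots> \<le> \<epsilon> + real (length ys) * \<epsilon>"
      using assms(2)[of "x + a"] Cons.IH by (intro order_trans[OF norm_triangle_ineq] add_mono) auto
    finally show ?case by (simp add: algebra_simps)
  qed simp
  note * = this[of xs]
  let ?n = "of_nat (length xs) :: complex"
  have n: "?n \<noteq> 0" "real (length xs) > 0" using assms(1) by auto
  have "avg xs f x - c = ((\<Sum>s\<leftarrow>xs. f (x + s)) - ?n * c) / ?n"
    using n(1) unfolding avg_def by (simp add: field_simps)
  then have "cmod (avg xs f x - c) = cmod ((\<Sum>s\<leftarrow>xs. f (x + s)) - ?n * c) / real (length xs)"
    by (simp add: norm_divide)
  also have "\<dots> \<le> \<epsilon>" using * n(2) by (simp add: field_simps)
  finally show ?thesis .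
qed

lemma avg_add: "avg xs (\<lambda>x. f x + g x) x = avg xs f x + avg xs g x"
  unfolding avg_def by (simp add: sum_list_addf add_divide_distrib)

lemma avg_cmult: "avg xs (\<lambda>x. c * f x) x = c * avg xs f x"
  unfolding avg_def by (simp add: sum_list_const_mult)

lemma avg_diff: "avg xs (\<lambda>x. f x - g x) x = avg xs f x - avg xs g x"
  using avg_add[of xs f "\<lambda>x. (-1) * g x" x] avg_cmult[of xs "-1" g x] by simp

lemma avg_shift: "avg xs (\<lambda>x. f (x + a)) x = avg xs f (x + a)"
  unfolding avg_def by (simp add: add_ac)

lemma avg_reflect: "avg xs (\<lambda>x. f (- x)) x = avg (map uminus xs) f (- x)"
proof -
  have "- (x + s) = - x + - s" for s by simp
  then show ?thesis unfolding avg_def by (simp only: map_map o_def length_map)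
qed

lemma avg_cnj: "avg xs (\<lambda>x. cnj (f x)) x = cnj (avg xs f x)"
proof -
  have "(\<Sum>s\<leftarrow>xs. cnj (f (x + s))) = cnj (\<Sum>s\<leftarrow>xs. f (x + s))" by (induction xs) auto
  then show ?thesis unfolding avg_def by simp
qed

lemma avg_diff_le:
  assumes "xs \<noteq> []" "\<And>x. cmod (f x - g x) \<le> \<epsilon>"
  shows "cmod (avg xs f x - avg xs g x) \<le> \<epsilon>"
  using avg_near[OF assms(1), of "\<lambda>x. f x - g x" 0 \<epsilon> x] assms(2) by (simp add: avg_diff)

text \<open>The constants in the uniform closure of the finite averages of the translates.\<close>

definition is_mean :: "('a::ab_group_add \<Rightarrow> complex) \<Rightarrow> complex \<Rightarrow> bool" where
  "is_mean f c \<longleftrightarrow> (\<forall>\<epsilon>>0. \<exists>xs. xs \<noteq> [] \<and> (\<forall>x. cmod (avg xs f x - c) \<le> \<epsilon>))"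

text \<open>Averaging a function that is close to a constant keeps it close to that constant, so
  applying both averages in either order gives one number close to both constants.\<close>

lemma means_close:
  assumes "xs \<noteq> []" "\<And>x. cmod (avg xs f x - c) \<le> \<epsilon>"
    and "ys \<noteq> []" "\<And>x. cmod (avg ys f x - d) \<le> \<delta>"
  shows "cmod (c - d) \<le> \<epsilon> + \<delta>"
proof -
  have "cmod (avg ys (avg xs f) 0 - c) \<le> \<epsilon>" using avg_near assms by blast
  moreover have "cmod (avg xs (avg ys f) 0 - d) \<le> \<delta>" using avg_near assms by blast
  ultimately have "cmod (c - avg ys (avg xs f) 0) \<le> \<epsilon>" "cmod (avg ys (avg xs f) 0 - d) \<le> \<delta>"
    by (simp_all add: norm_minus_commute avg_commute[of xs ys])
  then show ?thesis by (rule norm_diff_triangle_le)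
qed

text \<open>For a single \<open>g\<close> one averages over \<open>0, g, 2g, \<dots>, (n-1)g\<close>; translating by \<open>g\<close> then
  telescopes and costs at most \<open>2B/n\<close>. Different \<open>g\<close> are treated one after the other, since a
  further averaging does not spoil invariance that has already been achieved.\<close>

lemma avg_almost_invariant:
  assumes "finite F" "\<And>x. cmod (f x) \<le> B" "\<delta> > 0"
  shows "\<exists>xs. xs \<noteq> [] \<and> (\<forall>g\<in>F. \<forall>x. cmod (avg xs f (x + g) - avg xs f x) \<le> \<delta>)"
  using assms(1)
proof induction
  case empty
  then show ?case by blast
next
  case (insert g F)
  then obtain xs where xs: "xs \<noteq> []" "\<And>h x. h \<in> F \<Longrightarrow> cmod (avg xs f (x + h) - avg xs f x) \<le> \<delta>"
    by blast
  define u where "u = avg xs f"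
  have u: "cmod (u x) \<le> B" for x unfolding u_def using avg_near[OF xs(1), of f 0] assms(2) by simp
  then have B: "B \<ge> 0" using norm_ge_zero order_trans by blast
  define m where "m i = (\<Sum>j<i. g)" for i :: nat
  have m: "m (Suc i) = m i + g" for i unfolding m_def by simp
  obtain n :: nat where "2 * B / \<delta> < real n" using reals_Archimedean2 by blast
  moreover have "0 \<le> 2 * B / \<delta>" using B assms(3) by simp
  ultimately have "real n > 0" by linarith
  moreover have "2 * B < real n * \<delta>" using \<open>2 * B / \<delta> < real n\<close> assms(3) by (simp add: pos_divide_less_eq)
  ultimately have n: "n > 0" "2 * B / real n \<le> \<delta>" by (simp_all add: pos_divide_le_eq mult.commute)
  define ys where "ys = map m [0..<n]"
  have ys: "ys \<noteq> []" using n(1) unfolding ys_def by simp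
  have avg_ys: "avg ys v x = (\<Sum>i<n. v (x + m i)) / of_nat n" for v x
    unfolding avg_def ys_def by (simp add: o_def interv_sum_list_conv_sum_set_nat atLeast0LessThan)
  have "cmod (avg ys u (x + h) - avg ys u x) \<le> \<delta>" if "h \<in> insert g F" for h x
  proof (cases "h = g")
    case True
    have "avg ys u (x + g) - avg ys u x = (\<Sum>i<n. u (x + m (Suc i)) - u (x + m i)) / of_nat n"
      unfolding avg_ys m sum_subtractf diff_divide_distrib by (simp only: add_ac)
    also have "\<dots> = (u (x + m n) - u (x + m 0)) / of_nat n"
      by (subst sum_lessThan_telescope) simp
    finally have "cmod (avg ys u (x + g) - avg ys u x) = cmod (u (x + m n) - u (x + m 0)) / real n"
      by (simp add: norm_divide)
    also have "\<dots> \<le> 2 * B / real n"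
      using u[of "x + m n"] u[of "x + m 0"] norm_triangle_ineq4[of "u (x + m n)" "u (x + m 0)"]
      by (intro divide_right_mono) auto
    finally show ?thesis using n(2) True by simp
  next
    case False
    then have "cmod (u (y + h) - u y) \<le> \<delta>" for y using xs(2) that unfolding u_def by blast
    then show ?thesis using avg_diff_le[OF ys, of "\<lambda>y. u (y + h)" u \<delta> x] by (simp add: avg_shift)
  qed
  then show ?case
    using sums_list_nonempty[OF ys xs(1)]
    by (intro exI[of _ "sums_list ys xs"]) (simp add: u_def flip: avg_avg)
qed

text \<open>An average that is almost invariant under representatives of a finite cover by almost
  periods is almost constant. The values of such averages of increasing quality form a Cauchy
  sequence by \<open>means_close\<close>.\<close>

lemma is_mean_exists:
  assumes "almost_periodic f"
  shows "\<exists>c. is_mean f c"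
proof -
  obtain B where B: "\<And>x. cmod (f x) \<le> B" using almost_periodic_bounded[OF assms] by blast
  have osc: "\<exists>xs. xs \<noteq> [] \<and> (\<forall>x. cmod (avg xs f x - avg xs f 0) \<le> \<epsilon>)" if "\<epsilon> > 0" for \<epsilon>
  proof -
    have "finitely_covering (periods f (\<epsilon>/2))" using assms that unfolding almost_periodic_def by simp
    then obtain F where F: "finite F" "\<And>x. \<exists>g\<in>F. x - g \<in> periods f (\<epsilon>/2)"
      using finitely_covering_reps by blast
    obtain xs where xs: "xs \<noteq> []" "\<And>g x. g \<in> F \<Longrightarrow> cmod (avg xs f (x + g) - avg xs f x) \<le> \<epsilon>/2"
      using avg_almost_invariant[OF F(1), of f B "\<epsilon>/2"] B \<open>\<epsilon> > 0\<close> by (meson half_gt_zero)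
    have "cmod (avg xs f x - avg xs f 0) \<le> \<epsilon>" for x
    proof -
      obtain g where g: "g \<in> F" "x - g \<in> periods f (\<epsilon>/2)" using F(2) by blast
      have "cmod (avg xs (\<lambda>y. f (y + (x - g))) g - avg xs f g) \<le> \<epsilon>/2"
        using periodsD[OF g(2)] by (intro avg_diff_le[OF xs(1)])
      then have "cmod (avg xs f x - avg xs f g) \<le> \<epsilon>/2" by (simp add: avg_shift)
      moreover have "cmod (avg xs f g - avg xs f 0) \<le> \<epsilon>/2" using xs(2)[OF g(1), of 0] by simp
      ultimately show ?thesis by (rule norm_diff_triangle_half)
    qed
    then show ?thesis using xs(1) by blast
  qed
  have "\<forall>n::nat. \<exists>xs. xs \<noteq> [] \<and> (\<forall>x. cmod (avg xs f x - avg xs f 0) \<le> inverse (real (Suc n)))"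
    by (intro allI osc) simp
  then obtain X where X: "\<And>n. X n \<noteq> []"
      "\<And>n x. cmod (avg (X n) f x - avg (X n) f 0) \<le> inverse (real (Suc n))"
    using choice[of "\<lambda>n xs. xs \<noteq> [] \<and> (\<forall>x. cmod (avg xs f x - avg xs f 0) \<le> inverse (real (Suc n)))"]
    by blast
  define a where "a n = avg (X n) f 0" for n
  \<comment> \<open>The averages of quality \<open>1/n\<close> and \<open>1/m\<close> approximate values that differ by at most the sum of the errors.\<close>
  have close: "cmod (a n - a m) \<le> inverse (real (Suc n)) + inverse (real (Suc m))" for n m
    using means_close[OF X(1) X(2) X(1) X(2)] unfolding a_def .
  have small: "\<exists>N. \<forall>n\<ge>N. inverse (real (Suc n)) < e" if "e > 0" for e :: real
    using LIMSEQ_inverse_real_of_nat that unfolding LIMSEQ_def by (simp add: dist_real_def)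
  have "Cauchy a"
  proof (rule metric_CauchyI)
    fix e :: real assume "e > 0"
    then obtain N where N: "\<And>n. n \<ge> N \<Longrightarrow> inverse (real (Suc n)) < e/2" using small[of "e/2"] by auto
    have "dist (a m) (a n) < e" if "m \<ge> N" "n \<ge> N" for m n
      using close[of m n] N[OF that(1)] N[OF that(2)] unfolding dist_norm by linarith
    then show "\<exists>M. \<forall>m\<ge>M. \<forall>n\<ge>M. dist (a m) (a n) < e" by blast
  qed
  then obtain c where c: "a \<longlonglongrightarrow> c" using Cauchy_convergent convergent_def by blast
  have "is_mean f c"
    unfolding is_mean_def
  proof (intro allI impI)
    fix e :: real assume "e > 0"
    then obtain N where N: "\<And>n. n \<ge> N \<Longrightarrow> inverse (real (Suc n)) < e/2" using small[of "e/2"] by auto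
    obtain M where M: "\<And>n. n \<ge> M \<Longrightarrow> cmod (a n - c) < e/2"
      using c \<open>e > 0\<close> unfolding LIMSEQ_iff by (metis half_gt_zero)
    let ?n = "max N M"
    have "cmod (avg (X ?n) f x - c) \<le> e" for x
    proof -
      have "cmod (avg (X ?n) f x - a ?n) \<le> e/2"
        using X(2)[of ?n x] N[of ?n] unfolding a_def by linarith
      moreover have "cmod (a ?n - c) \<le> e/2" using M[of ?n] by simp
      ultimately show ?thesis by (rule norm_diff_triangle_half)
    qed
    then show "\<exists>xs. xs \<noteq> [] \<and> (\<forall>x. cmod (avg xs f x - c) \<le> e)" using X(1) by blast
  qed
  then show ?thesis by blast
qed

lemma is_mean_unique:
  assumes "is_mean f c" "is_mean f d" shows "c = d"
proof -
  have "cmod (c - d) \<le> 0 + \<epsilon>" if "\<epsilon> > 0" for \<epsilon>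
  proof -
    obtain xs where "xs \<noteq> []" "\<And>x. cmod (avg xs f x - c) \<le> \<epsilon>/2"
      using assms(1) \<open>\<epsilon> > 0\<close> unfolding is_mean_def by (metis half_gt_zero)
    moreover obtain ys where "ys \<noteq> []" "\<And>x. cmod (avg ys f x - d) \<le> \<epsilon>/2"
      using assms(2) \<open>\<epsilon> > 0\<close> unfolding is_mean_def by (metis half_gt_zero)
    ultimately show ?thesis using means_close[of xs f c "\<epsilon>/2" ys d "\<epsilon>/2"] by simp
  qed
  then have "cmod (c - d) \<le> 0" by (rule field_le_epsilon)
  then show ?thesis by simp
qed

definition mean :: "('a::ab_group_add \<Rightarrow> complex) \<Rightarrow> complex" where
  "mean f = (THE c. is_mean f c)"

lemma mean_eqI: "is_mean f c \<Longrightarrow> mean f = c"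
  unfolding mean_def using is_mean_unique by blast

lemma is_mean_mean: "almost_periodic f \<Longrightarrow> is_mean f (mean f)"
  using is_mean_exists mean_eqI by blast

lemma common_avg:
  assumes "finite Q" "\<And>q. q \<in> Q \<Longrightarrow> almost_periodic q" "\<epsilon> > 0"
  shows "\<exists>xs. xs \<noteq> [] \<and> (\<forall>q\<in>Q. \<forall>x. cmod (avg xs q x - mean q) \<le> \<epsilon>)"
  using assms(1,2)
proof induction
  case empty
  then show ?case by blast
next
  case (insert q Q)
  then obtain xs where xs: "xs \<noteq> []" "\<And>p x. p \<in> Q \<Longrightarrow> cmod (avg xs p x - mean p) \<le> \<epsilon>" by blast
  have "is_mean q (mean q)" using insert.prems is_mean_mean by blast
  then obtain ys where ys: "ys \<noteq> []" "\<And>x. cmod (avg ys q x - mean q) \<le> \<epsilon>"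
    using assms(3) unfolding is_mean_def by blast
  have "cmod (avg ys (avg xs p) x - mean p) \<le> \<epsilon>" if "p \<in> insert q Q" for p x
  proof (cases "p = q")
    case True
    then show ?thesis using avg_near[OF xs(1) ys(2)] avg_commute[of ys xs] by simp
  next
    case False
    then have "p \<in> Q" using that by simp
    then show ?thesis using avg_near[OF ys(1), of "avg xs p" "mean p" \<epsilon> x] xs(2)[of p] by simp
  qed
  then show ?case
    using sums_list_nonempty[OF ys(1) xs(1)] by (intro exI[of _ "sums_list ys xs"]) (simp flip: avg_avg)
qed

lemma mean_close:
  assumes "almost_periodic f" "almost_periodic g" "\<And>x. cmod (f x - g x) \<le> \<epsilon>"
  shows "cmod (mean f - mean g) \<le> \<epsilon>"
proof (rule field_le_epsilon)
  fix e :: real assume "e > 0"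
  then obtain xs where xs: "xs \<noteq> []" "\<forall>q\<in>{f, g}. \<forall>x. cmod (avg xs q x - mean q) \<le> e/2"
    using common_avg[of "{f, g}" "e/2"] assms by auto
  have "cmod (mean f - avg xs f 0) \<le> e/2" "cmod (avg xs g 0 - mean g) \<le> e/2"
    using xs(2) by (auto simp: norm_minus_commute)
  moreover have "cmod (avg xs f 0 - avg xs g 0) \<le> \<epsilon>" using avg_diff_le[OF xs(1) assms(3)] .
  ultimately have "cmod (mean f - mean g) \<le> e/2 + (\<epsilon> + e/2)" by (meson norm_diff_triangle_le)
  then show "cmod (mean f - mean g) \<le> \<epsilon> + e" by simp
qed

text \<open>One averaging list serves a whole totally bounded family. This uniformity is what allows
  two means to be interchanged.\<close>

lemma uniform_avg:
  assumes F: "\<And>i. almost_periodic (F i)"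
    and tb: "\<And>\<delta>. \<delta> > 0 \<Longrightarrow> \<exists>X. finite X \<and> (\<forall>i. \<exists>j\<in>X. \<forall>y. cmod (F i y - F j y) \<le> \<delta>)"
    and g: "almost_periodic g" and e: "\<epsilon> > 0"
  shows "\<exists>xs. xs \<noteq> [] \<and> (\<forall>i x. cmod (avg xs (F i) x - mean (F i)) \<le> \<epsilon>)
     \<and> (\<forall>x. cmod (avg xs g x - mean g) \<le> \<epsilon>)"
proof -
  obtain X where X: "finite X" "\<And>i. \<exists>j\<in>X. \<forall>y. cmod (F i y - F j y) \<le> \<epsilon>/3" using tb[of "\<epsilon>/3"] e by auto
  have "finite (insert g (F ` X))" using X(1) by simp
  moreover have "almost_periodic q" if "q \<in> insert g (F ` X)" for q using that F g by blast
  moreover have "\<epsilon>/3 > 0" using e by simp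
  ultimately obtain xs where xs: "xs \<noteq> []"
      "\<And>q x. q \<in> insert g (F ` X) \<Longrightarrow> cmod (avg xs q x - mean q) \<le> \<epsilon>/3"
    using common_avg[of "insert g (F ` X)" "\<epsilon>/3"] by blast
  have "cmod (avg xs (F i) x - mean (F i)) \<le> \<epsilon>" for i x
  proof -
    obtain j where j: "j \<in> X" "\<And>y. cmod (F i y - F j y) \<le> \<epsilon>/3" using X(2) by blast
    have "cmod (avg xs (F i) x - avg xs (F j) x) \<le> \<epsilon>/3" using avg_diff_le[OF xs(1) j(2)] .
    moreover have "cmod (avg xs (F j) x - mean (F j)) \<le> \<epsilon>/3" using xs(2) j(1) by blast
    moreover have "cmod (mean (F j) - mean (F i)) \<le> \<epsilon>/3"
      using j(2) by (intro mean_close F) (simp only: norm_minus_commute)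
    ultimately have "cmod (avg xs (F i) x - mean (F i)) \<le> \<epsilon>/3 + (\<epsilon>/3 + \<epsilon>/3)"
      by (meson norm_diff_triangle_le)
    then show ?thesis by simp
  qed
  moreover have "cmod (avg xs g x - mean g) \<le> \<epsilon>" for x using xs(2)[of g x] e by simp
  ultimately show ?thesis using xs(1) by blast
qed

lemma mean_const [simp]: "mean (\<lambda>x. c) = c"
proof (rule mean_eqI, unfold is_mean_def, intro allI impI)
  fix e :: real assume "e > 0"
  then show "\<exists>xs. xs \<noteq> [] \<and> (\<forall>x. cmod (avg xs (\<lambda>x. c) x - c) \<le> e)"
    by (intro exI[of _ "[0]"]) (simp add: avg_def)
qed

lemma mean_add:
  assumes "almost_periodic f" "almost_periodic g"
  shows "mean (\<lambda>x. f x + g x) = mean f + mean g"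
proof (rule mean_eqI, unfold is_mean_def, intro allI impI)
  fix e :: real assume "e > 0"
  then obtain xs where xs: "xs \<noteq> []" "\<forall>q\<in>{f, g}. \<forall>x. cmod (avg xs q x - mean q) \<le> e/2"
    using common_avg[of "{f, g}" "e/2"] assms by auto
  have "cmod (avg xs (\<lambda>x. f x + g x) x - (mean f + mean g)) \<le> e" for x
  proof -
    have "cmod ((avg xs f x - mean f) + (avg xs g x - mean g)) \<le> e/2 + e/2"
      using xs(2) by (intro order_trans[OF norm_triangle_ineq] add_mono) auto
    then show ?thesis by (simp add: avg_add algebra_simps)
  qed
  then show "\<exists>xs. xs \<noteq> [] \<and> (\<forall>x. cmod (avg xs (\<lambda>x. f x + g x) x - (mean f + mean g)) \<le> e)"
    using xs(1) by blast
qed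

lemma mean_cmult:
  assumes "almost_periodic f"
  shows "mean (\<lambda>x. c * f x) = c * mean f"
proof (rule mean_eqI, unfold is_mean_def, intro allI impI)
  fix e :: real assume "e > 0"
  then have "e / (cmod c + 1) > 0" by (smt (verit) divide_pos_pos norm_ge_zero)
  then obtain xs where xs: "xs \<noteq> []" "\<And>x. cmod (avg xs f x - mean f) \<le> e / (cmod c + 1)"
    using is_mean_mean[OF assms] unfolding is_mean_def by blast
  have "cmod (avg xs (\<lambda>x. c * f x) x - c * mean f) \<le> e" for x
  proof -
    have "cmod (avg xs (\<lambda>x. c * f x) x - c * mean f) = cmod c * cmod (avg xs f x - mean f)"
      by (simp add: avg_cmult norm_mult flip: right_diff_distrib)
    also have "\<dots> \<le> (cmod c + 1) * (e / (cmod c + 1))" using xs(2) by (intro mult_mono) auto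
    also have "\<dots> = e" by (smt (verit) nonzero_mult_div_cancel_left norm_ge_zero times_divide_eq_right)
    finally show ?thesis .
  qed
  then show "\<exists>xs. xs \<noteq> [] \<and> (\<forall>x. cmod (avg xs (\<lambda>x. c * f x) x - c * mean f) \<le> e)"
    using xs(1) by blast
qed

lemma mean_multc: "almost_periodic f \<Longrightarrow> mean (\<lambda>x. f x * c) = mean f * c"
  using mean_cmult[of f c] by (simp add: mult.commute)

lemma mean_diff:
  "almost_periodic f \<Longrightarrow> almost_periodic g \<Longrightarrow> mean (\<lambda>x. f x - g x) = mean f - mean g"
  using mean_add[OF _ almost_periodic_uminus, of f g] mean_cmult[of g "-1"] by simp

lemma mean_sum:
  "(\<And>i. i \<in> I \<Longrightarrow> almost_periodic (f i)) \<Longrightarrow> mean (\<lambda>x. \<Sum>i\<in>I. f i x) = (\<Sum>i\<in>I. mean (f i))"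
  by (induction I rule: infinite_finite_induct) (simp_all add: mean_add almost_periodic_sum)

lemma mean_shift:
  assumes "almost_periodic f" shows "mean (\<lambda>x. f (x + a)) = mean f"
  using is_mean_mean[OF assms] by (intro mean_eqI) (unfold is_mean_def avg_shift, meson)

lemma mean_reflect:
  assumes "almost_periodic f" shows "mean (\<lambda>x. f (- x)) = mean f"
proof (rule mean_eqI, unfold is_mean_def, intro allI impI)
  fix e :: real assume "e > 0"
  then obtain xs where xs: "xs \<noteq> []" "\<And>x. cmod (avg xs f x - mean f) \<le> e"
    using is_mean_mean[OF assms] unfolding is_mean_def by blast
  show "\<exists>xs. xs \<noteq> [] \<and> (\<forall>x. cmod (avg xs (\<lambda>x. f (- x)) x - mean f) \<le> e)"
    using xs by (intro exI[of _ "map uminus xs"]) (simp add: avg_reflect o_def)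
qed

lemma mean_cnj:
  assumes "almost_periodic f" shows "mean (\<lambda>x. cnj (f x)) = cnj (mean f)"
proof (rule mean_eqI)
  have "cmod (cnj z - cnj w) = cmod (z - w)" for z w by (simp flip: complex_cnj_diff)
  then show "is_mean (\<lambda>x. cnj (f x)) (cnj (mean f))"
    using is_mean_mean[OF assms] unfolding is_mean_def by (simp add: avg_cnj)
qed

lemma mean_norm_le:
  assumes "almost_periodic f" "\<And>x. cmod (f x) \<le> B" shows "cmod (mean f) \<le> B"
  using mean_close[of f "\<lambda>x. 0" B] assms by simp

lemma Re_mean_nonneg:
  assumes "almost_periodic f" "\<And>x. Re (f x) \<ge> 0" shows "Re (mean f) \<ge> 0"
proof -
  have "0 \<le> Re (mean f) + e" if "e > 0" for e
  proof -
    obtain xs where xs: "xs \<noteq> []" "\<And>x. cmod (avg xs f x - mean f) \<le> e"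
      using is_mean_mean[OF assms(1)] \<open>e > 0\<close> unfolding is_mean_def by blast
    have "Re (\<Sum>s\<leftarrow>ys. f (0 + s)) \<ge> 0" for ys using assms(2) by (induction ys) simp_all
    then have "Re (avg xs f 0) \<ge> 0" unfolding avg_def by simp
    moreover have "\<bar>Re (avg xs f 0) - Re (mean f)\<bar> \<le> e"
      using abs_Re_le_cmod[of "avg xs f 0 - mean f"] xs(2)[of 0] by simp
    ultimately show ?thesis by linarith
  qed
  then show ?thesis by (rule field_le_epsilon)
qed

text \<open>The mean is strictly positive on nonzero nonnegative functions: finitely many translates
  of such a function add up to a function bounded below by a positive constant.\<close>

lemma Re_mean_pos:
  assumes f: "almost_periodic f" "\<And>x. Re (f x) \<ge> 0" and x0: "Re (f x0) > 0"
  shows "Re (mean f) > 0"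
proof -
  define d where "d = Re (f x0) / 2"
  have d: "d > 0" using x0 unfolding d_def by simp
  then have "finitely_covering (periods f d)" using f unfolding almost_periodic_def by blast
  then obtain F where F: "finite F" "\<And>x. \<exists>g\<in>F. x - g \<in> periods f d"
    using finitely_covering_reps by blast
  have "F \<noteq> {}" using F(2) by blast
  have "Re ((\<Sum>g\<in>F. f (x + g)) - of_real d) \<ge> 0" for x
  proof -
    obtain g where g: "g \<in> F" "(x0 - x) - g \<in> periods f d" using F(2) by blast
    have "cmod (f (x + g + ((x0 - x) - g)) - f (x + g)) \<le> d" using g(2) by (rule periodsD)
    then have "\<bar>Re (f x0) - Re (f (x + g))\<bar> \<le> d"
      using abs_Re_le_cmod[of "f x0 - f (x + g)"] by simp
    then have "d \<le> Re (f (x + g))" unfolding d_def by linarith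
    also have "\<dots> \<le> (\<Sum>g\<in>F. Re (f (x + g)))"
      using f(2) g F by (intro member_le_sum) auto
    finally show ?thesis by simp
  qed
  moreover have ap: "almost_periodic (\<lambda>x. f (x + g))" for g using f(1) by (rule almost_periodic_shift)
  ultimately have "0 \<le> Re (mean (\<lambda>x. (\<Sum>g\<in>F. f (x + g)) - of_real d))"
    by (intro Re_mean_nonneg almost_periodic_diff almost_periodic_sum almost_periodic_const)
  also have "mean (\<lambda>x. (\<Sum>g\<in>F. f (x + g)) - of_real d) = of_nat (card F) * mean f - of_real d"
    using ap by (simp add: mean_diff mean_sum almost_periodic_sum mean_shift[OF f(1)])
  finally have "0 < real (card F) * Re (mean f)" using d by simp
  then show ?thesis by (simp add: zero_less_mult_iff)
qed

section \<open>The inner product and correlations of almost periodic functions\<close>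

lemmas almost_periodic_intros = almost_periodic_mult almost_periodic_cnj almost_periodic_add
  almost_periodic_diff almost_periodic_sum almost_periodic_const

text \<open>The inner product of the pre-Hilbert space of almost periodic functions;
  \<open>nsq\<close> is the square of its norm.\<close>

definition ip :: "('a::ab_group_add \<Rightarrow> complex) \<Rightarrow> ('a \<Rightarrow> complex) \<Rightarrow> complex" where
  "ip f g = mean (\<lambda>x. f x * cnj (g x))"

definition nsq :: "('a::ab_group_add \<Rightarrow> complex) \<Rightarrow> real" where
  "nsq f = Re (ip f f)"

lemma ip_commute: 
  assumes "almost_periodic f" "almost_periodic g" shows "ip g f = cnj (ip f g)"
proof -
  have "almost_periodic (\<lambda>x. f x * cnj (g x))" by (intro almost_periodic_intros assms)
  from mean_cnj[OF this] show ?thesis unfolding ip_def by (simp add: mult.commute)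
qed

lemma nsq_nonneg: "almost_periodic f \<Longrightarrow> nsq f \<ge> 0"
  unfolding nsq_def ip_def by (intro Re_mean_nonneg almost_periodic_intros) simp_all

lemma nsq_pos: 
  assumes "almost_periodic f" "f x \<noteq> 0" shows "nsq f > 0"
  unfolding nsq_def ip_def
proof (rule Re_mean_pos[of _ x])
  show "0 < Re (f x * cnj (f x))" using assms(2)
    by (simp add: complex_neq_0 flip: power2_eq_square)
qed (intro almost_periodic_intros assms, simp)

lemma ip_self: "almost_periodic f \<Longrightarrow> ip f f = of_real (nsq f)"
  using ip_commute[of f f] by (simp add: nsq_def complex_eq_iff)

lemma ip_add_left:
  "almost_periodic f \<Longrightarrow> almost_periodic g \<Longrightarrow> almost_periodic h
    \<Longrightarrow> ip (\<lambda>x. f x + g x) h = ip f h + ip g h"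
  unfolding ip_def distrib_right by (intro mean_add almost_periodic_intros)

lemma ip_diff_left:
  "almost_periodic f \<Longrightarrow> almost_periodic g \<Longrightarrow> almost_periodic h
    \<Longrightarrow> ip (\<lambda>x. f x - g x) h = ip f h - ip g h"
  unfolding ip_def left_diff_distrib by (intro mean_diff almost_periodic_intros)

lemma ip_diff_right:
  "almost_periodic f \<Longrightarrow> almost_periodic g \<Longrightarrow> almost_periodic h
    \<Longrightarrow> ip h (\<lambda>x. f x - g x) = ip h f - ip h g"
  unfolding ip_def complex_cnj_diff right_diff_distrib by (intro mean_diff almost_periodic_intros)

lemma ip_cmult_left:
  "almost_periodic f \<Longrightarrow> almost_periodic g \<Longrightarrow> ip (\<lambda>x. c * f x) g = c * ip f g"
  unfolding ip_def mult.assoc by (intro mean_cmult almost_periodic_intros)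

lemma ip_cmult_right:
  "almost_periodic f \<Longrightarrow> almost_periodic g \<Longrightarrow> ip f (\<lambda>x. c * g x) = cnj c * ip f g"
  unfolding ip_def complex_cnj_mult mult.left_commute[of _ "cnj c"]
  by (intro mean_cmult almost_periodic_intros)

lemma ip_shift:
  "almost_periodic f \<Longrightarrow> almost_periodic g \<Longrightarrow> ip (\<lambda>x. f (x + a)) (\<lambda>x. g (x + a)) = ip f g"
  unfolding ip_def by (rule mean_shift[of "\<lambda>x. f x * cnj (g x)"]) (intro almost_periodic_intros)

lemma nsq_shift: "almost_periodic f \<Longrightarrow> nsq (\<lambda>x. f (x + a)) = nsq f"
  unfolding nsq_def by (simp add: ip_shift)

lemma nsq_add_cmult:
  assumes f: "almost_periodic f" and g: "almost_periodic g"
  shows "nsq (\<lambda>x. f x + d * g x) = nsq f + 2 * Re (cnj d * ip f g) + (cmod d)\<^sup>2 * nsq g"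
proof -
  have dg: "almost_periodic (\<lambda>x. d * g x)" by (intro almost_periodic_intros g)
  have fdg: "almost_periodic (\<lambda>x. f x + d * g x)" by (intro almost_periodic_intros f g)
  have l: "ip (\<lambda>x. f x + d * g x) f = ip f f + d * cnj (ip f g)"
    by (simp only: ip_add_left[OF f dg f] ip_cmult_left[OF g f] ip_commute[OF f g])
  have r: "ip (\<lambda>x. f x + d * g x) (\<lambda>x. d * g x) = cnj d * (ip f g + d * ip g g)"
    by (simp only: ip_cmult_right[OF fdg g] ip_add_left[OF f dg g] ip_cmult_left[OF g g])
  have "ip (\<lambda>x. f x + d * g x) (\<lambda>x. f x + d * g x)
      = cnj (ip (\<lambda>x. f x + d * g x) f) + cnj (ip (\<lambda>x. f x + d * g x) (\<lambda>x. d * g x))"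
    by (simp only: ip_add_left[OF f dg fdg] ip_commute[OF fdg f] ip_commute[OF fdg dg])
  also have "\<dots> = of_real (nsq f) + cnj d * ip f g + d * cnj (ip f g) + d * cnj d * of_real (nsq g)"
    unfolding l r by (simp add: ip_self f g algebra_simps)
  finally show ?thesis unfolding nsq_def[of "\<lambda>x. f x + d * g x"]
    by (simp add: complex_mult_cnj cmod_power2 algebra_simps)
qed

lemma nsq_le:
  assumes "almost_periodic f" "\<And>x. cmod (f x) \<le> B" shows "nsq f \<le> B\<^sup>2"
proof -
  have "cmod (ip f f) \<le> B * B"
    unfolding ip_def using assms(2) norm_ge_zero order_trans
    by (intro mean_norm_le almost_periodic_intros assms)
       (auto simp: norm_mult intro!: mult_mono intro: order_trans[OF norm_ge_zero])
  then show ?thesis using abs_Re_le_cmod[of "ip f f"] unfolding nsq_def power2_eq_square by linarith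
qed

text \<open>The norm of \<open>f\<close> minus its orthogonal projection to \<open>g\<close> is nonnegative.\<close>

lemma Cauchy_Schwarz_ip:
  assumes f: "almost_periodic f" and g: "almost_periodic g"
  shows "(cmod (ip f g))\<^sup>2 \<le> nsq f * nsq g"
proof (cases "nsq g = 0")
  case True
  then have "g x = 0" for x using nsq_pos[OF g] by force
  then show ?thesis using True by (simp add: ip_def)
next
  case False
  then have pos: "nsq g > 0" using nsq_nonneg[OF g] by simp
  define d where "d = - ip f g / of_real (nsq g)"
  have "0 \<le> nsq (\<lambda>x. f x + d * g x)" by (intro nsq_nonneg almost_periodic_intros f g)
  also have "\<dots> = nsq f + 2 * Re (cnj d * ip f g) + (cmod d)\<^sup>2 * nsq g"
    by (rule nsq_add_cmult[OF f g])
  also have "cnj d * ip f g = - of_real ((cmod (ip f g))\<^sup>2 / nsq g)"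
    unfolding d_def by (simp add: complex_norm_square mult.commute del: of_real_power)
  also have "(cmod d)\<^sup>2 * nsq g = (cmod (ip f g))\<^sup>2 / nsq g"
    unfolding d_def using pos by (simp add: norm_divide power2_eq_square)
  finally have "(cmod (ip f g))\<^sup>2 / nsq g \<le> nsq f" by simp
  then show ?thesis using pos by (simp add: pos_divide_le_eq)
qed

text \<open>The correlation of \<open>f\<close> with \<open>g\<close>, which is the convolution of \<open>f\<close> with the function
  mapping \<open>x\<close> to \<open>cnj (g (- x))\<close>. For fixed \<open>g\<close> it is an operator in \<open>f\<close> that commutes with
  translations; \<open>corr f f\<close> is the autocorrelation of \<open>f\<close>.\<close>

definition corr :: "('a::ab_group_add \<Rightarrow> complex) \<Rightarrow> ('a \<Rightarrow> complex) \<Rightarrow> 'a \<Rightarrow> complex" where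
  "corr f g y = mean (\<lambda>x. f (x + y) * cnj (g x))"

lemma corr_ip: "corr f g y = ip (\<lambda>x. f (x + y)) g"
  unfolding corr_def ip_def ..

lemma corr_0: "corr f g 0 = ip f g"
  unfolding corr_def ip_def by simp

lemma corr_diff_left:
  "almost_periodic f \<Longrightarrow> almost_periodic g \<Longrightarrow> almost_periodic h
    \<Longrightarrow> corr (\<lambda>x. f x - g x) h y = corr f h y - corr g h y"
  unfolding corr_ip by (intro ip_diff_left almost_periodic_shift)

lemma corr_diff_right:
  "almost_periodic f \<Longrightarrow> almost_periodic g \<Longrightarrow> almost_periodic h
    \<Longrightarrow> corr h (\<lambda>x. f x - g x) y = corr h f y - corr h g y"
  unfolding corr_ip by (intro ip_diff_right almost_periodic_shift)

lemma corr_cmult_left: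
  "almost_periodic f \<Longrightarrow> almost_periodic g \<Longrightarrow> corr (\<lambda>x. c * f x) g y = c * corr f g y"
  unfolding corr_ip by (intro ip_cmult_left almost_periodic_shift)

lemma corr_norm_le:
  assumes "almost_periodic f" "almost_periodic g" "\<And>x. cmod (f x) \<le> A" "\<And>x. cmod (g x) \<le> B"
  shows "cmod (corr f g y) \<le> A * B"
  unfolding corr_def using assms(3,4)
  by (intro mean_norm_le almost_periodic_intros almost_periodic_shift assms)
     (auto simp: norm_mult intro!: mult_mono intro: order_trans[OF norm_ge_zero])

lemma corr_shift_left: 
  "corr (\<lambda>x. f (x + a)) g y = corr f g (y + a)"
  unfolding corr_def by (simp add: add_ac)

lemma corr_uminus:
  assumes "almost_periodic f" "almost_periodic g"
  shows "corr f g (- y) = cnj (corr g f y)"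
proof -
  have "almost_periodic (\<lambda>x. f (x + - y) * cnj (g x))"
    by (intro almost_periodic_intros almost_periodic_shift assms)
  from mean_shift[OF this, of y] have "corr f g (- y) = ip f (\<lambda>x. g (x + y))"
    unfolding corr_def ip_def by simp
  also have "\<dots> = cnj (corr g f y)"
    unfolding corr_ip using assms by (intro ip_commute almost_periodic_shift)
  finally show ?thesis .
qed

lemma almost_periodic_corr:
  assumes f: "almost_periodic f" and g: "almost_periodic g"
  shows "almost_periodic (corr f g)"
proof (rule almost_periodicI_periods[OF f])
  fix \<epsilon> :: real assume e: "\<epsilon> > 0"
  obtain B where B: "B > 0" "\<And>x. cmod (g x) \<le> B" using almost_periodic_bounded[OF g] by blast
  have "t \<in> periods (corr f g) \<epsilon>" if "t \<in> periods f (\<epsilon> / B)" for t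
  proof -
    have "cmod (corr f g (y + t) - corr f g y) \<le> \<epsilon> / B * B" for y
    proof -
      have "corr f g (y + t) - corr f g y = corr (\<lambda>x. f (x + t) - f x) g y"
        by (simp add: corr_diff_left almost_periodic_shift f g corr_shift_left)
      then show ?thesis
        using periodsD[OF that] B(2)
        by (simp only:) (intro corr_norm_le almost_periodic_intros almost_periodic_shift f g)
    qed
    then show ?thesis using B(1) by (simp add: periods_def)
  qed
  then show "\<exists>\<delta>>0. periods f \<delta> \<subseteq> periods (corr f g) \<epsilon>"
    using e B(1) by (intro exI[of _ "\<epsilon> / B"]) auto
qed

text \<open>Both sides are iterated means of \<open>f (x + y) * cnj (g x) * cnj (h y)\<close>, in the two possible
  orders. The inner mean is replaced by a finite average that is accurate uniformly in the outer
  variable, which exists because \<open>f\<close> has a totally bounded set of translates.\<close>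

lemma ip_corr_swap:
  assumes f: "almost_periodic f" and g: "almost_periodic g" and h: "almost_periodic h"
  shows "ip (corr f g) h = ip (corr f h) g"
proof -
  obtain B where B: "B > 0" "\<And>x. cmod (g x) \<le> B" using almost_periodic_bounded[OF g] by blast
  obtain A where A: "A > 0" "\<And>x. cmod (h x) \<le> A" using almost_periodic_bounded[OF h] by blast
  define F where "F y x = f (x + y) * cnj (g x)" for y x
  have F: "almost_periodic (F y)" for y
    unfolding F_def by (intro almost_periodic_intros almost_periodic_shift f g)
  have tb: "\<exists>X. finite X \<and> (\<forall>i. \<exists>j\<in>X. \<forall>y. cmod (F i y - F j y) \<le> \<delta>)" if "\<delta> > 0" for \<delta>
  proof -
    have "finitely_covering (periods f (\<delta> / B))"
      using f B(1) that unfolding almost_periodic_def by simp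
    then obtain X where X: "finite X" "\<And>x. \<exists>g\<in>X. x - g \<in> periods f (\<delta> / B)"
      using finitely_covering_reps by blast
    have "\<exists>j\<in>X. \<forall>y. cmod (F i y - F j y) \<le> \<delta>" for i
    proof -
      obtain j where j: "j \<in> X" "i - j \<in> periods f (\<delta> / B)" using X(2) by blast
      have "cmod (F i y - F j y) \<le> \<delta>" for y
      proof -
        have "cmod (f (y + j + (i - j)) - f (y + j)) \<le> \<delta> / B" using j(2) by (rule periodsD)
        then have "cmod (f (y + i) - f (y + j)) * cmod (g y) \<le> \<delta> / B * B"
          using B that by (intro mult_mono) auto
        then show ?thesis unfolding F_def using B(1)
          by (simp add: norm_mult flip: left_diff_distrib)
      qed
      then show ?thesis using j(1) by blast
    qed
    then show ?thesis using X(1) by blast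
  qed
  define G where "G x = corr f h x * cnj (g x)" for x
  have G: "almost_periodic G"
    unfolding G_def by (intro almost_periodic_intros almost_periodic_corr f g h)
  have "cmod (ip (corr f g) h - ip (corr f h) g) \<le> 0 + e" if "e > 0" for e
  proof -
    define d where "d = e / (A + 1)"
    have d: "d > 0" using that A(1) unfolding d_def by simp
    obtain xs where xs: "xs \<noteq> []" "\<And>y x. cmod (avg xs (F y) x - mean (F y)) \<le> d"
        "\<And>x. cmod (avg xs G x - mean G) \<le> d"
      using uniform_avg[OF F tb G d] by blast
    have corr_F: "corr f g y = mean (F y)" for y unfolding corr_def F_def ..
    have eq: "mean (\<lambda>y. avg xs (F y) 0 * cnj (h y)) = avg xs G 0"
    proof -
      have "almost_periodic (\<lambda>y. f (y + s) * cnj (h y))" for s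
        by (intro almost_periodic_intros almost_periodic_shift f h)
      then have "mean (\<lambda>y. \<Sum>s\<leftarrow>ys. (f (y + s) * cnj (h y)) * cnj (g s))
          = (\<Sum>s\<leftarrow>ys. corr f h s * cnj (g s)) \<and>
          almost_periodic (\<lambda>y. \<Sum>s\<leftarrow>ys. (f (y + s) * cnj (h y)) * cnj (g s))" for ys
        by (induction ys)
           (simp_all add: mean_add mean_multc corr_def almost_periodic_add almost_periodic_mult)
      moreover have "avg xs (F y) 0 * cnj (h y)
          = (\<Sum>s\<leftarrow>xs. (f (y + s) * cnj (h y)) * cnj (g s)) * inverse (of_nat (length xs))" for y
      proof -
        have "(\<Sum>s\<leftarrow>ys. F y s) * cnj (h y) = (\<Sum>s\<leftarrow>ys. (f (y + s) * cnj (h y)) * cnj (g s))" for ys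
          by (induction ys) (simp_all add: F_def algebra_simps)
        from this[of xs, symmetric] show ?thesis unfolding avg_def by (simp add: divide_inverse mult_ac)
      qed
      ultimately show ?thesis unfolding avg_def[of xs G] G_def
        by (simp add: mean_multc divide_inverse)
    qed
    have ap: "almost_periodic (\<lambda>y. avg xs (F y) 0 * cnj (h y))"
    proof -
      have "almost_periodic (\<lambda>y. f (s + y))" for s
        using almost_periodic_shift[OF f, of s] by (simp add: add.commute)
      then have "almost_periodic (\<lambda>y. \<Sum>s\<leftarrow>ys. F y (0 + s))" for ys
        unfolding F_def by (induction ys) (simp_all add: almost_periodic_add almost_periodic_mult)
      then show ?thesis unfolding avg_def divide_inverse
        by (intro almost_periodic_intros h)
    qed
    have "cmod (mean (\<lambda>y. corr f g y * cnj (h y)) - mean (\<lambda>y. avg xs (F y) 0 * cnj (h y))) \<le> d * A"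
    proof (intro mean_close ap almost_periodic_intros almost_periodic_corr f g h)
      fix y
      have "cmod (corr f g y - avg xs (F y) 0) * cmod (h y) \<le> d * A"
        using xs(2)[of y 0] A d unfolding corr_F by (intro mult_mono) (auto simp: norm_minus_commute)
      then show "cmod (corr f g y * cnj (h y) - avg xs (F y) 0 * cnj (h y)) \<le> d * A"
        by (simp add: norm_mult flip: left_diff_distrib)
    qed
    then have "cmod (ip (corr f g) h - avg xs G 0) \<le> d * A" unfolding ip_def eq .
    moreover have "cmod (avg xs G 0 - ip (corr f h) g) \<le> d"
      using xs(3)[of 0] unfolding ip_def G_def .
    ultimately have "cmod (ip (corr f g) h - ip (corr f h) g) \<le> d * A + d"
      by (rule norm_diff_triangle_le)
    also have "\<dots> = d * (A + 1)" by (simp add: algebra_simps)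
    also have "\<dots> = e" unfolding d_def using A(1) by simp
    finally show ?thesis by simp
  qed
  then have "cmod (ip (corr f g) h - ip (corr f h) g) \<le> 0" by (rule field_le_epsilon)
  then show ?thesis by simp
qed

text \<open>This commutation puts the autocorrelation of an eigenfunction of a correlation operator into
  the same eigenspace.\<close>

lemma corr_corr_swap:
  assumes f: "almost_periodic f" and g: "almost_periodic g" and h: "almost_periodic h"
  shows "corr (corr f g) h = corr (corr f h) g"
proof
  fix y
  have *: "corr (corr f u) v y = ip (corr (\<lambda>x. f (x + y)) u) v" for u v
  proof -
    have "corr (\<lambda>x. f (x + y)) u = (\<lambda>x. corr f u (x + y))" by (rule ext) (rule corr_shift_left)
    then show ?thesis unfolding corr_ip[of "corr f u"] by simp
  qed
  show "corr (corr f g) h y = corr (corr f h) g y"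
    unfolding * by (intro ip_corr_swap almost_periodic_shift f g h)
qed

section \<open>Compactness of the correlation operators\<close>

lemma uniform_limit_cmodI:
  assumes "\<And>e. e > 0 \<Longrightarrow> \<exists>N. \<forall>n\<ge>N. \<forall>x. cmod (F n x - f x) \<le> e"
  shows "uniform_limit UNIV F f sequentially"
  unfolding uniform_limit_sequentially_iff
proof (intro allI impI)
  fix e :: real assume "e > 0"
  then obtain N where "\<forall>n\<ge>N. \<forall>x. cmod (F n x - f x) \<le> e/2" using assms[of "e/2"] by auto
  then have "dist (F n x) (f x) < e" if "n \<ge> N" for n x
    using that \<open>e > 0\<close> unfolding dist_norm by (smt (verit) field_sum_of_halves)
  then show "\<exists>N. \<forall>n\<ge>N. \<forall>x\<in>UNIV. dist (F n x) (f x) < e" by meson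
qed

lemma uniform_limit_cmodD:
  assumes "uniform_limit UNIV F f sequentially" "e > 0"
  obtains N where "\<And>n x. n \<ge> N \<Longrightarrow> cmod (F n x - f x) \<le> e"
proof -
  obtain N where "\<forall>n\<ge>N. \<forall>x\<in>UNIV. dist (F n x) (f x) < e"
    using assms unfolding uniform_limit_sequentially_iff by blast
  then show ?thesis using that[of N] unfolding dist_norm by (meson UNIV_I less_imp_le)
qed

lemma almost_periodic_uniform_limit:
  assumes "uniform_limit UNIV F f sequentially" "\<And>n. almost_periodic (F n)"
  shows "almost_periodic f"
proof (rule almost_periodic_uniform_approx)
  fix e :: real assume "e > 0"
  then obtain N where "\<And>n x. n \<ge> N \<Longrightarrow> cmod (F n x - f x) \<le> e"
    using uniform_limit_cmodD[OF assms(1)] by metis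
  then show "\<exists>g. almost_periodic g \<and> (\<forall>x. cmod (f x - g x) \<le> e)"
    using assms(2) by (intro exI[of _ "F N"]) (simp add: norm_minus_commute)
qed

lemma corr_uniform_limit:
  assumes F: "uniform_limit UNIV F f sequentially" "\<And>n. almost_periodic (F n)"
    and G: "uniform_limit UNIV G g sequentially" "\<And>n. almost_periodic (G n)"
  shows "uniform_limit UNIV (\<lambda>n. corr (F n) (G n)) (corr f g) sequentially"
proof (rule uniform_limit_cmodI)
  fix e :: real assume e: "e > 0"
  note f = almost_periodic_uniform_limit[OF F] and g = almost_periodic_uniform_limit[OF G]
  obtain A where A: "A > 0" "\<And>x. cmod (f x) \<le> A" using almost_periodic_bounded[OF f] by blast
  obtain B where B: "B > 0" "\<And>x. cmod (g x) \<le> B" using almost_periodic_bounded[OF g] by blast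
  define d where "d = min 1 (e / (A + B + 1))"
  have d: "d > 0" "d \<le> 1" "d * (A + B + 1) \<le> e"
  proof -
    have pos: "A + B + 1 > 0" using A(1) B(1) by simp
    then show "d > 0" "d \<le> 1" using e unfolding d_def by simp_all
    have "d \<le> e / (A + B + 1)" unfolding d_def by simp
    then show "d * (A + B + 1) \<le> e" using pos by (simp only: pos_le_divide_eq)
  qed
  obtain M where M: "\<And>n x. n \<ge> M \<Longrightarrow> cmod (F n x - f x) \<le> d" using uniform_limit_cmodD[OF F(1) d(1)] by blast
  obtain N where N: "\<And>n x. n \<ge> N \<Longrightarrow> cmod (G n x - g x) \<le> d" using uniform_limit_cmodD[OF G(1) d(1)] by blast
  have "cmod (corr (F n) (G n) y - corr f g y) \<le> e" if n: "n \<ge> max M N" for n y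
  proof -
    have G_le: "cmod (G n x) \<le> B + 1" for x
      using N[of n x] B(2)[of x] n d(2) norm_triangle_ineq2[of "G n x" "g x"] by simp
    have "corr (F n) (G n) y - corr f g y
        = corr (\<lambda>x. F n x - f x) (G n) y + corr f (\<lambda>x. G n x - g x) y"
      using F(2) G(2) f g by (simp add: corr_diff_left corr_diff_right)
    also have "cmod \<dots> \<le> d * (B + 1) + A * d"
      using M[of n] N[of n] n G_le A(2)
      by (intro order_trans[OF norm_triangle_ineq] add_mono corr_norm_le almost_periodic_diff F G f g) auto
    also have "\<dots> = d * (A + B + 1)" by (simp add: algebra_simps)
    finally show ?thesis using d(3) by simp
  qed
  then show "\<exists>N. \<forall>n\<ge>N. \<forall>x. cmod (corr (F n) (G n) x - corr f g x) \<le> e" by blast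
qed

lemma ip_tendsto:
  assumes "uniform_limit UNIV F f sequentially" "\<And>n. almost_periodic (F n)"
    and "uniform_limit UNIV G g sequentially" "\<And>n. almost_periodic (G n)"
  shows "(\<lambda>n. ip (F n) (G n)) \<longlonglongrightarrow> ip f g"
  using tendsto_uniform_limitI[OF corr_uniform_limit[OF assms], of 0] by (simp add: corr_0)

lemma nsq_tendsto:
  assumes "uniform_limit UNIV F f sequentially" "\<And>n. almost_periodic (F n)"
  shows "(\<lambda>n. nsq (F n)) \<longlonglongrightarrow> nsq f"
  unfolding nsq_def by (intro tendsto_Re ip_tendsto assms)

text \<open>The theorem of Arzela and Ascoli: pointwise convergence on the countable set of all
  representatives of the covers becomes uniform by common almost periods.\<close>

lemma equi_almost_periodic_subsequence:
  fixes U :: "nat \<Rightarrow> 'a::ab_group_add \<Rightarrow> complex"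
  assumes B: "\<And>n x. cmod (U n x) \<le> B"
    and eq: "\<And>\<epsilon>. \<epsilon> > 0 \<Longrightarrow> finitely_covering (\<Inter>n. periods (U n) \<epsilon>)"
  obtains r g where "strict_mono (r :: nat \<Rightarrow> nat)" "uniform_limit UNIV (\<lambda>n. U (r n)) g sequentially"
proof -
  have "\<forall>m. \<exists>F. finite F \<and> (\<forall>x. \<exists>g\<in>F. x - g \<in> (\<Inter>n. periods (U n) (inverse (real (Suc m)))))"
  proof
    fix m
    have "finitely_covering (\<Inter>n. periods (U n) (inverse (real (Suc m))))" by (intro eq) simp
    then show "\<exists>F. finite F \<and> (\<forall>x. \<exists>g\<in>F. x - g \<in> (\<Inter>n. periods (U n) (inverse (real (Suc m)))))"
      using finitely_covering_reps by meson
  qed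
  from choice[OF this] obtain F where F: "\<And>m. finite (F m)"
      "\<And>m x. \<exists>g\<in>F m. x - g \<in> (\<Inter>n. periods (U n) (inverse (real (Suc m))))" by blast
  have "countable (\<Union>m. F m)" using F(1) by (simp add: countable_finite)
  then obtain r where r: "strict_mono (r :: nat \<Rightarrow> nat)"
      "\<And>x. x \<in> (\<Union>m. F m) \<Longrightarrow> \<exists>l. (\<lambda>n. U (r n) x) \<longlonglongrightarrow> l"
    using function_convergent_subsequence[of "\<Union>m. F m" U B] B by blast
  have "uniformly_Cauchy_on UNIV (\<lambda>n. U (r n))"
  proof (rule uniformly_Cauchy_onI)
    fix e :: real assume e: "e > 0"
    obtain m where m: "inverse (real (Suc m)) < e/4" using reals_Archimedean[of "e/4"] e by auto
    have "\<exists>N. \<forall>k\<ge>N. \<forall>l\<ge>N. cmod (U (r k) g - U (r l) g) < e/4" if "g \<in> F m" for g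
    proof -
      have "Cauchy (\<lambda>n. U (r n) g)" using r(2)[of g] that by (blast intro: LIMSEQ_imp_Cauchy)
      from metric_CauchyD[OF this, of "e/4"] show ?thesis using e unfolding dist_norm by simp
    qed
    then obtain N where N: "\<And>g k l. g \<in> F m \<Longrightarrow> k \<ge> N g \<Longrightarrow> l \<ge> N g \<Longrightarrow> cmod (U (r k) g - U (r l) g) < e/4"
      using bchoice[of "F m" "\<lambda>g N. \<forall>k\<ge>N. \<forall>l\<ge>N. cmod (U (r k) g - U (r l) g) < e/4"] by blast
    define M where "M = (\<Sum>g\<in>F m. N g)"
    have M: "N g \<le> M" if "g \<in> F m" for g
      unfolding M_def by (rule member_le_sum[OF that _ F(1)]) simp
    have "dist (U (r k) x) (U (r l) x) < e" if "k \<ge> M" "l \<ge> M" for x k l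
    proof -
      obtain g where g: "g \<in> F m" "\<And>n. x - g \<in> periods (U n) (inverse (real (Suc m)))"
        using F(2)[of m x] by auto
      have *: "cmod (U n x - U n g) < e/4" for n
        using periodsD[OF g(2), of n g] m by simp
      have 2: "cmod (U (r k) g - U (r l) g) < e/4"
        using N[OF g(1)] M[OF g(1)] that by (meson order_trans)
      have 3: "cmod (U (r l) g - U (r l) x) < e/4"
        using *[of "r l"] by (simp only: norm_minus_commute)
      have "cmod (U (r k) x - U (r l) x) < (e/4 + e/4) + e/4"
        by (rule norm_diff_triangle_less[OF norm_diff_triangle_less[OF *[of "r k"] 2] 3])
      then show ?thesis using e unfolding dist_norm by simp
    qed
    then show "\<exists>M. \<forall>x\<in>UNIV. \<forall>m\<ge>M. \<forall>n\<ge>M. dist (U (r m) x) (U (r n) x) < e" by blast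
  qed
  then obtain g where "uniform_limit UNIV (\<lambda>n. U (r n)) g sequentially"
    using Cauchy_uniformly_convergent unfolding uniformly_convergent_on_def by blast
  then show ?thesis using that r(1) by blast
qed

text \<open>By the Cauchy--Schwarz inequality an almost period of \<open>h\<close> is one of \<open>corr f h\<close> for every
  \<open>f\<close> in the unit ball, so the image of the unit ball is equi-almost-periodic.\<close>

lemma corr_periods:
  assumes f: "almost_periodic f" "nsq f \<le> 1" and h: "almost_periodic h" and "\<epsilon> > 0"
  shows "periods h \<epsilon> \<subseteq> periods (corr f h) \<epsilon>"
proof
  fix t assume "t \<in> periods h \<epsilon>"
  then have t: "- t \<in> periods h \<epsilon>" by (rule periods_uminus)
  have ap: "almost_periodic (\<lambda>x. h (x + - t) - h x)" by (intro almost_periodic_intros almost_periodic_shift h)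
  have "cmod (corr f h (y + t) - corr f h y) \<le> \<epsilon>" for y
  proof -
    have fy: "almost_periodic (\<lambda>x. f (x + y))" using f(1) by (rule almost_periodic_shift)
    have "corr f h (y + t) = ip (\<lambda>x. f (x + y)) (\<lambda>x. h (x + - t))"
    proof -
      have "almost_periodic (\<lambda>x. f (x + y) * cnj (h (x + - t)))"
        by (intro almost_periodic_intros almost_periodic_shift f h)
      from mean_shift[OF this, of t] show ?thesis unfolding corr_def ip_def by (simp add: add_ac)
    qed
    then have "corr f h (y + t) - corr f h y = ip (\<lambda>x. f (x + y)) (\<lambda>x. h (x + - t) - h x)"
      unfolding corr_ip[of f h y] by (simp only: ip_diff_right[OF almost_periodic_shift[OF h] h fy])
    then have "(cmod (corr f h (y + t) - corr f h y))\<^sup>2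
        \<le> nsq (\<lambda>x. f (x + y)) * nsq (\<lambda>x. h (x + - t) - h x)"
      using Cauchy_Schwarz_ip[OF fy ap] by simp
    also have "\<dots> \<le> 1 * \<epsilon>\<^sup>2"
      using nsq_le[OF ap, of \<epsilon>] periodsD[OF t] f nsq_nonneg[OF ap]
      by (intro mult_mono) (auto simp: nsq_shift[OF f(1)])
    finally show ?thesis using \<open>\<epsilon> > 0\<close> by (simp add: power2_le_iff_abs_le)
  qed
  then show "t \<in> periods (corr f h) \<epsilon>" by (simp add: periods_def)
qed

text \<open>Correlating with \<open>h\<close> is a compact operator, even from the norm of the mean to the
  supremum norm.\<close>

lemma corr_subsequence:
  assumes f: "\<And>n. almost_periodic (f n)" "\<And>n. nsq (f n) \<le> 1" and h: "almost_periodic h"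
  obtains r g where "strict_mono (r :: nat \<Rightarrow> nat)"
    "uniform_limit UNIV (\<lambda>n. corr (f (r n)) h) g sequentially"
proof (rule equi_almost_periodic_subsequence)
  fix n x
  have "(cmod (corr (f n) h x))\<^sup>2 \<le> nsq (\<lambda>z. f n (z + x)) * nsq h"
    unfolding corr_ip by (intro Cauchy_Schwarz_ip almost_periodic_shift f h)
  also have "\<dots> \<le> 1 * nsq h"
    using f(2) nsq_nonneg[OF h] by (intro mult_mono) (auto simp: nsq_shift[OF f(1)])
  finally show "cmod (corr (f n) h x) \<le> sqrt (nsq h)" by (simp add: real_le_rsqrt)
next
  fix \<epsilon> :: real assume e: "\<epsilon> > 0"
  have "periods h \<epsilon> \<subseteq> (\<Inter>n. periods (corr (f n) h) \<epsilon>)" using corr_periods[OF f h e] by blast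
  then show "finitely_covering (\<Inter>n. periods (corr (f n) h) \<epsilon>)"
    using h e finitely_covering_mono unfolding almost_periodic_def by blast
qed

section \<open>Existence of almost periodic characters\<close>

definition character :: "('a::ab_group_add \<Rightarrow> complex) \<Rightarrow> bool" where
  "character \<phi> \<longleftrightarrow> (\<forall>x y. \<phi> (x + y) = \<phi> x * \<phi> y) \<and> (\<forall>x. cmod (\<phi> x) = 1)"

lemma character_add: "character \<phi> \<Longrightarrow> \<phi> (x + y) = \<phi> x * \<phi> y"
  and character_norm: "character \<phi> \<Longrightarrow> cmod (\<phi> x) = 1"
  unfolding character_def by blast+

lemma character_0: "character \<phi> \<Longrightarrow> \<phi> 0 = 1"
  using character_add[of \<phi> 0 0] character_norm[of \<phi> 0] by auto

lemma character_uminus: "character \<phi> \<Longrightarrow> \<phi> (- x) = cnj (\<phi> x)"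
proof -
  assume c: "character \<phi>"
  have "\<phi> x * \<phi> (- x) = 1" using character_add[OF c, of x "- x"] character_0[OF c] by simp
  moreover have "cnj (\<phi> x) * \<phi> x = 1"
    using character_norm[OF c, of x] by (simp add: complex_norm_square[symmetric] mult.commute)
  ultimately show ?thesis by (metis mult.assoc mult.left_neutral mult.right_neutral)
qed

lemma nsq_cmult: "almost_periodic f \<Longrightarrow> nsq (\<lambda>x. c * f x) = (cmod c)\<^sup>2 * nsq f"
  using nsq_add_cmult[OF almost_periodic_const[of 0], of f c] by (simp add: nsq_def ip_def)

lemma corr_norm_sq_le:
  assumes "almost_periodic f" "almost_periodic g"
  shows "(cmod (corr f g y))\<^sup>2 \<le> nsq f * nsq g"
  using Cauchy_Schwarz_ip[OF almost_periodic_shift[OF assms(1), of y] assms(2)]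
  by (simp add: corr_ip nsq_shift[OF assms(1)])

lemma nsq_corr_le:
  assumes "almost_periodic f" "almost_periodic g"
  shows "nsq (corr f g) \<le> nsq f * nsq g"
proof -
  have "nsq f * nsq g \<ge> 0" using assms by (intro mult_nonneg_nonneg nsq_nonneg)
  then show ?thesis
    using nsq_le[OF almost_periodic_corr[OF assms], of "sqrt (nsq f * nsq g)"]
      corr_norm_sq_le[OF assms] by (simp add: real_le_rsqrt)
qed

lemma ip_corr_self_adjoint:
  assumes f: "almost_periodic f" and g: "almost_periodic g" and h: "almost_periodic h"
    and herm: "\<And>x. h (- x) = cnj (h x)"
  shows "ip (corr f h) g = ip f (corr g h)"
proof -
  have ap: "almost_periodic (\<lambda>y. corr f g y * cnj (h y))"
    by (intro almost_periodic_intros almost_periodic_corr f g h)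
  have "ip f (corr g h) = cnj (ip (corr g f) h)"
    using ip_commute[OF almost_periodic_corr[OF g h] f] ip_corr_swap[OF g h f] by simp
  also have "\<dots> = mean (\<lambda>y. cnj (corr g f y * cnj (h y)))"
    unfolding ip_def by (intro mean_cnj[symmetric] almost_periodic_intros almost_periodic_corr f g h)
  also have "\<dots> = mean (\<lambda>y. corr f g (- y) * cnj (h (- y)))"
    by (simp add: corr_uminus f g herm)
  also have "\<dots> = ip (corr f g) h" unfolding ip_def by (rule mean_reflect[OF ap])
  also have "\<dots> = ip (corr f h) g" by (rule ip_corr_swap[OF f g h])
  finally show ?thesis ..
qed

text \<open>Write \<open>A f = corr f h\<close> and let \<open>L\<close> be the square of the norm of the self-adjoint operator
  \<open>A\<close>. For unit vectors \<open>f n\<close> with \<open>\<parallel>A (f n)\<parallel>\<^sup>2 \<longlonglongrightarrow> L\<close> the vectors \<open>A (A (f n)) - L * f n\<close> tend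
  to 0, and by compactness \<open>A (f n)\<close> converges along a subsequence, to an eigenvector of \<open>A\<^sup>2\<close>. Using
  \<open>A\<^sup>2\<close> avoids deciding whether \<open>sqrt L\<close> or its negative is an eigenvalue of \<open>A\<close>.\<close>

lemma eigenfunction_exists:
  assumes h: "almost_periodic h" and herm: "\<And>x. h (- x) = cnj (h x)" and nz: "h x0 \<noteq> 0"
  obtains L u where "L > 0" "almost_periodic u" "nsq u > 0"
    "corr (corr u h) h = (\<lambda>x. of_real L * u x)"
proof -
  define V where "V = {nsq (corr f h) | f. almost_periodic f \<and> nsq f \<le> 1}"
  define L where "L = Sup V"
  have bdd: "bdd_above V"
  proof (rule bdd_aboveI)
    fix v assume "v \<in> V"
    then obtain f where f: "almost_periodic f" "nsq f \<le> 1" "v = nsq (corr f h)" unfolding V_def by blast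
    have "v \<le> nsq f * nsq h" unfolding f(3) by (rule nsq_corr_le[OF f(1) h])
    also have "\<dots> \<le> 1 * nsq h" using f(2) nsq_nonneg[OF h] by (intro mult_right_mono)
    finally show "v \<le> nsq h" by simp
  qed
  have V0: "nsq (corr (\<lambda>x. 0) h) \<in> V" unfolding V_def
    by (intro CollectI exI[of _ "\<lambda>x. 0"]) (simp add: nsq_def ip_def)
  have scale: "nsq (corr f h) \<le> L * nsq f" if f: "almost_periodic f" for f
  proof (cases "nsq f = 0")
    case True
    then have "nsq (corr f h) \<le> 0" using nsq_corr_le[OF f h] by simp
    then show ?thesis using True by simp
  next
    case False
    then have pos: "nsq f > 0" using nsq_nonneg[OF f] by simp
    define s where "s = complex_of_real (1 / sqrt (nsq f))"
    have s: "(cmod s)\<^sup>2 = 1 / nsq f" unfolding s_def using pos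
      by (simp add: norm_divide power_divide)
    have "nsq (\<lambda>x. s * f x) = 1" using pos by (simp add: nsq_cmult[OF f] s)
    then have "nsq (corr (\<lambda>x. s * f x) h) \<in> V" unfolding V_def using f
      by (intro CollectI exI[of _ "\<lambda>x. s * f x"]) (simp add: almost_periodic_cmult)
    moreover have "corr (\<lambda>x. s * f x) h = (\<lambda>y. s * corr f h y)"
      by (rule ext) (rule corr_cmult_left[OF f h])
    ultimately have "(cmod s)\<^sup>2 * nsq (corr f h) \<in> V"
      by (simp add: nsq_cmult almost_periodic_corr f h)
    then have "(cmod s)\<^sup>2 * nsq (corr f h) \<le> L" unfolding L_def using bdd by (rule cSup_upper)
    then show ?thesis using pos by (simp add: s pos_divide_le_eq)
  qed
  have "nsq h > 0" using nsq_pos[OF h nz] .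
  have "L > 0"
  proof -
    have "corr h h 0 \<noteq> 0" using \<open>nsq h > 0\<close> by (simp add: corr_0 ip_self[OF h])
    then have "0 < nsq (corr h h)" by (rule nsq_pos[OF almost_periodic_corr[OF h h]])
    also have "\<dots> \<le> L * nsq h" by (rule scale[OF h])
    finally show ?thesis using \<open>nsq h > 0\<close> by (simp add: zero_less_mult_iff)
  qed
  have "\<forall>n::nat. \<exists>f. almost_periodic f \<and> nsq f \<le> 1 \<and> L - inverse (real (Suc n)) < nsq (corr f h)"
  proof
    fix n :: nat
    have "L - inverse (real (Suc n)) < Sup V" unfolding L_def by simp
    then obtain v where "v \<in> V" "L - inverse (real (Suc n)) < v"
      using less_cSup_iff[OF _ bdd] V0 by blast
    then show "\<exists>f. almost_periodic f \<and> nsq f \<le> 1 \<and> L - inverse (real (Suc n)) < nsq (corr f h)"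
      unfolding V_def by blast
  qed
  from choice[OF this] obtain f where f: "\<And>n::nat. almost_periodic (f n)" "\<And>n. nsq (f n) \<le> 1"
      "\<And>n. L - inverse (real (Suc n)) < nsq (corr (f n) h)" by blast
  obtain r u where r: "strict_mono r" and u: "uniform_limit UNIV (\<lambda>n. corr (f (r n)) h) u sequentially"
    using corr_subsequence[of f h] f h by blast
  define F where "F n = corr (f (r n)) h" for n
  have F: "almost_periodic (F n)" for n unfolding F_def by (intro almost_periodic_corr f h)
  have Fu: "uniform_limit UNIV F u sequentially" using u unfolding F_def .
  have ap_u: "almost_periodic u" by (rule almost_periodic_uniform_limit[OF Fu F])
  have nsq_le_L: "nsq (F n) \<le> L" for n
  proof -
    have "nsq (F n) \<le> L * nsq (f (r n))" unfolding F_def by (intro scale f)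
    also have "\<dots> \<le> L * 1" using f(2) \<open>L > 0\<close> by (intro mult_left_mono) auto
    finally show ?thesis by simp
  qed
  have lim: "(\<lambda>n. nsq (F n)) \<longlonglongrightarrow> L"
  proof (rule tendsto_sandwich)
    have "(\<lambda>n. L - inverse (real (Suc n))) \<longlonglongrightarrow> L - 0"
      by (intro tendsto_diff tendsto_const LIMSEQ_inverse_real_of_nat)
    then show "((\<lambda>n. L - inverse (real (Suc n))) \<circ> r) \<longlonglongrightarrow> L"
      using LIMSEQ_subseq_LIMSEQ[OF _ r] by simp
    show "eventually (\<lambda>n. ((\<lambda>n. L - inverse (real (Suc n))) \<circ> r) n \<le> nsq (F n)) sequentially"
      using f(3) by (simp add: F_def less_imp_le)
  qed (use nsq_le_L in auto)
  then have "nsq u = L" using LIMSEQ_unique[OF nsq_tendsto[OF Fu F]] by blast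
  \<comment> \<open>\<open>D n\<close> is the defect \<open>A (A f) - L * f\<close> of the approximate eigenvector; it tends to 0 in norm, but only its image under \<open>A\<close> converges uniformly.\<close>
  define D where "D n = (\<lambda>x. corr (F n) h x + (- of_real L) * f (r n) x)" for n
  have D: "almost_periodic (D n)" for n
    unfolding D_def by (intro almost_periodic_intros almost_periodic_corr F f h)
  have D_small: "nsq (D n) \<le> L * (L - nsq (F n))" for n
  proof -
    have "ip (corr (F n) h) (f (r n)) = ip (F n) (F n)"
      using ip_corr_self_adjoint[OF F f(1) h herm] unfolding F_def .
    then have "nsq (D n) = nsq (corr (F n) h) - 2 * L * nsq (F n) + L\<^sup>2 * nsq (f (r n))"
      unfolding D_def
      by (subst nsq_add_cmult) (simp_all add: almost_periodic_corr F f h ip_self)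
    also have "\<dots> \<le> L * nsq (F n) - 2 * L * nsq (F n) + L\<^sup>2 * 1"
      using scale[OF F, of n] mult_left_mono[OF f(2)[of "r n"], of "L\<^sup>2"] by simp
    finally show ?thesis by (simp add: algebra_simps power2_eq_square)
  qed
  define W where "W n = corr (corr (F n) h) h" for n
  define w where "w = (\<lambda>x. corr (corr u h) h x - of_real L * u x)"
  have ap_w: "almost_periodic w"
    unfolding w_def by (intro almost_periodic_intros almost_periodic_corr ap_u h)
  have hh: "uniform_limit UNIV (\<lambda>n::nat. h) h sequentially" by (rule uniform_limit_const)
  have "uniform_limit UNIV (\<lambda>n. corr (corr (F n) h) h) (corr (corr u h) h) sequentially"
    by (intro corr_uniform_limit hh Fu F h almost_periodic_corr)
  moreover have "uniform_limit UNIV (\<lambda>n x. of_real L * F n x) (\<lambda>x. of_real L * u x) sequentially"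
    by (intro bounded_linear.uniform_limit[OF bounded_linear_mult_right] Fu)
  ultimately have "uniform_limit UNIV (\<lambda>n x. corr (corr (F n) h) h x - of_real L * F n x) w sequentially"
    unfolding w_def by (rule uniform_limit_minus)
  moreover have "corr (D n) h = (\<lambda>x. corr (corr (F n) h) h x - of_real L * F n x)" for n
  proof
    fix x
    have "corr (D n) h x = corr (\<lambda>x. corr (F n) h x - of_real L * f (r n) x) h x"
      unfolding D_def by simp
    also have "\<dots> = corr (corr (F n) h) h x - of_real L * corr (f (r n)) h x"
      by (simp add: corr_diff_left corr_cmult_left almost_periodic_corr almost_periodic_cmult F f h)
    finally show "corr (D n) h x = corr (corr (F n) h) h x - of_real L * F n x" unfolding F_def .
  qed
  ultimately have Dw: "uniform_limit UNIV (\<lambda>n. corr (D n) h) w sequentially" by simp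
  have "nsq w \<le> 0"
  proof (rule LIMSEQ_le)
    show "(\<lambda>n. nsq (corr (D n) h)) \<longlonglongrightarrow> nsq w"
      by (intro nsq_tendsto[OF Dw] almost_periodic_corr D h)
    have "(\<lambda>n. L * (L * (L - nsq (F n)))) \<longlonglongrightarrow> L * (L * (L - L))"
      by (intro tendsto_intros lim)
    then show "(\<lambda>n. L * (L * (L - nsq (F n)))) \<longlonglongrightarrow> 0" by simp
    have "nsq (corr (D n) h) \<le> L * (L * (L - nsq (F n)))" for n
      using scale[OF D, of n] mult_left_mono[OF D_small[of n], of L] \<open>L > 0\<close> by linarith
    then show "\<exists>N. \<forall>n\<ge>N. nsq (corr (D n) h) \<le> L * (L * (L - nsq (F n)))" by blast
  qed
  then have "w x = 0" for x using nsq_pos[OF ap_w, of x] by force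
  then have "corr (corr u h) h = (\<lambda>x. of_real L * u x)" unfolding w_def by (auto simp: fun_eq_iff)
  then show ?thesis using that \<open>L > 0\<close> ap_u \<open>nsq u = L\<close> by auto
qed

text \<open>An eigenfunction is \<open>1 / L\<close> times a value of the compact operator, so the unit sphere of
  the eigenspace is compact in the supremum norm and the continuous functional
  \<open>nsq (corr f f)\<close> attains its maximum there. The last conclusion is the maximality, extended
  to the whole eigenspace by homogeneity of degree 4.\<close>

lemma maximal_autocorrelation_exists:
  assumes h: "almost_periodic h" and "L > 0"
    and u: "almost_periodic u" "nsq u > 0" "corr (corr u h) h = (\<lambda>x. of_real L * u x)"
  obtains f where "almost_periodic f" "nsq f = 1" "corr (corr f h) h = (\<lambda>x. of_real L * f x)"
    "\<And>g. almost_periodic g \<Longrightarrow> corr (corr g h) h = (\<lambda>x. of_real L * g x)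
       \<Longrightarrow> nsq (corr g g) \<le> nsq (corr f f) * (nsq g)\<^sup>2"
proof -
  define W where "W = {f. almost_periodic f \<and> corr (corr f h) h = (\<lambda>x. of_real L * f x)}"
  define V where "V = {nsq (corr f f) | f. f \<in> W \<and> nsq f = 1}"
  define S where "S = Sup V"
  have bdd: "bdd_above V"
  proof (rule bdd_aboveI)
    fix v assume "v \<in> V"
    then show "v \<le> 1" unfolding V_def W_def using nsq_corr_le by fastforce
  qed
  have W_scale: "(\<lambda>x. s * f x) \<in> W" if f: "f \<in> W" for f s
  proof -
    have ap: "almost_periodic f" and eq: "corr (corr f h) h = (\<lambda>x. of_real L * f x)"
      using f unfolding W_def by auto
    have "corr (\<lambda>x. s * f x) h = (\<lambda>x. s * corr f h x)"
      by (rule ext) (rule corr_cmult_left[OF ap h])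
    moreover have "corr (\<lambda>x. s * corr f h x) h = (\<lambda>x. s * corr (corr f h) h x)"
      by (rule ext) (rule corr_cmult_left[OF almost_periodic_corr[OF ap h] h])
    ultimately have "corr (corr (\<lambda>x. s * f x) h) h = (\<lambda>x. s * corr (corr f h) h x)" by simp
    then show ?thesis unfolding W_def eq by (simp add: almost_periodic_cmult ap mult.left_commute)
  qed
  have corr_scale: "corr (\<lambda>x. s * f x) (\<lambda>x. s * f x) = (\<lambda>x. of_real ((cmod s)\<^sup>2) * corr f f x)"
    if f: "almost_periodic f" for f s
  proof
    fix x
    have sf: "almost_periodic (\<lambda>x. s * f x)" using f by (rule almost_periodic_cmult)
    have "corr (\<lambda>x. s * f x) (\<lambda>x. s * f x) x = s * (cnj s * corr f f x)"
      by (simp only: corr_cmult_left[OF f sf])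
         (simp only: corr_ip ip_cmult_right[OF almost_periodic_shift[OF f] f])
    then show "corr (\<lambda>x. s * f x) (\<lambda>x. s * f x) x = of_real ((cmod s)\<^sup>2) * corr f f x"
      by (simp add: complex_norm_square del: of_real_power)
  qed
  have scale: "\<exists>v\<in>V. nsq (corr g g) = v * (nsq g)\<^sup>2" if g: "g \<in> W" "nsq g > 0" for g
  proof -
    have ap: "almost_periodic g" using g unfolding W_def by auto
    define s where "s = complex_of_real (1 / sqrt (nsq g))"
    have s: "(cmod s)\<^sup>2 = 1 / nsq g" unfolding s_def using g(2)
      by (simp add: norm_divide power_divide)
    have "nsq (\<lambda>x. s * g x) = 1" using g(2) by (simp add: nsq_cmult[OF ap] s)
    then have "nsq (corr (\<lambda>x. s * g x) (\<lambda>x. s * g x)) \<in> V" unfolding V_def using W_scale[OF g(1)] by blast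
    moreover have "nsq (corr (\<lambda>x. s * g x) (\<lambda>x. s * g x)) = (1 / nsq g)\<^sup>2 * nsq (corr g g)"
      unfolding corr_scale[OF ap] s using g(2)
      by (subst nsq_cmult) (simp_all add: almost_periodic_corr ap norm_divide power_divide)
    moreover have "nsq (corr g g) = ((1 / nsq g)\<^sup>2 * nsq (corr g g)) * (nsq g)\<^sup>2"
      using g(2) by (simp add: power_divide)
    ultimately show ?thesis by metis
  qed
  have "u \<in> W" using u unfolding W_def by blast
  then have "V \<noteq> {}" using scale u(2) by blast
  have max: "nsq (corr g g) \<le> S * (nsq g)\<^sup>2" if g: "g \<in> W" for g
  proof (cases "nsq g > 0")
    case True
    then obtain v where v: "v \<in> V" "nsq (corr g g) = v * (nsq g)\<^sup>2" using scale g by blast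
    have "v \<le> S" unfolding S_def using v(1) bdd by (rule cSup_upper)
    then show ?thesis unfolding v(2) by (intro mult_right_mono) auto
  next
    case False
    then have "nsq g = 0" using nsq_nonneg g unfolding W_def by force
    then show ?thesis using nsq_corr_le[of g g] g unfolding W_def by simp
  qed
  have "\<forall>n::nat. \<exists>f. f \<in> W \<and> nsq f = 1 \<and> S - inverse (real (Suc n)) < nsq (corr f f)"
  proof
    fix n :: nat
    have "S - inverse (real (Suc n)) < Sup V" unfolding S_def by simp
    then obtain v where "v \<in> V" "S - inverse (real (Suc n)) < v"
      using less_cSup_iff[OF \<open>V \<noteq> {}\<close> bdd] by blast
    moreover from \<open>v \<in> V\<close> obtain f where "v = nsq (corr f f)" "f \<in> W" "nsq f = 1"
      unfolding V_def by blast
    ultimately show "\<exists>f. f \<in> W \<and> nsq f = 1 \<and> S - inverse (real (Suc n)) < nsq (corr f f)"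
      by (intro exI[of _ f]) simp
  qed
  from choice[OF this] obtain f where f: "\<And>n::nat. f n \<in> W" "\<And>n. nsq (f n) = 1"
      "\<And>n. S - inverse (real (Suc n)) < nsq (corr (f n) (f n))" by blast
  have ap_f: "almost_periodic (f n)" and eq_f: "corr (corr (f n) h) h = (\<lambda>x. of_real L * f n x)" for n
    using f(1) unfolding W_def by auto
  obtain r g where r: "strict_mono r" and g: "uniform_limit UNIV (\<lambda>n. corr (f (r n)) h) g sequentially"
    using corr_subsequence[of f h] ap_f f(2) h by (metis order_refl)
  define F where "F n = f (r n)" for n
  have F: "almost_periodic (F n)" "corr (corr (F n) h) h = (\<lambda>x. of_real L * F n x)" "nsq (F n) = 1" for n
    unfolding F_def using ap_f eq_f f(2) by auto
  have hh: "uniform_limit UNIV (\<lambda>n::nat. h) h sequentially" by (rule uniform_limit_const)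
  \<comment> \<open>\<open>F n\<close> equals \<open>1 / L\<close> times \<open>A\<close> applied to the convergent sequence, so \<open>F n\<close> itself converges uniformly, to \<open>k\<close>.\<close>
  define k where "k = (\<lambda>x. of_real (1 / L) * corr g h x)"
  have "uniform_limit UNIV (\<lambda>n. corr (corr (F n) h) h) (corr g h) sequentially"
    unfolding F_def by (intro corr_uniform_limit hh g ap_f h almost_periodic_corr)
  then have "uniform_limit UNIV (\<lambda>n x. of_real (1 / L) * corr (corr (F n) h) h x) k sequentially"
    unfolding k_def by (intro bounded_linear.uniform_limit[OF bounded_linear_mult_right])
  then have Fk: "uniform_limit UNIV F k sequentially"
    unfolding F(2) using \<open>L > 0\<close> by simp
  have ap_k: "almost_periodic k" by (rule almost_periodic_uniform_limit[OF Fk F(1)])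
  have "corr (corr k h) h x = of_real L * k x" for x
  proof (rule LIMSEQ_unique)
    have "uniform_limit UNIV (\<lambda>n. corr (corr (F n) h) h) (corr (corr k h) h) sequentially"
      by (intro corr_uniform_limit hh Fk F h almost_periodic_corr)
    then show "(\<lambda>n. corr (corr (F n) h) h x) \<longlonglongrightarrow> corr (corr k h) h x"
      by (rule tendsto_uniform_limitI) simp
    have "(\<lambda>n. F n x) \<longlonglongrightarrow> k x" using Fk by (rule tendsto_uniform_limitI) simp
    then show "(\<lambda>n. corr (corr (F n) h) h x) \<longlonglongrightarrow> of_real L * k x"
      unfolding F(2) by (intro tendsto_mult tendsto_const)
  qed
  then have eq_k: "corr (corr k h) h = (\<lambda>x. of_real L * k x)" by blast
  have nsq_k: "nsq k = 1"
    using LIMSEQ_unique[OF nsq_tendsto[OF Fk F(1)]] F(3) by simp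
  have "S \<le> nsq (corr k k)"
  proof (rule LIMSEQ_le)
    have "(\<lambda>n. S - inverse (real (Suc n))) \<longlonglongrightarrow> S - 0"
      by (intro tendsto_diff tendsto_const LIMSEQ_inverse_real_of_nat)
    then show "((\<lambda>n. S - inverse (real (Suc n))) \<circ> r) \<longlonglongrightarrow> S"
      using LIMSEQ_subseq_LIMSEQ[OF _ r] by simp
    show "(\<lambda>n. nsq (corr (F n) (F n))) \<longlonglongrightarrow> nsq (corr k k)"
      by (intro nsq_tendsto corr_uniform_limit Fk F almost_periodic_corr)
    show "\<exists>N. \<forall>n\<ge>N. ((\<lambda>n. S - inverse (real (Suc n))) \<circ> r) n \<le> nsq (corr (F n) (F n))"
      using f(3) by (auto simp: F_def less_imp_le)
  qed
  then have "nsq (corr g g) \<le> nsq (corr k k) * (nsq g)\<^sup>2"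
    if "almost_periodic g" "corr (corr g h) h = (\<lambda>x. of_real L * g x)" for g
    using max[of g] that mult_right_mono[of S "nsq (corr k k)" "(nsq g)\<^sup>2"]
    unfolding W_def by fastforce
  then show ?thesis using that ap_k nsq_k eq_k by blast
qed

text \<open>If \<open>f\<close> is a combination of characters with coefficients \<open>c\<^sub>i\<close>, the maximised quantity is
  \<open>\<Sum> \<bar>c\<^sub>i\<bar>\<^sup>4\<close> under the constraint \<open>\<Sum> \<bar>c\<^sub>i\<bar>\<^sup>2 = 1\<close>, and the maximum 1 forces a single character. Without
  knowing such an expansion one compares \<open>f\<close> with \<open>f \<plusminus> c f\<^sub>y\<close>, where \<open>f\<^sub>y\<close> is a translate and
  \<open>\<bar>c\<bar> = 1\<close>: the autocorrelation \<open>\<phi>\<close> is a convex combination of the normalised autocorrelations of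
  the two perturbations, and strict convexity of the norm makes all three proportional. This
  proportionality, for \<open>c = 1\<close> and \<open>c = \<i>\<close>, says that \<open>\<phi>\<close> is multiplicative.\<close>

lemma maximal_autocorrelation_is_character:
  assumes f: "almost_periodic f" "nsq f = 1"
    and max: "\<And>d y. nsq (corr (\<lambda>x. f x + d * f (x + y)) (\<lambda>x. f x + d * f (x + y)))
      \<le> nsq (corr f f) * (nsq (\<lambda>x. f x + d * f (x + y)))\<^sup>2"
  shows "character (corr f f)"
proof -
  define \<phi> where "\<phi> = corr f f"
  have ap: "almost_periodic \<phi>" unfolding \<phi>_def by (rule almost_periodic_corr[OF f(1) f(1)])
  have \<phi>0: "\<phi> 0 = 1" unfolding \<phi>_def by (simp add: corr_0 ip_self f)
  have \<phi>m: "\<phi> (- y) = cnj (\<phi> y)" for y unfolding \<phi>_def by (rule corr_uminus[OF f(1) f(1)])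
  have \<phi>_le: "cmod (\<phi> y) \<le> 1" for y
    using corr_norm_sq_le[OF f(1) f(1), of y] f(2) unfolding \<phi>_def by (simp add: power_le_one_iff)
  have key: "c * \<phi> (x + y) + cnj c * \<phi> (x - y) = of_real (2 * Re (c * \<phi> y)) * \<phi> x"
    if c: "cmod c = 1" for c x y
  proof -
    define w where "w = 2 * Re (c * \<phi> y)"
    define \<kappa> where "\<kappa> = (\<lambda>x. c * \<phi> (x + y) + cnj c * \<phi> (x - y))"
    have w_le: "\<bar>w\<bar> \<le> 2"
      using abs_Re_le_cmod[of "c * \<phi> y"] \<phi>_le[of y] c unfolding w_def by (simp add: norm_mult)
    have ap_shift: "almost_periodic (\<lambda>x. \<phi> (x - y))"
      using almost_periodic_shift[OF ap, of "- y"] by simp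
    have ap_\<kappa>: "almost_periodic \<kappa>"
      unfolding \<kappa>_def by (intro almost_periodic_intros almost_periodic_shift ap ap_shift)
    \<comment> \<open>Up to the sign \<open>s\<close> this is the autocorrelation of \<open>f + s * c * f\<^sub>y\<close>, whose squared norm is \<open>2 + s * w\<close>.\<close>
    have main: "nsq (\<lambda>x. \<kappa> x + of_real (2 * s) * \<phi> x) \<le> nsq \<phi> * (2 + s * w)\<^sup>2"
      if s: "s = 1 \<or> s = -1" for s :: real
    proof -
      define d where "d = of_real s * c"
      have d: "cmod d = 1" "d * cnj d = 1"
        using s c unfolding d_def by (auto simp: norm_mult complex_norm_square[symmetric])
      define g where "g = (\<lambda>x. f (x + y))"
      define k where "k = (\<lambda>x. f x + d * g x)"
      have g: "almost_periodic g" unfolding g_def by (rule almost_periodic_shift[OF f(1)])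
      have dg: "almost_periodic (\<lambda>x. d * g x)" by (rule almost_periodic_cmult[OF g])
      have k: "almost_periodic k" unfolding k_def by (rule almost_periodic_add[OF f(1) dg])
      have corr_gf: "corr g f x = \<phi> (x + y)" for x
        unfolding g_def \<phi>_def by (rule corr_shift_left)
      have corr_fg: "corr f g x = \<phi> (x - y)" for x
      proof -
        have "corr f g x = cnj (corr g f (- x))" using corr_uminus[OF f(1) g, of "- x"] by simp
        also have "\<dots> = \<phi> (- (- x + y))" unfolding corr_gf \<phi>m by simp
        finally show ?thesis by simp
      qed
      have corr_gg: "corr g g x = \<phi> x" for x
      proof -
        have "corr g g x = ip (\<lambda>z. f (z + y + x)) (\<lambda>z. f (z + y))"
          unfolding corr_ip g_def by (simp add: add_ac)
        also have "\<dots> = ip (\<lambda>z. f (z + x)) f"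
          by (rule ip_shift[OF almost_periodic_shift[OF f(1), of x] f(1), of y])
        finally show ?thesis unfolding \<phi>_def corr_ip .
      qed
      have split: "corr u k x = corr u f x + cnj d * corr u g x" if u: "almost_periodic u" for u x
      proof -
        have "corr u (\<lambda>x. f x - (- d) * g x) x = corr u f x - corr u (\<lambda>x. (- d) * g x) x"
          by (intro corr_diff_right almost_periodic_cmult f g u)
        also have "corr u (\<lambda>x. (- d) * g x) x = cnj (- d) * corr u g x"
          unfolding corr_ip by (intro ip_cmult_right almost_periodic_shift u g)
        finally show ?thesis unfolding k_def by simp
      qed
      have "corr k k x = corr f k x + d * corr g k x" for x
      proof -
        have "corr (\<lambda>x. f x - (- d) * g x) k x = corr f k x - corr (\<lambda>x. (- d) * g x) k x"
          by (intro corr_diff_left almost_periodic_cmult f g k)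
        also have "corr (\<lambda>x. (- d) * g x) k x = (- d) * corr g k x"
          by (intro corr_cmult_left g k)
        finally show ?thesis unfolding k_def by simp
      qed
      then have "corr k k x = (1 + d * cnj d) * \<phi> x + (d * \<phi> (x + y) + cnj d * \<phi> (x - y))" for x
        unfolding split[OF f(1)] split[OF g] corr_fg corr_gf corr_gg \<phi>_def[symmetric]
        by (simp add: algebra_simps)
      then have "corr k k x = 2 * \<phi> x + (d * \<phi> (x + y) + cnj d * \<phi> (x - y))" for x
        unfolding d(2) by simp
      then have kk: "corr k k x = of_real s * (\<kappa> x + of_real (2 * s) * \<phi> x)" for x
        unfolding \<kappa>_def d_def using s by (auto simp: algebra_simps)
      have nsq_kk: "nsq (corr k k) = nsq (\<lambda>x. \<kappa> x + of_real (2 * s) * \<phi> x)"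
      proof -
        have "corr k k = (\<lambda>x. of_real s * (\<kappa> x + of_real (2 * s) * \<phi> x))" using kk by blast
        then show ?thesis using s
          by (simp only:, subst nsq_cmult, intro almost_periodic_intros ap ap_\<kappa>) auto
      qed
      have "nsq k = 2 + s * w"
      proof -
        have "ip k k = corr k k 0" by (simp add: corr_0)
        also have "\<dots> = of_real s * (c * \<phi> y + cnj c * cnj (\<phi> y) + of_real (2 * s))"
          unfolding kk \<kappa>_def by (simp add: \<phi>0 \<phi>m)
        finally show ?thesis unfolding nsq_def w_def using s by auto
      qed
      moreover have "nsq (corr k k) \<le> nsq \<phi> * (nsq k)\<^sup>2"
        using max[of d y] unfolding k_def g_def \<phi>_def .
      ultimately show ?thesis unfolding nsq_kk by simp
    qed
    define K where "K = nsq \<kappa>"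
    define R where "R = Re (ip \<kappa> \<phi>)"
    define S where "S = nsq \<phi>"
    have "nsq (\<lambda>x. \<kappa> x + of_real t * \<phi> x) = K + 2 * t * R + t\<^sup>2 * S" for t
      unfolding K_def R_def S_def by (subst nsq_add_cmult[OF ap_\<kappa> ap]) simp
    note expand = this
    have 1: "K + 4 * R + 4 * S \<le> S * (2 + w)\<^sup>2"
      using main[of 1] expand[of 2] unfolding S_def[symmetric] by simp
    have 2: "K - 4 * R + 4 * S \<le> S * (2 - w)\<^sup>2"
      using main[of "-1"] expand[of "-2"] unfolding S_def[symmetric] by simp
    have KS: "K \<le> S * w\<^sup>2" using 1 2 by (simp add: power2_eq_square algebra_simps)
    \<comment> \<open>The left-hand side is the squared norm of \<open>\<kappa> - w * \<phi>\<close>. The inequality is \<open>1 - \<bar>w\<bar> / 2\<close> times \<open>KS\<close> plus \<open>\<bar>w\<bar> / 2\<close> times one of the two inequalities before it, according to the sign of \<open>w\<close>.\<close>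
    have "K - 2 * w * R + w\<^sup>2 * S \<le> 0"
    proof (cases "w \<ge> 0")
      case True
      have "w / 2 * (K - 4 * R + 4 * S) \<le> w / 2 * (S * (2 - w)\<^sup>2)"
        using True 2 by (intro mult_left_mono) auto
      moreover have "(1 - w / 2) * K \<le> (1 - w / 2) * (S * w\<^sup>2)"
        using w_le KS by (intro mult_left_mono) auto
      ultimately show ?thesis by (simp add: power2_eq_square algebra_simps)
    next
      case False
      have "(- w / 2) * (K + 4 * R + 4 * S) \<le> (- w / 2) * (S * (2 + w)\<^sup>2)"
        using False 1 by (intro mult_left_mono) auto
      moreover have "(1 + w / 2) * K \<le> (1 + w / 2) * (S * w\<^sup>2)"
        using w_le KS by (intro mult_left_mono) auto
      ultimately show ?thesis by (simp add: power2_eq_square algebra_simps)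
    qed
    then have "nsq (\<lambda>x. \<kappa> x + of_real (- w) * \<phi> x) \<le> 0" unfolding expand by simp
    moreover have "almost_periodic (\<lambda>x. \<kappa> x + of_real (- w) * \<phi> x)"
      by (intro almost_periodic_intros ap ap_\<kappa>)
    ultimately have "\<kappa> x + of_real (- w) * \<phi> x = 0" using nsq_pos by (meson not_less)
    then have "\<kappa> x = of_real w * \<phi> x" by simp
    then show ?thesis unfolding \<kappa>_def w_def .
  qed
  have mult: "\<phi> (x + y) = \<phi> x * \<phi> y" for x y
  proof -
    have 1: "\<phi> (x + y) + \<phi> (x - y) = of_real (2 * Re (\<phi> y)) * \<phi> x"
      using key[of 1 x y] by simp
    have "\<i> * (\<phi> (x + y) - \<phi> (x - y)) = of_real (2 * Re (\<i> * \<phi> y)) * \<phi> x"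
      using key[of \<i> x y] by (simp add: algebra_simps)
    moreover have "complex_of_real (2 * Re (\<i> * \<phi> y)) = \<i> * (\<i> * of_real (2 * Im (\<phi> y)))" by simp
    ultimately have "\<i> * (\<phi> (x + y) - \<phi> (x - y)) = \<i> * (\<i> * of_real (2 * Im (\<phi> y)) * \<phi> x)"
      by (simp only: mult.assoc)
    then have 2: "\<phi> (x + y) - \<phi> (x - y) = \<i> * of_real (2 * Im (\<phi> y)) * \<phi> x"
      by (simp only: mult_cancel_left complex_i_not_zero simp_thms)
    have "2 * \<phi> (x + y) = (\<phi> (x + y) + \<phi> (x - y)) + (\<phi> (x + y) - \<phi> (x - y))" by simp
    also have "\<dots> = 2 * (of_real (Re (\<phi> y)) + \<i> * of_real (Im (\<phi> y))) * \<phi> x"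
      unfolding 1 2 by (simp add: algebra_simps)
    also have "of_real (Re (\<phi> y)) + \<i> * of_real (Im (\<phi> y)) = \<phi> y" by (rule complex_eq[symmetric])
    finally show ?thesis by simp
  qed
  moreover have "cmod (\<phi> y) = 1" for y
  proof -
    have "\<phi> y * cnj (\<phi> y) = 1" using mult[of y "- y"] \<phi>0 \<phi>m by simp
    then have "complex_of_real ((cmod (\<phi> y))\<^sup>2) = 1" by (simp only: complex_norm_square)
    then have "(cmod (\<phi> y))\<^sup>2 = 1\<^sup>2" by (simp only: of_real_eq_1_iff) simp
    then show ?thesis by (simp only: power2_eq_iff_nonneg norm_ge_zero zero_le_one)
  qed
  ultimately show ?thesis unfolding character_def \<phi>_def by blast
qed

text \<open>The extremal function is taken in the eigenspace of \<open>eigenfunction_exists\<close>. Its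
  autocorrelation \<open>\<phi>\<close> is an eigenfunction for the same eigenvalue because correlation operators
  commute, and \<open>corr \<phi> h = ip \<phi> h * \<phi>\<close> for a character, so \<open>(ip \<phi> h)\<^sup>2\<close> is the nonzero eigenvalue.\<close>

lemma correlated_character_exists:
  assumes h: "almost_periodic h" and herm: "\<And>x. h (- x) = cnj (h x)" and nz: "h x0 \<noteq> 0"
  obtains \<phi> where "character \<phi>" "almost_periodic \<phi>" "ip \<phi> h \<noteq> 0"
proof -
  obtain L u where L: "L > 0" and u: "almost_periodic u" "nsq u > 0"
    "corr (corr u h) h = (\<lambda>x. of_real L * u x)"
    using eigenfunction_exists[OF h herm nz] by blast
  obtain f where f: "almost_periodic f" "nsq f = 1" and eq: "corr (corr f h) h = (\<lambda>x. of_real L * f x)"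
    and max: "\<And>g. almost_periodic g \<Longrightarrow> corr (corr g h) h = (\<lambda>x. of_real L * g x)
       \<Longrightarrow> nsq (corr g g) \<le> nsq (corr f f) * (nsq g)\<^sup>2"
    using maximal_autocorrelation_exists[OF h L u] by blast
  have "character (corr f f)"
  proof (rule maximal_autocorrelation_is_character[OF f])
    fix d y
    define g where "g = (\<lambda>x. f (x + y))"
    define k where "k = (\<lambda>x. f x - (- d) * g x)"
    have g: "almost_periodic g" unfolding g_def by (rule almost_periodic_shift[OF f(1)])
    have dg: "almost_periodic (\<lambda>x. (- d) * g x)" by (rule almost_periodic_cmult[OF g])
    have k: "almost_periodic k" unfolding k_def by (rule almost_periodic_diff[OF f(1) dg])
    have lin: "corr (\<lambda>x. a x - (- d) * b x) h = (\<lambda>x. corr a h x - (- d) * corr b h x)"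
      if a: "almost_periodic a" and b: "almost_periodic b" for a b
      using corr_diff_left[OF a almost_periodic_cmult[OF b, of "- d"] h] corr_cmult_left[OF b h, of "- d"]
      by (intro ext) simp
    have shift: "corr (\<lambda>x. a (x + y)) h = (\<lambda>x. corr a h (x + y))" for a
      by (rule ext) (rule corr_shift_left)
    have "corr (corr g h) h = (\<lambda>x. of_real L * g x)"
      unfolding g_def shift eq ..
    then have "corr (corr k h) h = (\<lambda>x. of_real L * f x - (- d) * (of_real L * g x))"
      unfolding k_def lin[OF f(1) g]
      by (simp only: lin[OF almost_periodic_corr[OF f(1) h] almost_periodic_corr[OF g h]] eq)
    also have "\<dots> = (\<lambda>x. of_real L * k x)" unfolding k_def by (simp add: algebra_simps)
    finally have "nsq (corr k k) \<le> nsq (corr f f) * (nsq k)\<^sup>2" by (rule max[OF k])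
    then show "nsq (corr (\<lambda>x. f x + d * f (x + y)) (\<lambda>x. f x + d * f (x + y)))
      \<le> nsq (corr f f) * (nsq (\<lambda>x. f x + d * f (x + y)))\<^sup>2"
      unfolding k_def g_def by simp
  qed
  moreover define \<phi> where "\<phi> = corr f f"
  ultimately have \<phi>: "character \<phi>" by simp
  have ap: "almost_periodic \<phi>" unfolding \<phi>_def by (rule almost_periodic_corr[OF f(1) f(1)])
  have "corr (corr \<phi> h) h = corr (corr (corr f h) f) h"
    unfolding \<phi>_def by (simp only: corr_corr_swap[OF f(1) f(1) h])
  also have "\<dots> = corr (corr (corr f h) h) f"
    by (rule corr_corr_swap[OF almost_periodic_corr[OF f(1) h] f(1) h])
  also have "\<dots> = (\<lambda>x. of_real L * \<phi> x)"
    unfolding eq \<phi>_def by (rule ext) (rule corr_cmult_left[OF f(1) f(1)])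
  finally have L\<phi>: "corr (corr \<phi> h) h = (\<lambda>x. of_real L * \<phi> x)" .
  define m where "m = ip \<phi> h"
  have m\<phi>: "corr \<phi> h = (\<lambda>x. m * \<phi> x)"
  proof
    fix x
    have "corr \<phi> h x = ip (\<lambda>z. \<phi> x * \<phi> z) h"
      unfolding corr_ip by (simp add: character_add[OF \<phi>] mult.commute)
    then show "corr \<phi> h x = m * \<phi> x" unfolding m_def by (simp add: ip_cmult_left[OF ap h])
  qed
  have "corr (corr \<phi> h) h 0 = m * (m * \<phi> 0)"
    unfolding m\<phi> by (simp add: corr_cmult_left[OF ap h] m\<phi>)
  then have "m * m = of_real L" unfolding L\<phi> by (simp add: character_0[OF \<phi>])
  then have "m \<noteq> 0" using L by auto
  then show ?thesis using that \<phi> ap unfolding m_def by blast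
qed

section \<open>Bohr sets inside difference sets\<close>

definition ap_characters :: "('a::ab_group_add \<Rightarrow> complex) set" where
  "ap_characters = {\<phi>. character \<phi> \<and> almost_periodic \<phi>}"

lemma ip_character_self: "character \<phi> \<Longrightarrow> ip \<phi> \<phi> = 1"
  unfolding ip_def by (simp add: complex_norm_square[symmetric] character_norm)

text \<open>Characters are common eigenvectors of all translations.\<close>

lemma corr_character:
  assumes \<phi>: "\<phi> \<in> ap_characters" and f: "almost_periodic f"
  shows "corr f \<phi> y = \<phi> y * ip f \<phi>"
proof -
  have c: "character \<phi>" and ap: "almost_periodic \<phi>" using \<phi> unfolding ap_characters_def by auto
  have "cnj (\<phi> y) * corr f \<phi> y = ip (\<lambda>x. f (x + y)) (\<lambda>x. \<phi> y * \<phi> x)"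
    unfolding corr_ip by (rule ip_cmult_right[OF almost_periodic_shift[OF f] ap, symmetric])
  also have "\<dots> = ip (\<lambda>x. f (x + y)) (\<lambda>x. \<phi> (x + y))"
    by (simp add: character_add[OF c] mult.commute)
  also have "\<dots> = ip f \<phi>" by (rule ip_shift[OF f ap])
  finally have "(\<phi> y * cnj (\<phi> y)) * corr f \<phi> y = \<phi> y * ip f \<phi>" by simp
  then show ?thesis by (simp add: complex_norm_square[symmetric] character_norm[OF c])
qed

lemma ip_characters_orthogonal:
  assumes \<phi>: "\<phi> \<in> ap_characters" and \<psi>: "\<psi> \<in> ap_characters" and ne: "\<phi> \<noteq> \<psi>"
  shows "ip \<phi> \<psi> = 0"
proof -
  have c: "character \<phi>" and ap: "almost_periodic \<phi>" and ap': "almost_periodic \<psi>"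
    using \<phi> \<psi> unfolding ap_characters_def by auto
  obtain y where y: "\<phi> y \<noteq> \<psi> y" using ne by blast
  have "\<psi> y * ip \<phi> \<psi> = corr \<phi> \<psi> y" by (rule corr_character[OF \<psi> ap, symmetric])
  also have "\<dots> = ip (\<lambda>x. \<phi> y * \<phi> x) \<psi>"
    unfolding corr_ip by (simp add: character_add[OF c] mult.commute)
  also have "\<dots> = \<phi> y * ip \<phi> \<psi>" by (rule ip_cmult_left[OF ap ap'])
  finally show ?thesis using y by simp
qed

lemma ap_characters_ap: "\<phi> \<in> ap_characters \<Longrightarrow> almost_periodic \<phi>"
  and ap_characters_char: "\<phi> \<in> ap_characters \<Longrightarrow> character \<phi>"
  unfolding ap_characters_def by auto

lemma ip_sum_left:
  assumes "\<And>i. i \<in> I \<Longrightarrow> almost_periodic (f i)" "almost_periodic g"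
  shows "ip (\<lambda>x. \<Sum>i\<in>I. f i x) g = (\<Sum>i\<in>I. ip (f i) g)"
  unfolding ip_def sum_distrib_right by (intro mean_sum almost_periodic_intros assms)

lemma ip_trig_poly:
  assumes "finite F" "F \<subseteq> ap_characters" "\<psi> \<in> ap_characters"
  shows "ip (\<lambda>x. \<Sum>\<phi>\<in>F. a \<phi> * \<phi> x) \<psi> = (if \<psi> \<in> F then a \<psi> else 0)"
proof -
  have "ip (\<lambda>x. \<Sum>\<phi>\<in>F. a \<phi> * \<phi> x) \<psi> = (\<Sum>\<phi>\<in>F. a \<phi> * ip \<phi> \<psi>)"
    using assms ap_characters_ap
    by (subst ip_sum_left) (auto intro!: almost_periodic_cmult sum.cong ip_cmult_left)
  also have "\<dots> = (\<Sum>\<phi>\<in>F. if \<phi> = \<psi> then a \<psi> else 0)"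
    using assms by (intro sum.cong refl)
      (auto simp: ip_character_self[OF ap_characters_char] ip_characters_orthogonal subset_iff)
  finally show ?thesis using assms(1) by simp
qed

text \<open>Subtracting the component along one more character lowers the squared norm by exactly
  the square of the coefficient.\<close>

lemma Bessel:
  assumes f: "almost_periodic f" and F: "finite F" "F \<subseteq> ap_characters"
  shows "(\<Sum>\<phi>\<in>F. (cmod (ip f \<phi>))\<^sup>2) \<le> nsq f"
proof -
  have "nsq (\<lambda>x. f x - (\<Sum>\<phi>\<in>F. ip f \<phi> * \<phi> x)) = nsq f - (\<Sum>\<phi>\<in>F. (cmod (ip f \<phi>))\<^sup>2)"
    using F
  proof induction
    case (insert \<psi> F)
    define g where "g = (\<lambda>x. f x - (\<Sum>\<phi>\<in>F. ip f \<phi> * \<phi> x))"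
    have \<psi>: "\<psi> \<in> ap_characters" "F \<subseteq> ap_characters" using insert.prems by auto
    have ap: "almost_periodic (\<lambda>x. \<Sum>\<phi>\<in>F. ip f \<phi> * \<phi> x)"
      using \<psi>(2) ap_characters_ap by (intro almost_periodic_sum almost_periodic_cmult) auto
    have g: "almost_periodic g" unfolding g_def by (intro almost_periodic_diff f ap)
    have "ip g \<psi> = ip f \<psi>"
      unfolding g_def ip_diff_left[OF f ap ap_characters_ap[OF \<psi>(1)]]
        ip_trig_poly[OF insert.hyps(1) \<psi>(2,1)] using insert.hyps(2) by simp
    moreover have "nsq \<psi> = 1" unfolding nsq_def by (simp add: ip_character_self ap_characters_char \<psi>)
    moreover have "cnj (- ip f \<psi>) * ip f \<psi> = of_real (- (cmod (ip f \<psi>))\<^sup>2)"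
      by (simp add: complex_norm_square mult.commute del: of_real_power)
    ultimately have "nsq (\<lambda>x. g x + (- ip f \<psi>) * \<psi> x) = nsq g - (cmod (ip f \<psi>))\<^sup>2"
      by (simp only: nsq_add_cmult[OF g ap_characters_ap[OF \<psi>(1)]] Re_complex_of_real norm_minus_cancel)
    moreover have "(\<lambda>x. g x + (- ip f \<psi>) * \<psi> x) = (\<lambda>x. f x - (\<Sum>\<phi>\<in>insert \<psi> F. ip f \<phi> * \<phi> x))"
      unfolding g_def using insert.hyps by (simp add: algebra_simps)
    ultimately show ?case using insert by (simp add: g_def)
  qed simp
  moreover have "almost_periodic (\<lambda>x. f x - (\<Sum>\<phi>\<in>F. ip f \<phi> * \<phi> x))"
    using F(2) ap_characters_ap
    by (intro almost_periodic_diff almost_periodic_sum almost_periodic_cmult f) blast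
  note nsq_nonneg[OF this]
  ultimately show ?thesis by simp
qed

text \<open>The series of \<open>\<bar>ip f \<phi>\<bar>\<^sup>2 * \<phi>\<close> over all almost periodic characters converges uniformly, by
  Bessel's inequality. Its sum and \<open>corr f f\<close> have the same inner product with every character, and
  a nonzero hermitian function is never orthogonal to all characters.\<close>

lemma autocorrelation_approx:
  assumes f: "almost_periodic f" and e: "\<epsilon> > 0"
  obtains F where "finite F" "F \<subseteq> ap_characters"
    "\<And>x. cmod (corr f f x - (\<Sum>\<phi>\<in>F. of_real ((cmod (ip f \<phi>))\<^sup>2) * \<phi> x)) \<le> \<epsilon>"
proof -
  define a where "a \<phi> = (cmod (ip f \<phi>))\<^sup>2" for \<phi>
  define X where "X = (ap_characters :: ('a \<Rightarrow> complex) set)"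
  have a_nonneg: "a \<phi> \<ge> 0" for \<phi> unfolding a_def by simp
  have a_sum: "a summable_on X"
  proof (rule nonneg_bdd_above_summable_on)
    show "bdd_above (sum a ` {F. F \<subseteq> X \<and> finite F})"
      using Bessel[OF f] unfolding a_def X_def by (intro bdd_aboveI[of _ "nsq f"]) auto
  qed (simp add: a_nonneg)
  define t where "t x \<phi> = of_real (a \<phi>) * \<phi> x" for x \<phi>
  have t_norm: "cmod (t x \<phi>) = a \<phi>" if "\<phi> \<in> X" for x \<phi>
    using character_norm[OF ap_characters_char[of \<phi>], of x] that a_nonneg[of \<phi>]
    unfolding t_def X_def by (simp add: norm_mult)
  have t_abs: "(\<lambda>\<phi>. cmod (t x \<phi>)) summable_on X" for x
    using summable_on_cong[of X "\<lambda>\<phi>. cmod (t x \<phi>)" a] t_norm a_sum by simp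
  have t_sum: "t x summable_on X" for x using t_abs by (rule abs_summable_summable)
  define \<Phi> where "\<Phi> x = infsum (t x) X" for x
  have approx: "\<exists>F. finite F \<and> F \<subseteq> X \<and> (\<forall>F'. finite F' \<longrightarrow> F \<subseteq> F' \<longrightarrow> F' \<subseteq> X \<longrightarrow>
      (\<forall>x. cmod (\<Phi> x - (\<Sum>\<phi>\<in>F'. t x \<phi>)) \<le> \<delta>))" if "\<delta> > 0" for \<delta>
  proof -
    have "(a has_sum infsum a X) X" using a_sum by (rule has_sum_infsum)
    then have "\<exists>F. finite F \<and> F \<subseteq> X \<and> dist (sum a F) (infsum a X) \<le> \<delta>"
      using has_sum_finite_approximation that by blast
    then obtain F where F: "finite F" "F \<subseteq> X" "\<bar>sum a F - infsum a X\<bar> \<le> \<delta>"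
      unfolding dist_real_def by blast
    have "cmod (\<Phi> x - (\<Sum>\<phi>\<in>F'. t x \<phi>)) \<le> \<delta>" if F': "finite F'" "F \<subseteq> F'" "F' \<subseteq> X" for F' x
    proof -
      have "\<Phi> x - (\<Sum>\<phi>\<in>F'. t x \<phi>) = infsum (t x) (X - F')"
        unfolding \<Phi>_def using F' t_sum by (subst infsum_Diff) auto
      also have "cmod \<dots> \<le> infsum (\<lambda>\<phi>. cmod (t x \<phi>)) (X - F')"
        using t_abs by (intro norm_infsum_bound) (meson Diff_subset summable_on_subset_banach)
      also have "\<dots> = infsum a (X - F')" by (intro infsum_cong) (simp add: t_norm)
      also have "\<dots> = infsum a X - sum a F'"
        using F' a_sum by (subst infsum_Diff) auto
      also have "\<dots> \<le> infsum a X - sum a F"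
        using sum_mono2[OF F'(1,2), of a] a_nonneg by simp
      finally show ?thesis using F(3) by simp
    qed
    then show ?thesis using F(1,2) by blast
  qed
  have ap_poly: "almost_periodic (\<lambda>x. \<Sum>\<phi>\<in>F. t x \<phi>)" if "F \<subseteq> X" for F
    unfolding t_def using that ap_characters_ap unfolding X_def
    by (intro almost_periodic_sum almost_periodic_cmult) auto
  have ap_\<Phi>: "almost_periodic \<Phi>"
  proof (rule almost_periodic_uniform_approx)
    fix \<delta> :: real assume "\<delta> > 0"
    from approx[OF this] obtain F where "finite F" "F \<subseteq> X" and
      F: "\<And>F'. finite F' \<longrightarrow> F \<subseteq> F' \<longrightarrow> F' \<subseteq> X \<longrightarrow>
        (\<forall>x. cmod (\<Phi> x - (\<Sum>\<phi>\<in>F'. t x \<phi>)) \<le> \<delta>)" by auto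
    then show "\<exists>g. almost_periodic g \<and> (\<forall>x. cmod (\<Phi> x - g x) \<le> \<delta>)"
      using F[of F] by (intro exI[of _ "\<lambda>x. \<Sum>\<phi>\<in>F. t x \<phi>"] conjI ap_poly) simp_all
  qed
  have ip_\<Phi>: "ip \<Phi> \<psi> = of_real (a \<psi>)" if \<psi>: "\<psi> \<in> X" for \<psi>
  proof -
    have "cmod (ip \<Phi> \<psi> - of_real (a \<psi>)) \<le> 0 + \<delta>" if "\<delta> > 0" for \<delta>
    proof -
      from approx[OF that] obtain F where F: "finite F" "F \<subseteq> X" and
        F_approx: "\<And>F'. finite F' \<longrightarrow> F \<subseteq> F' \<longrightarrow> F' \<subseteq> X \<longrightarrow>
          (\<forall>x. cmod (\<Phi> x - (\<Sum>\<phi>\<in>F'. t x \<phi>)) \<le> \<delta>)" by auto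
      define F' where "F' = insert \<psi> F"
      have F': "finite F'" "F \<subseteq> F'" "F' \<subseteq> X" "\<psi> \<in> F'" using F \<psi> unfolding F'_def by auto
      have "ip (\<lambda>x. \<Sum>\<phi>\<in>F'. t x \<phi>) \<psi> = of_real (a \<psi>)"
        unfolding t_def using ip_trig_poly[of F' \<psi> "\<lambda>\<phi>. of_real (a \<phi>)"] F' \<psi> unfolding X_def by simp
      moreover have "cmod (ip \<Phi> \<psi> - ip (\<lambda>x. \<Sum>\<phi>\<in>F'. t x \<phi>) \<psi>) \<le> \<delta>"
        unfolding ip_def
      proof (intro mean_close almost_periodic_mult almost_periodic_cnj ap_\<Phi> ap_poly F')
        show "almost_periodic \<psi>" using \<psi> ap_characters_ap unfolding X_def by blast
        then show "almost_periodic \<psi>" .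
        fix x
        have "cmod (\<psi> x) = 1" using \<psi> character_norm ap_characters_char unfolding X_def by blast
        then show "cmod (\<Phi> x * cnj (\<psi> x) - (\<Sum>\<phi>\<in>F'. t x \<phi>) * cnj (\<psi> x)) \<le> \<delta>"
          using F_approx[of F'] F'(1-3) by (simp add: norm_mult flip: left_diff_distrib)
      qed
      ultimately show ?thesis by simp
    qed
    then have "cmod (ip \<Phi> \<psi> - of_real (a \<psi>)) \<le> 0" by (rule field_le_epsilon)
    then show ?thesis by simp
  qed
  have ip_ff: "ip (corr f f) \<psi> = of_real (a \<psi>)" if \<psi>: "\<psi> \<in> X" for \<psi>
  proof -
    have ap: "almost_periodic \<psi>" using \<psi> ap_characters_ap unfolding X_def by blast
    have "ip (corr f f) \<psi> = ip (corr f \<psi>) f" by (rule ip_corr_swap[OF f f ap])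
    also have "corr f \<psi> = (\<lambda>y. ip f \<psi> * \<psi> y)"
      using corr_character[OF _ f] \<psi> unfolding X_def by (auto simp: mult.commute)
    also have "ip \<dots> f = ip f \<psi> * cnj (ip f \<psi>)"
      by (simp add: ip_cmult_left[OF ap f] ip_commute[OF f ap])
    finally show ?thesis unfolding a_def by (simp add: complex_norm_square del: of_real_power)
  qed
  define k where "k = (\<lambda>x. corr f f x - \<Phi> x)"
  have ap_k: "almost_periodic k" unfolding k_def by (intro almost_periodic_diff almost_periodic_corr f ap_\<Phi>)
  have herm: "k (- x) = cnj (k x)" for x
  proof -
    have "\<Phi> (- x) = cnj (\<Phi> x)"
      unfolding \<Phi>_def infsum_cnj[symmetric] t_def X_def
      by (intro infsum_cong) (simp add: character_uminus ap_characters_char)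
    then show ?thesis unfolding k_def by (simp add: corr_uminus[OF f f])
  qed
  have "k x = 0" for x
  proof (rule ccontr)
    assume "k x \<noteq> 0"
    then obtain \<phi> where \<phi>: "character \<phi>" "almost_periodic \<phi>" "ip \<phi> k \<noteq> 0"
      using correlated_character_exists[OF ap_k herm] by blast
    have "ip k \<phi> = 0"
      unfolding k_def using \<phi>(1,2) ip_ff[of \<phi>] ip_\<Phi>[of \<phi>]
      by (subst ip_diff_left) (auto intro: almost_periodic_corr f ap_\<Phi> simp: X_def ap_characters_def)
    then show False using \<phi>(3) ip_commute[OF ap_k \<phi>(2)] by simp
  qed
  then have eq: "corr f f x = \<Phi> x" for x unfolding k_def by simp
  from approx[OF e] obtain F where F: "finite F" "F \<subseteq> X"
    and "\<And>F'. finite F' \<longrightarrow> F \<subseteq> F' \<longrightarrow> F' \<subseteq> X \<longrightarrow>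
      (\<forall>x. cmod (\<Phi> x - (\<Sum>\<phi>\<in>F'. t x \<phi>)) \<le> \<epsilon>)" by auto
  from this(3)[of F] F have F_approx: "cmod (\<Phi> x - (\<Sum>\<phi>\<in>F. t x \<phi>)) \<le> \<epsilon>" for x by simp
  show ?thesis
    by (rule that[OF F(1) F(2)[unfolded X_def]]) (use F_approx in \<open>simp add: eq t_def a_def\<close>)
qed

text \<open>The autocorrelation takes the value \<open>nsq f\<close> at 0. A finite approximation to within a
  quarter of this value moves by at most another quarter as long as its characters are within
  \<open>1/4\<close> of 1, since the coefficients add up to at most \<open>nsq f\<close>.\<close>

lemma autocorrelation_nonzero_on_Bohr_set:
  assumes f: "almost_periodic f" and pos: "nsq f > 0"
  obtains F where "finite F" "F \<subseteq> ap_characters" "\<And>\<phi>. \<phi> \<in> F \<Longrightarrow> ip f \<phi> \<noteq> 0"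
    "\<And>x. \<forall>\<phi>\<in>F. cmod (\<phi> x - 1) \<le> 1/4 \<Longrightarrow> corr f f x \<noteq> 0"
proof -
  define n where "n = nsq f"
  have n: "n / 4 > 0" using pos unfolding n_def by simp
  obtain F where F: "finite F" "F \<subseteq> ap_characters"
    "\<And>x. cmod (corr f f x - (\<Sum>\<phi>\<in>F. of_real ((cmod (ip f \<phi>))\<^sup>2) * \<phi> x)) \<le> n / 4"
    by (rule autocorrelation_approx[OF f n]) (rule that)
  define F' where "F' = {\<phi> \<in> F. ip f \<phi> \<noteq> 0}"
  define p where "p x = (\<Sum>\<phi>\<in>F. of_real ((cmod (ip f \<phi>))\<^sup>2) * \<phi> x)" for x
  have "corr f f x \<noteq> 0" if x: "\<forall>\<phi>\<in>F'. cmod (\<phi> x - 1) \<le> 1/4" for x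
  proof
    assume 0: "corr f f x = 0"
    have scaled: "cmod (of_real r * z - of_real r * w) = r * cmod (z - w)" if "r \<ge> 0" for r z w
      using that by (simp add: norm_mult flip: right_diff_distrib)
    have "cmod (p x - p 0) \<le> (\<Sum>\<phi>\<in>F. (cmod (ip f \<phi>))\<^sup>2 * (1/4))"
      unfolding p_def sum_subtractf[symmetric]
    proof (rule sum_norm_le)
      fix \<phi> assume \<phi>: "\<phi> \<in> F"
      then have "\<phi> 0 = 1" using F(2) character_0 ap_characters_char by blast
      then have "cmod (of_real ((cmod (ip f \<phi>))\<^sup>2) * \<phi> x - of_real ((cmod (ip f \<phi>))\<^sup>2) * \<phi> 0)
          = (cmod (ip f \<phi>))\<^sup>2 * cmod (\<phi> x - 1)"
        using scaled[of "(cmod (ip f \<phi>))\<^sup>2" "\<phi> x" 1] by simp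
      also have "\<dots> \<le> (cmod (ip f \<phi>))\<^sup>2 * (1/4)"
      proof (cases "ip f \<phi> = 0")
        case False
        then show ?thesis using x \<phi> unfolding F'_def by (intro mult_left_mono) auto
      qed simp
      finally show "cmod (of_real ((cmod (ip f \<phi>))\<^sup>2) * \<phi> x - of_real ((cmod (ip f \<phi>))\<^sup>2) * \<phi> 0)
          \<le> (cmod (ip f \<phi>))\<^sup>2 * (1/4)" .
    qed
    also have "\<dots> \<le> n * (1/4)"
      unfolding sum_distrib_right[symmetric] n_def using Bessel[OF f F(1,2)] by (intro mult_right_mono) auto
    finally have 2: "cmod (p 0 - p x) \<le> n / 4" by (simp add: norm_minus_commute)
    have 1: "cmod (corr f f 0 - p 0) \<le> n / 4" using F(3)[of 0] unfolding p_def .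
    have 3: "cmod (p x - corr f f x) \<le> n / 4"
      using F(3)[of x] unfolding p_def[symmetric] by (simp only: norm_minus_commute)
    have "cmod (corr f f 0 - corr f f x) \<le> n / 4 + (n / 4 + n / 4)"
      by (rule norm_diff_triangle_le[OF 1 norm_diff_triangle_le[OF 2 3]])
    moreover have "cmod (corr f f 0) = n" unfolding corr_0 ip_self[OF f] n_def using pos by simp
    ultimately show False using 0 pos unfolding n_def by simp
  qed
  note * = this
  have "finite F'" "F' \<subseteq> ap_characters" "\<And>\<phi>. \<phi> \<in> F' \<Longrightarrow> ip f \<phi> \<noteq> 0"
    using F(1,2) unfolding F'_def by auto
  from this * show ?thesis by (rule that)
qed

text \<open>A character that is not orthogonal to \<open>f\<close> inherits almost periods from \<open>f\<close>. This makes the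
  characters that occur in the expansion continuous whenever \<open>f\<close> is uniformly continuous.\<close>

lemma correlated_character_periods:
  assumes \<phi>: "\<phi> \<in> ap_characters" and f: "almost_periodic f" and y: "y \<in> periods f \<epsilon>"
  shows "cmod (\<phi> y - 1) * cmod (ip f \<phi>) \<le> \<epsilon>"
proof -
  have ap: "almost_periodic \<phi>" using \<phi> by (rule ap_characters_ap)
  have "(\<phi> y - 1) * ip f \<phi> = corr f \<phi> y - corr f \<phi> 0"
    by (simp add: corr_character[OF \<phi> f] character_0[OF ap_characters_char[OF \<phi>]] left_diff_distrib)
  also have "cmod \<dots> \<le> \<epsilon>"
    unfolding corr_def
  proof (intro mean_close almost_periodic_mult almost_periodic_shift almost_periodic_cnj f ap)
    fix x
    show "cmod (f (x + y) * cnj (\<phi> x) - f (x + 0) * cnj (\<phi> x)) \<le> \<epsilon>"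
      using periodsD[OF y, of x] character_norm[OF ap_characters_char[OF \<phi>], of x]
      by (simp add: norm_mult flip: left_diff_distrib)
  qed
  finally show ?thesis by (simp add: norm_mult)
qed

section \<open>Neighbourhoods of zero in group topologies\<close>

definition nbhd0 :: "'a::ab_group_add topology \<Rightarrow> 'a set \<Rightarrow> bool" where
  "nbhd0 T U \<longleftrightarrow> (\<exists>V. openin T V \<and> 0 \<in> V \<and> V \<subseteq> U)"

lemma nbhd0_mono: "nbhd0 T U \<Longrightarrow> U \<subseteq> U' \<Longrightarrow> nbhd0 T U'"
  unfolding nbhd0_def by (meson order_trans)

lemma nbhd0_Int: "nbhd0 T U \<Longrightarrow> nbhd0 T V \<Longrightarrow> nbhd0 T (U \<inter> V)"
  unfolding nbhd0_def by (meson IntI Int_mono openin_Int)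

lemma nbhd0_zero: "nbhd0 T U \<Longrightarrow> 0 \<in> U"
  unfolding nbhd0_def by blast

lemma nbhd0_UNIV: "group_topology T \<Longrightarrow> nbhd0 T UNIV"
  unfolding nbhd0_def group_topology_def by (metis UNIV_I openin_topspace subset_UNIV)

lemma nbhd0_Inter:
  "finite F \<Longrightarrow> group_topology T \<Longrightarrow> (\<And>\<phi>. \<phi> \<in> F \<Longrightarrow> nbhd0 T (U \<phi>)) \<Longrightarrow> nbhd0 T {x. \<forall>\<phi>\<in>F. x \<in> U \<phi>}"
proof (induction F rule: finite_induct)
  case empty
  then show ?case using nbhd0_UNIV by simp
next
  case (insert \<phi> F)
  have "nbhd0 T (U \<phi> \<inter> {x. \<forall>\<phi>\<in>F. x \<in> U \<phi>})" using insert by (intro nbhd0_Int) auto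
  then show ?case by (rule nbhd0_mono) auto
qed

lemma openin_translate:
  assumes "group_topology T" "openin T U"
  shows "openin T {x. a + x \<in> U}"
proof -
  have ts: "topspace T = UNIV" using assms(1) unfolding group_topology_def by blast
  have "continuous_map T (prod_topology T T) (\<lambda>x. (a, x))"
    by (intro continuous_map_pairedI) (simp_all add: ts)
  moreover have "continuous_map (prod_topology T T) T (\<lambda>(x, y). x + y)"
    using assms(1) unfolding group_topology_def by blast
  ultimately have "continuous_map T T ((\<lambda>(x, y). x + y) \<circ> (\<lambda>x. (a, x)))"
    by (rule continuous_map_compose)
  from openin_continuous_map_preimage[OF this assms(2)] show ?thesis by (simp add: ts)
qed

text \<open>A group topology is determined by its neighbourhoods of zero, so two such topologies can be
  compared there.\<close>

lemma openin_iff_nbhd0: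
  assumes "group_topology T"
  shows "openin T U \<longleftrightarrow> (\<forall>x\<in>U. nbhd0 T {y. x + y \<in> U})"
proof
  assume U: "openin T U"
  show "\<forall>x\<in>U. nbhd0 T {y. x + y \<in> U}"
  proof
    fix x assume "x \<in> U"
    then show "nbhd0 T {y. x + y \<in> U}"
      unfolding nbhd0_def using openin_translate[OF assms U, of x]
      by (intro exI[of _ "{y. x + y \<in> U}"]) simp
  qed
next
  assume *: "\<forall>x\<in>U. nbhd0 T {y. x + y \<in> U}"
  have "\<exists>V. openin T V \<and> x \<in> V \<and> V \<subseteq> U" if x: "x \<in> U" for x
  proof -
    from * x have "nbhd0 T {y. x + y \<in> U}" by blast
    then obtain V where V: "openin T V" "0 \<in> V" "V \<subseteq> {y. x + y \<in> U}" unfolding nbhd0_def by blast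
    have "openin T {z. - x + z \<in> V}" by (rule openin_translate[OF assms V(1)])
    moreover have "x \<in> {z. - x + z \<in> V}" using V(2) by simp
    moreover have "{z. - x + z \<in> V} \<subseteq> U"
    proof
      fix z assume "z \<in> {z. - x + z \<in> V}"
      then have "x + (- x + z) \<in> U" using V(3) by blast
      then show "z \<in> U" by simp
    qed
    ultimately show ?thesis by blast
  qed
  then show "openin T U" by (subst openin_subopen) blast
qed

lemma nbhd0_diff:
  assumes T: "group_topology T" and U: "nbhd0 T U"
  obtains V where "nbhd0 T V" "\<And>x y. x \<in> V \<Longrightarrow> y \<in> V \<Longrightarrow> x - y \<in> U"
proof -
  have ts: "topspace T = UNIV" using T unfolding group_topology_def by blast
  obtain W where W: "openin T W" "0 \<in> W" "W \<subseteq> U" using U unfolding nbhd0_def by blast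
  have cont: "continuous_map (prod_topology T T) T (\<lambda>(x, y). x + y)" "continuous_map T T uminus"
    using T unfolding group_topology_def by auto
  have "openin (prod_topology T T) {p \<in> topspace (prod_topology T T). (case p of (x, y) \<Rightarrow> x + y) \<in> W}"
    by (rule openin_continuous_map_preimage[OF cont(1) W(1)])
  then have op: "openin (prod_topology T T) {p. fst p + snd p \<in> W}" by (simp add: ts split_def)
  have "(0, 0) \<in> {p. fst p + snd p \<in> W}" using W(2) by simp
  from op[unfolded openin_prod_topology_alt, rule_format, OF this]
  obtain A B where AB: "openin T A" "openin T B" "0 \<in> A" "0 \<in> B" "A \<times> B \<subseteq> {p. fst p + snd p \<in> W}"
    by (elim exE conjE) (rule that)
  have "openin T {x \<in> topspace T. - x \<in> B}"
    by (rule openin_continuous_map_preimage[OF cont(2) AB(2)])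
  then have "openin T (A \<inter> {x. - x \<in> B})" using AB(1) by (simp add: ts openin_Int)
  then have "nbhd0 T (A \<inter> {x. - x \<in> B})" unfolding nbhd0_def using AB(3,4) by auto
  moreover have "x - y \<in> U" if "x \<in> A \<inter> {x. - x \<in> B}" "y \<in> A \<inter> {x. - x \<in> B}" for x y
  proof -
    have "(x, - y) \<in> A \<times> B" using that by blast
    then have "x + - y \<in> W" using AB(5) by fastforce
    then show ?thesis using W(3) by auto
  qed
  ultimately show ?thesis using that by blast
qed

lemma nbhd0_chain_step:
  assumes T: "group_topology T" and U: "nbhd0 T U"
  obtains V where "nbhd0 T V" "\<And>x. x \<in> V \<Longrightarrow> - x \<in> V"
    "\<And>x y z. x \<in> V \<Longrightarrow> y \<in> V \<Longrightarrow> z \<in> V \<Longrightarrow> x + y + z \<in> U"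
proof -
  obtain A where A: "nbhd0 T A" "\<And>x y. x \<in> A \<Longrightarrow> y \<in> A \<Longrightarrow> x - y \<in> U" using nbhd0_diff[OF T U] by blast
  obtain B where B: "nbhd0 T B" "\<And>x y. x \<in> B \<Longrightarrow> y \<in> B \<Longrightarrow> x - y \<in> A" using nbhd0_diff[OF T A(1)] by blast
  obtain C where C: "nbhd0 T C" "\<And>x y. x \<in> C \<Longrightarrow> y \<in> C \<Longrightarrow> x - y \<in> B" using nbhd0_diff[OF T B(1)] by blast
  define V where "V = B \<inter> {x. - x \<in> B}"
  have 0: "0 \<in> B" "0 \<in> C" "0 \<in> A" using nbhd0_zero A B C by blast+
  have "C \<subseteq> V"
    unfolding V_def using C(2)[OF _ 0(2)] C(2)[OF 0(2)] by auto
  then have "nbhd0 T V" using nbhd0_mono[OF C(1)] by blast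
  moreover have "- x \<in> V" if "x \<in> V" for x using that unfolding V_def by simp
  moreover have "x + y + z \<in> U" if "x \<in> V" "y \<in> V" "z \<in> V" for x y z
  proof -
    have "x - (- y) \<in> A" "0 - z \<in> A" using that 0 unfolding V_def by (intro B(2); simp)+
    then have "(x - (- y)) - (0 - z) \<in> U" by (rule A(2))
    then show ?thesis by simp
  qed
  ultimately show ?thesis using that by blast
qed

text \<open>The threefold sums are the form needed for a pseudonorm with \<open>sum_in_V\<close>. The chain
  starts with the whole group so that every element has finite pseudonorm.\<close>

lemma nbhd0_chain:
  assumes T: "group_topology T" and U: "\<And>n. nbhd0 T (U n)"
  obtains V where "V 0 = UNIV" "\<And>n. nbhd0 T (V n)" "\<And>n x. x \<in> V n \<Longrightarrow> - x \<in> V n"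
    "\<And>n x y z. x \<in> V (Suc n) \<Longrightarrow> y \<in> V (Suc n) \<Longrightarrow> z \<in> V (Suc n) \<Longrightarrow> x + y + z \<in> V n"
    "\<And>n. V (Suc n) \<subseteq> U n"
proof -
  let ?P = "\<lambda>n V. nbhd0 T V \<and> (\<forall>x\<in>V. - x \<in> V) \<and> (n = 0 \<longrightarrow> V = UNIV)"
  let ?Q = "\<lambda>n V W. (\<forall>x\<in>W. \<forall>y\<in>W. \<forall>z\<in>W. x + y + z \<in> V) \<and> W \<subseteq> U n"
  have step: "\<exists>W. ?P (Suc n) W \<and> ?Q n V W" if V: "?P n V" for n V
  proof -
    have nV: "nbhd0 T (V \<inter> U n)" using V U by (intro nbhd0_Int) auto
    obtain W where W: "nbhd0 T W" "\<And>x. x \<in> W \<Longrightarrow> - x \<in> W"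
      "\<And>x y z. x \<in> W \<Longrightarrow> y \<in> W \<Longrightarrow> z \<in> W \<Longrightarrow> x + y + z \<in> V \<inter> U n"
      using nbhd0_chain_step[OF T nV] by blast
    have "W \<subseteq> U n"
    proof
      fix x assume "x \<in> W"
      from W(3)[OF this nbhd0_zero[OF W(1)] nbhd0_zero[OF W(1)]] show "x \<in> U n" by simp
    qed
    with W show ?thesis by (intro exI[of _ W] conjI ballI) auto
  qed
  have "\<exists>V. \<forall>n. ?P n (V n) \<and> ?Q n (V n) (V (Suc n))"
  proof (rule dependent_nat_choice)
    show "\<exists>V. ?P 0 V" using nbhd0_UNIV[OF T] by (intro exI[of _ UNIV]) simp
  qed (rule step)
  then obtain V where V: "\<forall>n. ?P n (V n) \<and> ?Q n (V n) (V (Suc n))" ..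
  show ?thesis
  proof (rule that[of V])
    show "V 0 = UNIV" using V by simp
    show "nbhd0 T (V n)" for n using V by simp
    show "- x \<in> V n" if "x \<in> V n" for n x using spec[OF V, of n] that by simp
    show "x + y + z \<in> V n" if "x \<in> V (Suc n)" "y \<in> V (Suc n)" "z \<in> V (Suc n)" for n x y z
      using spec[OF V, of n] that by simp
    show "V (Suc n) \<subseteq> U n" for n using spec[OF V, of n] by simp
  qed
qed

section \<open>The pseudonorm of a chain of neighbourhoods\<close>

text \<open>The entry at which the partial sums exceed the threshold \<open>c\<close>.\<close>

lemma sum_list_split:
  fixes f :: "'b \<Rightarrow> real"
  assumes "\<And>p. p \<in> set ps \<Longrightarrow> f p > 0" "0 \<le> c" "c < (\<Sum>p\<leftarrow>ps. f p)"
  shows "\<exists>as b cs. ps = as @ b # cs \<and> (\<Sum>p\<leftarrow>as. f p) \<le> c \<and> c < (\<Sum>p\<leftarrow>as. f p) + f b"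
  using assms
proof (induction ps arbitrary: c)
  case (Cons p ps)
  show ?case
  proof (cases "c < f p")
    case True
    then show ?thesis using Cons.prems by (intro exI[of _ "[]"] exI[of _ p] exI[of _ ps]) simp
  next
    case False
    then obtain as b cs where "ps = as @ b # cs" "(\<Sum>p\<leftarrow>as. f p) \<le> c - f p" "c - f p < (\<Sum>p\<leftarrow>as. f p) + f b"
      using Cons.IH[of "c - f p"] Cons.prems by auto
    then show ?thesis by (intro exI[of _ "p # as"] exI[of _ b] exI[of _ cs]) simp
  qed
qed simp

locale nbhd_chain =
  fixes V :: "nat \<Rightarrow> 'a::ab_group_add set"
  assumes V0: "V 0 = UNIV"
    and V_zero: "0 \<in> V n"
    and V_uminus: "x \<in> V n \<Longrightarrow> - x \<in> V n"
    and V_add3: "x \<in> V (Suc n) \<Longrightarrow> y \<in> V (Suc n) \<Longrightarrow> z \<in> V (Suc n) \<Longrightarrow> x + y + z \<in> V n"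
begin

lemma V_Suc: "V (Suc n) \<subseteq> V n"
  using V_add3[of _ n 0 0] V_zero by auto

lemma V_antimono: "m \<le> n \<Longrightarrow> V n \<subseteq> V m"
  by (induction rule: dec_induct) (use V_Suc in auto)

text \<open>The pseudonorm of Birkhoff and Kakutani: an element is decomposed in all possible ways into
  summands labelled by members of the chain, a summand labelled \<open>n\<close> costs \<open>(1/2) ^ n\<close>, and the
  infimum of the total costs is taken.\<close>

definition cost :: "(nat \<times> 'a) list \<Rightarrow> real" where
  "cost ps = (\<Sum>p\<leftarrow>ps. (1/2) ^ fst p)"

definition reps :: "'a \<Rightarrow> (nat \<times> 'a) list set" where
  "reps x = {ps. (\<forall>p\<in>set ps. snd p \<in> V (fst p)) \<and> (\<Sum>p\<leftarrow>ps. snd p) = x}"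

definition pnorm :: "'a \<Rightarrow> real" where
  "pnorm x = Inf (cost ` reps x)"

lemma cost_nonneg: "cost ps \<ge> 0"
  unfolding cost_def by (intro sum_list_nonneg) auto

lemma cost_bdd: "bdd_below (cost ` reps x)"
  using cost_nonneg by (intro bdd_belowI[of _ 0]) auto

lemma pnorm_le_cost: "ps \<in> reps x \<Longrightarrow> pnorm x \<le> cost ps"
  unfolding pnorm_def by (intro cInf_lower cost_bdd imageI)

lemma reps_single: "x \<in> V n \<Longrightarrow> [(n, x)] \<in> reps x"
  unfolding reps_def by simp

lemma reps_nonempty: "reps x \<noteq> {}"
  using reps_single[of x 0] V0 by blast

lemma pnorm_nonneg: "pnorm x \<ge> 0"
  unfolding pnorm_def using reps_nonempty cost_nonneg by (intro cInf_greatest) auto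

lemma pnorm_le: "x \<in> V n \<Longrightarrow> pnorm x \<le> (1/2) ^ n"
  using pnorm_le_cost[OF reps_single] by (simp add: cost_def)

lemma pnorm_approx:
  assumes "e > 0" obtains ps where "ps \<in> reps x" "cost ps < pnorm x + e"
proof -
  have "Inf (cost ` reps x) < pnorm x + e" unfolding pnorm_def using assms by simp
  then show ?thesis using cInf_less_iff[OF _ cost_bdd] reps_nonempty that by blast
qed

lemma pnorm_triangle: "pnorm (x + y) \<le> pnorm x + pnorm y"
proof (rule field_le_epsilon)
  fix e :: real assume "e > 0"
  then have e: "e / 2 > 0" by simp
  obtain ps where ps: "ps \<in> reps x" "cost ps < pnorm x + e/2" using pnorm_approx[OF e] by blast
  obtain qs where qs: "qs \<in> reps y" "cost qs < pnorm y + e/2" using pnorm_approx[OF e] by blast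
  have "ps @ qs \<in> reps (x + y)" using ps(1) qs(1) unfolding reps_def by auto
  then have "pnorm (x + y) \<le> cost (ps @ qs)" by (rule pnorm_le_cost)
  also have "\<dots> = cost ps + cost qs" unfolding cost_def by simp
  finally show "pnorm (x + y) \<le> pnorm x + pnorm y + e" using ps(2) qs(2) by simp
qed

lemma pnorm_uminus_le: "pnorm (- x) \<le> pnorm x"
proof (rule field_le_epsilon)
  fix e :: real assume e: "e > 0"
  obtain ps where ps: "ps \<in> reps x" "cost ps < pnorm x + e" using pnorm_approx[OF e] by blast
  let ?qs = "map (\<lambda>p. (fst p, - snd p)) ps"
  have "(\<Sum>p\<leftarrow>ps. - snd p) = - (\<Sum>p\<leftarrow>ps. snd p)" by (induction ps) auto
  then have "?qs \<in> reps (- x)" using ps(1) V_uminus unfolding reps_def by (auto simp: o_def)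
  then have "pnorm (- x) \<le> cost ?qs" by (rule pnorm_le_cost)
  also have "\<dots> = cost ps" unfolding cost_def by (simp add: o_def)
  finally show "pnorm (- x) \<le> pnorm x + e" using ps(2) by simp
qed

lemma pnorm_uminus: "pnorm (- x) = pnorm x"
  using pnorm_uminus_le[of x] pnorm_uminus_le[of "- x"] by simp

lemma pnorm_zero: "pnorm 0 = 0"
proof -
  have "[] \<in> reps 0" unfolding reps_def by simp
  then show ?thesis using pnorm_le_cost[of "[]" 0] pnorm_nonneg[of 0] by (simp add: cost_def)
qed

text \<open>Frink's argument. Cut the list at the entry where half of the total cost is passed: the two
  outer parts cost at most half each, so their sums lie in \<open>V (Suc n)\<close> by induction, and so does the
  entry itself, being a single summand of cost less than \<open>(1/2) ^ n\<close>.\<close>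

lemma sum_in_V:
  assumes "\<forall>p\<in>set ps. snd p \<in> V (fst p)" "cost ps < (1/2) ^ n"
  shows "(\<Sum>p\<leftarrow>ps. snd p) \<in> V n"
  using assms
proof (induction "length ps" arbitrary: ps n rule: less_induct)
  case less
  show ?case
  proof (cases "ps = []")
    case True
    then show ?thesis by (simp add: V_zero)
  next
    case False
    define f where "f p = (1/2::real) ^ fst p" for p :: "nat \<times> 'a"
    have f: "f p > 0" for p unfolding f_def by simp
    have cost: "cost qs = (\<Sum>p\<leftarrow>qs. f p)" for qs unfolding cost_def f_def ..
    have "cost ps > 0"
      using False f cost_nonneg by (cases ps) (auto simp: cost add_pos_nonneg intro!: add_pos_nonneg)
    then obtain as b cs where split: "ps = as @ b # cs" "cost as \<le> cost ps / 2" "cost ps / 2 < cost as + f b"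
      using sum_list_split[of ps f "cost ps / 2"] f unfolding cost by auto
    have total: "cost ps = cost as + f b + cost cs" unfolding split(1) cost by simp
    have half: "(1/2::real) ^ Suc n = (1/2) ^ n / 2" by simp
    have "cost as < (1/2) ^ Suc n" "cost cs < (1/2) ^ Suc n"
      unfolding half using split(2,3) total less.prems(2) by linarith+
    then have "(\<Sum>p\<leftarrow>as. snd p) \<in> V (Suc n)" "(\<Sum>p\<leftarrow>cs. snd p) \<in> V (Suc n)"
      using less.prems(1) unfolding split(1) by (intro less.hyps; simp add: split(1))+
    moreover have "snd b \<in> V (Suc n)"
    proof -
      have "f b < (1/2) ^ n"
        using total less.prems(2) cost_nonneg[of as] cost_nonneg[of cs] by linarith
      then have "\<not> fst b \<le> n" unfolding f_def using power_decreasing[of "fst b" n "1/2::real"] by force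
      then have "V (fst b) \<subseteq> V (Suc n)" by (intro V_antimono) simp
      then show ?thesis using less.prems(1) unfolding split(1) by auto
    qed
    ultimately have "(\<Sum>p\<leftarrow>as. snd p) + snd b + (\<Sum>p\<leftarrow>cs. snd p) \<in> V n" by (intro V_add3)
    then show ?thesis unfolding split(1) by (simp add: add.assoc)
  qed
qed

lemma pnorm_less: 
  assumes "pnorm x < (1/2) ^ n" shows "x \<in> V n"
proof -
  obtain ps where "ps \<in> reps x" "cost ps < pnorm x + ((1/2) ^ n - pnorm x)"
    using pnorm_approx[of "(1/2) ^ n - pnorm x" x] assms by auto
  then show ?thesis using sum_in_V[of ps n] unfolding reps_def by auto
qed

end

section \<open>Precompact topologies are generated by characters\<close>

lemma precompactD:
  assumes "precompact_group_topology T"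
  shows "group_topology T" "Hausdorff_space T"
  using assms unfolding precompact_group_topology_def by auto

text \<open>Translates of a neighbourhood \<open>V\<close> with \<open>V - V \<subseteq> U\<close> are small of order \<open>U\<close>.\<close>

lemma precompact_finitely_covering:
  assumes "precompact_group_topology T" "nbhd0 T U"
  shows "finitely_covering U"
proof -
  obtain V where V: "nbhd0 T V" "\<And>x y. x \<in> V \<Longrightarrow> y \<in> V \<Longrightarrow> x - y \<in> U"
    using nbhd0_diff[OF precompactD(1)] assms by blast
  obtain F where F: "finite F" "{f + x | f x. f \<in> F \<and> x \<in> V} = UNIV"
    using assms(1) V(1) unfolding precompact_group_topology_def nbhd0_def by blast
  define \<C> where "\<C> = (\<lambda>f. {x. x - f \<in> V}) ` F"
  have "finite \<C>" unfolding \<C>_def using F(1) by simp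
  moreover have "\<Union>\<C> = UNIV"
  proof -
    have "x \<in> \<Union>\<C>" for x
    proof -
      have "x \<in> {f + x | f x. f \<in> F \<and> x \<in> V}" using F(2) by simp
      then obtain f v where "f \<in> F" "v \<in> V" "x = f + v" by blast
      then show ?thesis unfolding \<C>_def by force
    qed
    then show ?thesis by blast
  qed
  moreover have "x - y \<in> U" if C: "C \<in> \<C>" "x \<in> C" "y \<in> C" for C x y
  proof -
    obtain f where "x - f \<in> V" "y - f \<in> V" using C unfolding \<C>_def by blast
    then have "(x - f) - (y - f) \<in> U" by (rule V(2))
    then show ?thesis by simp
  qed
  ultimately show ?thesis unfolding finitely_covering_def by blast
qed

text \<open>For a homomorphism continuity at zero is enough, and it is the only form used here.\<close>

definition continuous_characters :: "'a::ab_group_add topology \<Rightarrow> ('a \<Rightarrow> complex) set" where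
  "continuous_characters T = {\<phi>. character \<phi> \<and> (\<forall>\<epsilon>>0. nbhd0 T {x. cmod (\<phi> x - 1) \<le> \<epsilon>})}"

text \<open>The neighbourhoods of zero given by finitely many continuous characters form a base. The
  bump function \<open>f\<close> is a cut-off of the pseudonorm of a chain of neighbourhoods; its support lies in
  a set \<open>W\<close> with \<open>W - W \<subseteq> U\<close>, so its autocorrelation vanishes outside \<open>U\<close>.\<close>

lemma nbhd0_contains_Bohr_set:
  assumes T: "precompact_group_topology T" and U: "nbhd0 T U"
  obtains F where "finite F" "F \<subseteq> continuous_characters T"
    "{x. \<forall>\<phi>\<in>F. cmod (\<phi> x - 1) \<le> 1/4} \<subseteq> U"
proof -
  note gT = precompactD(1)[OF T]
  obtain W where W: "nbhd0 T W" "\<And>x y. x \<in> W \<Longrightarrow> y \<in> W \<Longrightarrow> x - y \<in> U" using nbhd0_diff[OF gT U] by blast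
  obtain V where V: "V 0 = UNIV" "\<And>n. nbhd0 T (V n)" "\<And>n x. x \<in> V n \<Longrightarrow> - x \<in> V n"
    "\<And>n x y z. x \<in> V (Suc n) \<Longrightarrow> y \<in> V (Suc n) \<Longrightarrow> z \<in> V (Suc n) \<Longrightarrow> x + y + z \<in> V n"
    "\<And>n::nat. V (Suc n) \<subseteq> W"
    using nbhd0_chain[OF gT, of "\<lambda>_. W"] W(1) by blast
  interpret nbhd_chain V
    by standard (use V nbhd0_zero in blast)+
  \<comment> \<open>\<open>f\<close> is supported in \<open>V 1\<close>, where the pseudonorm is below \<open>1/2\<close>.\<close>
  define f where "f x = complex_of_real (max 0 (1 - 2 * pnorm x))" for x
  have f_periods: "V n \<subseteq> periods f (2 * (1/2) ^ n)" for n
  proof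
    fix t assume t: "t \<in> V n"
    have "cmod (f (x + t) - f x) \<le> 2 * (1/2) ^ n" for x
    proof -
      have "\<bar>pnorm (x + t) - pnorm x\<bar> \<le> pnorm t"
        using pnorm_triangle[of x t] pnorm_triangle[of "x + t" "- t"] pnorm_uminus[of t] by simp
      then have "\<bar>max 0 (1 - 2 * pnorm (x + t)) - max 0 (1 - 2 * pnorm x)\<bar> \<le> 2 * pnorm t" by linarith
      also have "\<dots> \<le> 2 * (1/2) ^ n" using pnorm_le[OF t] by simp
      finally show ?thesis unfolding f_def by (simp only: of_real_diff[symmetric] norm_of_real)
    qed
    then show "t \<in> periods f (2 * (1/2) ^ n)" by (simp add: periods_def)
  qed
  have periods_nbhd: "nbhd0 T (periods f \<epsilon>)" if e: "\<epsilon> > 0" for \<epsilon>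
  proof -
    obtain n where n: "(1/2::real) ^ n < \<epsilon> / 2"
      using real_arch_pow_inv[of "\<epsilon>/2" "1/2"] half_gt_zero[OF e] by (auto simp del: power_one_over)
    then have le: "2 * (1/2) ^ n \<le> \<epsilon>" by simp
    have "periods f (2 * (1/2) ^ n) \<subseteq> periods f \<epsilon>"
      unfolding periods_def using order_trans[OF _ le] by blast
    then show ?thesis using f_periods[of n] V(2)[of n] nbhd0_mono by blast
  qed
  have ap: "almost_periodic f"
    unfolding almost_periodic_def using precompact_finitely_covering[OF T] periods_nbhd by blast
  have "f 0 \<noteq> 0" unfolding f_def by (simp add: pnorm_zero)
  then have pos: "nsq f > 0" by (rule nsq_pos[OF ap])
  obtain F where F: "finite F" "F \<subseteq> ap_characters" "\<And>\<phi>. \<phi> \<in> F \<Longrightarrow> ip f \<phi> \<noteq> 0"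
    and F_Bohr: "\<And>x. \<forall>\<phi>\<in>F. cmod (\<phi> x - 1) \<le> 1/4 \<Longrightarrow> corr f f x \<noteq> 0"
    by (rule autocorrelation_nonzero_on_Bohr_set[OF ap pos]) (rule that)
  have "F \<subseteq> continuous_characters T"
  proof
    fix \<phi> assume \<phi>: "\<phi> \<in> F"
    have "nbhd0 T {x. cmod (\<phi> x - 1) \<le> \<epsilon>}" if "\<epsilon> > 0" for \<epsilon>
    proof -
      have c: "cmod (ip f \<phi>) > 0" using F(3)[OF \<phi>] by simp
      have "cmod (\<phi> y - 1) \<le> \<epsilon>" if "y \<in> periods f (\<epsilon> * cmod (ip f \<phi>))" for y
        using correlated_character_periods[OF _ ap that, of \<phi>] \<phi> F(2) c by auto
      then have "periods f (\<epsilon> * cmod (ip f \<phi>)) \<subseteq> {x. cmod (\<phi> x - 1) \<le> \<epsilon>}" by blast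
      then show ?thesis using periods_nbhd[of "\<epsilon> * cmod (ip f \<phi>)"] c that nbhd0_mono by simp
    qed
    then show "\<phi> \<in> continuous_characters T"
      unfolding continuous_characters_def using \<phi> F(2) ap_characters_char by blast
  qed
  moreover have "{x. \<forall>\<phi>\<in>F. cmod (\<phi> x - 1) \<le> 1/4} \<subseteq> U"
  proof
    fix x assume "x \<in> {x. \<forall>\<phi>\<in>F. cmod (\<phi> x - 1) \<le> 1/4}"
    then have "corr f f x \<noteq> 0" using F_Bohr by blast
    then have "\<not> (\<forall>z. f (z + x) * cnj (f z) = 0)" unfolding corr_def by force
    then obtain z where z: "f (z + x) \<noteq> 0" "f z \<noteq> 0" by auto
    have "y \<in> W" if "f y \<noteq> 0" for y
    proof -
      have "pnorm y < (1/2) ^ 1" using that unfolding f_def by (simp add: max_def split: if_splits)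
      then have "y \<in> V 1" by (rule pnorm_less)
      then show ?thesis using V(5)[of 0] by auto
    qed
    from W(2)[OF this[OF z(1)] this[OF z(2)]] show "x \<in> U" by simp
  qed
  ultimately show ?thesis using that F(1) by blast
qed

section \<open>Characters close to the trivial character\<close>

text \<open>The circle has no small subgroups: as long as \<open>z\<close> is within \<open>3/4\<close> of 1, squaring enlarges
  the distance to 1 by a factor of at least \<open>5/4\<close>.\<close>

lemma small_character_trivial:
  assumes \<phi>: "character \<phi>" and small: "\<And>x. cmod (\<phi> x - 1) \<le> 3/4"
  shows "\<phi> x = 1"
proof (rule ccontr)
  assume "\<phi> x \<noteq> 1"
  then have pos: "cmod (\<phi> x - 1) > 0" by simp
  define m where "m n = ((\<lambda>y. y + y) ^^ n) x" for n :: nat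
  have "(5/4) ^ n * cmod (\<phi> x - 1) \<le> cmod (\<phi> (m n) - 1)" for n
  proof (induction n)
    case (Suc n)
    have "5/4 \<le> cmod (\<phi> (m n) + 1)"
      using norm_triangle_ineq4[of "\<phi> (m n) + 1" "\<phi> (m n) - 1"] small[of "m n"] by simp
    then have "(5/4) * ((5/4) ^ n * cmod (\<phi> x - 1)) \<le> cmod (\<phi> (m n) + 1) * cmod (\<phi> (m n) - 1)"
      using Suc.IH by (intro mult_mono) auto
    also have "\<dots> = cmod (\<phi> (m n + m n) - 1)"
      unfolding norm_mult[symmetric] character_add[OF \<phi>] by (simp add: algebra_simps)
    also have "m n + m n = m (Suc n)" unfolding m_def by simp
    finally show ?case by (simp add: mult.assoc)
  qed (simp add: m_def)
  then have bound: "(5/4) ^ n * cmod (\<phi> x - 1) \<le> 3/4" for n using small order_trans by blast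
  obtain n where "3/4 / cmod (\<phi> x - 1) < (5/4::real) ^ n"
    using real_arch_pow[of "5/4" "3/4 / cmod (\<phi> x - 1)"] by auto
  then have "3/4 < (5/4) ^ n * cmod (\<phi> x - 1)" using pos by (simp add: pos_divide_less_eq)
  then show False using bound[of n] by simp
qed

lemma character_mult_cnj:
  assumes "character \<phi>" "character \<psi>" shows "character (\<lambda>x. \<phi> x * cnj (\<psi> x))"
  using assms unfolding character_def by (simp add: norm_mult)

lemma cmod_character_quotient:
  assumes "character \<phi>" "character \<psi>"
  shows "cmod (\<phi> x * cnj (\<psi> x) - 1) = cmod (\<phi> x - \<psi> x)"
proof -
  have "\<psi> x * cnj (\<psi> x) = 1"
    by (simp add: complex_norm_square[symmetric] character_norm[OF assms(2)])
  then have "\<phi> x * cnj (\<psi> x) - 1 = (\<phi> x - \<psi> x) * cnj (\<psi> x)" by (simp add: left_diff_distrib)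
  then show ?thesis by (simp add: norm_mult character_norm[OF assms(2)])
qed

lemma close_characters_eq:
  assumes "character \<phi>" "character \<psi>" "\<And>x. cmod (\<phi> x - \<psi> x) \<le> 3/4"
  shows "\<phi> = \<psi>"
proof
  fix x
  have "cmod (\<phi> x * cnj (\<psi> x) - 1) \<le> 3/4" for x
    using cmod_character_quotient[OF assms(1,2)] assms(3) by simp
  then have "\<phi> x * cnj (\<psi> x) = 1" by (rule small_character_trivial[OF character_mult_cnj[OF assms(1,2)]])
  then show "\<phi> x = \<psi> x" using cmod_character_quotient[OF assms(1,2), of x] by simp
qed

lemma cmod_character_diff:
  assumes "character \<phi>" shows "cmod (\<phi> (x - y) - 1) = cmod (\<phi> x - \<phi> y)"
proof -
  have 1: "\<phi> (x - y) = \<phi> x * cnj (\<phi> y)"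
    using character_add[OF assms, of x "- y"] character_uminus[OF assms, of y] by simp
  have "\<phi> y * cnj (\<phi> y) = 1"
    by (simp add: complex_norm_square[symmetric] character_norm[OF assms])
  then have "\<phi> (x - y) - 1 = (\<phi> x - \<phi> y) * cnj (\<phi> y)"
    unfolding 1 by (simp add: left_diff_distrib)
  then show ?thesis by (simp add: norm_mult character_norm[OF assms])
qed

text \<open>The circle is cut along a grid of mesh \<open>1 / k\<close>.\<close>

lemma circle_partition:
  assumes "\<epsilon> > 0"
  obtains q :: "complex \<Rightarrow> int \<times> int"
  where "finite (q ` {z. cmod z = 1})" "\<And>z w. q z = q w \<Longrightarrow> cmod (z - w) \<le> \<epsilon>"
proof -
  obtain k :: nat where k: "2 / \<epsilon> < real k" using reals_Archimedean2 by blast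
  moreover have "2 / \<epsilon> > 0" using assms by simp
  ultimately have k0: "real k > 0" by linarith
  have k2: "2 / real k \<le> \<epsilon>" using k k0 assms by (simp add: field_simps)
  define q where "q z = (\<lfloor>real k * Re z\<rfloor>, \<lfloor>real k * Im z\<rfloor>)" for z
  have "q ` {z. cmod z = 1} \<subseteq> {- int k..int k} \<times> {- int k..int k}"
  proof
    fix p assume "p \<in> q ` {z. cmod z = 1}"
    then obtain z where z: "cmod z = 1" "p = q z" by blast
    have bound: "- int k \<le> \<lfloor>real k * t\<rfloor> \<and> \<lfloor>real k * t\<rfloor> \<le> int k" if t: "\<bar>t\<bar> \<le> 1" for t
    proof -
      have "real k * \<bar>t\<bar> \<le> real k * 1" using t k0 by (intro mult_left_mono) auto
      then have "\<bar>real k * t\<bar> \<le> real k" by (simp add: abs_mult)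
      then show ?thesis by linarith
    qed
    show "p \<in> {- int k..int k} \<times> {- int k..int k}"
      unfolding z(2) q_def using bound[of "Re z"] bound[of "Im z"] abs_Re_le_cmod[of z] abs_Im_le_cmod[of z] z(1)
      by simp
  qed
  then have fin: "finite (q ` {z. cmod z = 1})" by (rule finite_subset) simp
  have "cmod (z - w) \<le> \<epsilon>" if "q z = q w" for z w
  proof -
    have close: "\<bar>s - t\<bar> \<le> 1 / real k" if "\<lfloor>real k * s\<rfloor> = \<lfloor>real k * t\<rfloor>" for s t
    proof -
      have "\<bar>real k * s - real k * t\<bar> \<le> 1" using that by linarith
      then have "real k * \<bar>s - t\<bar> \<le> 1"
        by (metis abs_mult abs_of_nat right_diff_distrib)
      then show ?thesis using k0 by (simp add: field_simps)
    qed
    have "cmod (z - w) \<le> \<bar>Re z - Re w\<bar> + \<bar>Im z - Im w\<bar>" using cmod_le[of "z - w"] by simp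
    also have "\<dots> \<le> 1 / real k + 1 / real k"
      using that unfolding q_def by (intro add_mono close) auto
    finally show ?thesis using k2 by simp
  qed
  then show ?thesis using that fin by blast
qed

text \<open>Such a character is determined, up to an error of at most \<open>3/4\<close> everywhere, by its
  approximate values on finitely many representatives, and characters so close are equal.\<close>

lemma finite_small_characters:
  assumes "finitely_covering V"
  shows "finite {\<phi>. character \<phi> \<and> (\<forall>x\<in>V. cmod (\<phi> x - 1) \<le> 1/4)}" (is "finite ?H")
proof -
  obtain F where F: "finite F" "\<And>x. \<exists>g\<in>F. x - g \<in> V" using finitely_covering_reps[OF assms] by blast
  obtain q :: "complex \<Rightarrow> int \<times> int" where q: "finite (q ` {z. cmod z = 1})"
    "\<And>z w. q z = q w \<Longrightarrow> cmod (z - w) \<le> 1/4" using circle_partition[of "1/4"] by auto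
  define r where "r \<phi> = restrict (\<lambda>g. q (\<phi> g)) F" for \<phi>
  have "r ` ?H \<subseteq> PiE F (\<lambda>_. q ` {z. cmod z = 1})"
    unfolding r_def by (auto simp: character_norm)
  then have fin: "finite (r ` ?H)" by (rule finite_subset) (intro finite_PiE F(1) q(1))
  have "inj_on r ?H"
  proof (rule inj_onI)
    fix \<phi> \<psi> assume \<phi>: "\<phi> \<in> ?H" and \<psi>: "\<psi> \<in> ?H" and eq: "r \<phi> = r \<psi>"
    have c: "character \<phi>" "character \<psi>" using \<phi> \<psi> by auto
    have "cmod (\<phi> x - \<psi> x) \<le> 3/4" for x
    proof -
      obtain g where g: "g \<in> F" "x - g \<in> V" using F(2) by blast
      have "q (\<phi> g) = q (\<psi> g)" using fun_cong[OF eq, of g] g(1) unfolding r_def by simp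
      then have 1: "cmod (\<phi> g - \<psi> g) \<le> 1/4" by (rule q(2))
      have 2: "cmod (\<phi> x - \<phi> g) \<le> 1/4" "cmod (\<psi> x - \<psi> g) \<le> 1/4"
        using \<phi> \<psi> g(2) by (simp_all flip: cmod_character_diff[OF c(1)] cmod_character_diff[OF c(2)])
      have "\<phi> x - \<psi> x = ((\<phi> x - \<phi> g) + (\<phi> g - \<psi> g)) - (\<psi> x - \<psi> g)" by simp
      also have "cmod \<dots> \<le> (1/4 + 1/4) + 1/4"
        by (intro order_trans[OF norm_triangle_ineq4] add_mono order_trans[OF norm_triangle_ineq] 1 2)
      finally show ?thesis by simp
    qed
    then show "\<phi> = \<psi>" by (rule close_characters_eq[OF c])
  qed
  then show ?thesis using fin finite_imageD by blast
qed

lemma character_finitely_covering: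
  assumes \<phi>: "character \<phi>" and "\<epsilon> > 0"
  shows "finitely_covering {x. cmod (\<phi> x - 1) \<le> \<epsilon>}"
proof -
  obtain q :: "complex \<Rightarrow> int \<times> int" where q: "finite (q ` {z. cmod z = 1})"
    "\<And>z w. q z = q w \<Longrightarrow> cmod (z - w) \<le> \<epsilon>"
    by (rule circle_partition[OF assms(2)]) (rule that)
  define \<C> where "\<C> = (\<lambda>p. {x. q (\<phi> x) = p}) ` q ` {z. cmod z = 1}"
  have "finite \<C>" unfolding \<C>_def using q(1) by simp
  moreover have "\<Union>\<C> = UNIV"
    unfolding \<C>_def using character_norm[OF \<phi>] by auto
  moreover have "x - y \<in> {x. cmod (\<phi> x - 1) \<le> \<epsilon>}" if "C \<in> \<C>" "x \<in> C" "y \<in> C" for C x y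
    using that q(2)[of "\<phi> x" "\<phi> y"] unfolding \<C>_def by (auto simp: cmod_character_diff[OF \<phi>])
  ultimately show ?thesis unfolding finitely_covering_def by blast
qed

text \<open>Halving the neighbourhood improves the bound by a factor \<open>4/5\<close>, by the doubling estimate
  in the circle, so a character that is close to 1 near zero tends to 1 there.\<close>

lemma continuous_characterI:
  assumes T: "group_topology T" and \<phi>: "character \<phi>"
    and V: "nbhd0 T V" "\<And>x. x \<in> V \<Longrightarrow> cmod (\<phi> x - 1) \<le> 1/4"
  shows "\<phi> \<in> continuous_characters T"
proof -
  have step: "\<exists>W. nbhd0 T W \<and> W \<subseteq> V \<and> (\<forall>x\<in>W. cmod (\<phi> x - 1) \<le> (4/5) ^ n)" for n
  proof (induction n)
    case 0
    then show ?case using V by (intro exI[of _ V]) force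
  next
    case (Suc n)
    from Suc.IH obtain W where W: "nbhd0 T W" "W \<subseteq> V" "\<forall>x\<in>W. cmod (\<phi> x - 1) \<le> (4/5) ^ n"
      by (elim exE conjE) (rule that)
    obtain A where A: "nbhd0 T A" "\<And>x y z. x \<in> A \<Longrightarrow> y \<in> A \<Longrightarrow> z \<in> A \<Longrightarrow> x + y + z \<in> W"
      by (rule nbhd0_chain_step[OF T W(1)]) (rule that)
    have 0: "0 \<in> A" using A(1) by (rule nbhd0_zero)
    have "cmod (\<phi> x - 1) \<le> (4/5) ^ Suc n" if x: "x \<in> A \<inter> V" for x
    proof -
      have "x + x + 0 \<in> W" using A(2)[of x x 0] x 0 by blast
      then have 2: "cmod (\<phi> (x + x) - 1) \<le> (4/5) ^ n" using W(3) by simp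
      have "5/4 \<le> cmod (\<phi> x + 1)"
        using norm_triangle_ineq4[of "\<phi> x + 1" "\<phi> x - 1"] V(2)[of x] x by simp
      then have "5/4 * cmod (\<phi> x - 1) \<le> cmod (\<phi> x + 1) * cmod (\<phi> x - 1)" by (intro mult_right_mono) auto
      also have "\<dots> = cmod (\<phi> (x + x) - 1)"
        unfolding norm_mult[symmetric] character_add[OF \<phi>] by (simp add: algebra_simps)
      finally show ?thesis using 2 by simp
    qed
    moreover have "nbhd0 T (A \<inter> V)" by (intro nbhd0_Int A V)
    ultimately show ?case by (intro exI[of _ "A \<inter> V"]) simp
  qed
  have "nbhd0 T {x. cmod (\<phi> x - 1) \<le> \<epsilon>}" if e: "\<epsilon> > 0" for \<epsilon>
  proof -
    obtain n where n: "(4/5::real) ^ n < \<epsilon>" using real_arch_pow_inv[OF e, of "4/5"] by auto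
    from step[of n] obtain W where W: "nbhd0 T W" "\<forall>x\<in>W. cmod (\<phi> x - 1) \<le> (4/5) ^ n"
      by (elim exE conjE) (rule that)
    have "W \<subseteq> {x. cmod (\<phi> x - 1) \<le> \<epsilon>}" using W(2) n by fastforce
    then show ?thesis by (rule nbhd0_mono[OF W(1)])
  qed
  then show ?thesis unfolding continuous_characters_def using \<phi> by blast
qed

section \<open>Group topologies from a subbase of neighbourhoods of zero\<close>

text \<open>A set is open if with each point \<open>x\<close> it contains a translate by \<open>x\<close> of a finite intersection
  of members of the family. The hypothesis on differences yields, in two steps, a map
  \<open>half\<close> into the family that controls sums and negatives.\<close>

lemma group_topology_from_subbase:
  fixes \<S> :: "'a::ab_group_add set set"
  assumes zero: "\<And>S. S \<in> \<S> \<Longrightarrow> 0 \<in> S"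
    and diff: "\<And>S. S \<in> \<S> \<Longrightarrow> \<exists>M\<in>\<S>. \<forall>x\<in>M. \<forall>y\<in>M. x - y \<in> S"
  obtains T where "group_topology T"
    "\<And>U. nbhd0 T U \<longleftrightarrow> (\<exists>F. finite F \<and> F \<subseteq> \<S> \<and> \<Inter>F \<subseteq> U)"
proof -
  have "\<exists>M\<in>\<S>. \<forall>x\<in>M. \<forall>y\<in>M. x + y \<in> S \<and> - x \<in> S" if S: "S \<in> \<S>" for S
  proof -
    obtain M where M: "M \<in> \<S>" "\<And>x y. x \<in> M \<Longrightarrow> y \<in> M \<Longrightarrow> x - y \<in> S" using diff[OF S] by blast
    obtain N where N: "N \<in> \<S>" "\<And>x y. x \<in> N \<Longrightarrow> y \<in> N \<Longrightarrow> x - y \<in> M" using diff[OF M(1)] by blast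
    have "x + y \<in> S \<and> - x \<in> S" if xy: "x \<in> N" "y \<in> N" for x y
    proof -
      have M_mem: "x \<in> M" "- x \<in> M" "- y \<in> M" "0 \<in> M"
        using N(2)[OF xy(1) zero[OF N(1)]] N(2)[OF zero[OF N(1)] xy(1)]
          N(2)[OF zero[OF N(1)] xy(2)] zero[OF M(1)] by auto
      show ?thesis using M(2)[OF M_mem(1,3)] M(2)[OF M_mem(2,4)] by simp
    qed
    then show ?thesis using N(1) by blast
  qed
  then have "\<forall>S\<in>\<S>. \<exists>M. M \<in> \<S> \<and> (\<forall>x\<in>M. \<forall>y\<in>M. x + y \<in> S \<and> - x \<in> S)" by blast
  from bchoice[OF this] obtain half where
    half: "\<forall>S\<in>\<S>. half S \<in> \<S> \<and> (\<forall>x\<in>half S. \<forall>y\<in>half S. x + y \<in> S \<and> - x \<in> S)" ..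
  define basic where "basic F \<longleftrightarrow> finite F \<and> F \<subseteq> \<S>" for F
  have basic_half: "basic (half ` F)" if "basic F" for F using that half unfolding basic_def by auto
  have add_half: "x + y \<in> \<Inter>F" if "basic F" "x \<in> \<Inter>(half ` F)" "y \<in> \<Inter>(half ` F)" for F x y
  proof
    fix S assume S: "S \<in> F"
    have mem: "S \<in> \<S>" "x \<in> half S" "y \<in> half S" using that S unfolding basic_def by auto
    from half mem(1) have "\<forall>x\<in>half S. \<forall>y\<in>half S. x + y \<in> S \<and> - x \<in> S" by simp
    from bspec[OF bspec[OF this mem(2)] mem(3)] show "x + y \<in> S" ..
  qed
  have uminus_half: "- x \<in> \<Inter>F" if "basic F" "x \<in> \<Inter>(half ` F)" for F x
  proof
    fix S assume S: "S \<in> F"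
    have mem: "S \<in> \<S>" "x \<in> half S" using that S unfolding basic_def by auto
    from half mem(1) have "\<forall>x\<in>half S. \<forall>y\<in>half S. x + y \<in> S \<and> - x \<in> S" by simp
    from bspec[OF bspec[OF this mem(2)] mem(2)] show "- x \<in> S" ..
  qed
  define opn :: "'a set \<Rightarrow> bool" where "opn U \<longleftrightarrow> (\<forall>x\<in>U. \<exists>F. basic F \<and> (\<forall>y\<in>\<Inter>F. x + y \<in> U))" for U
  have opnD: "\<exists>F. basic F \<and> (\<forall>y\<in>\<Inter>F. x + y \<in> U)" if "opn U" "x \<in> U" for U x
    using that unfolding opn_def by simp
  have "istopology opn"
    unfolding istopology_def
  proof (intro conjI allI impI)
    fix U V assume U: "opn U" and V: "opn V"
    show "opn (U \<inter> V)" unfolding opn_def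
    proof
      fix x assume "x \<in> U \<inter> V"
      then have "x \<in> U" "x \<in> V" by simp_all
      from opnD[OF U this(1)] opnD[OF V this(2)]
      obtain F G where "basic F" "\<forall>y\<in>\<Inter>F. x + y \<in> U" "basic G" "\<forall>y\<in>\<Inter>G. x + y \<in> V"
        by (elim exE conjE) (rule that)
      then show "\<exists>F. basic F \<and> (\<forall>y\<in>\<Inter>F. x + y \<in> U \<inter> V)"
        by (intro exI[of _ "F \<union> G"]) (auto simp: basic_def)
    qed
  next
    fix \<K> assume K: "\<forall>K\<in>\<K>. opn K"
    show "opn (\<Union>\<K>)" unfolding opn_def
    proof
      fix x assume "x \<in> \<Union>\<K>"
      then obtain K where Kx: "K \<in> \<K>" "x \<in> K" by blast
      with K have "opn K" by simp
      from opnD[OF this Kx(2)] obtain F where "basic F" "\<forall>y\<in>\<Inter>F. x + y \<in> K"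
        by (elim exE conjE) (rule that)
      then show "\<exists>F. basic F \<and> (\<forall>y\<in>\<Inter>F. x + y \<in> \<Union>\<K>)" using Kx(1) by (intro exI[of _ F]) blast
    qed
  qed
  define T where "T = topology opn"
  have openin_T: "openin T U \<longleftrightarrow> opn U" for U
    unfolding T_def using topology_inverse'[OF \<open>istopology opn\<close>] by simp
  have "opn UNIV" unfolding opn_def by (auto intro!: exI[of _ "{}"] simp: basic_def)
  then have ts: "topspace T = UNIV" using openin_subset[of T UNIV] openin_T by blast
  have nbhd: "nbhd0 T U \<longleftrightarrow> (\<exists>F. basic F \<and> \<Inter>F \<subseteq> U)" for U
  proof
    assume "nbhd0 T U"
    then obtain V where V: "opn V" "0 \<in> V" "V \<subseteq> U" unfolding nbhd0_def openin_T by blast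
    from opnD[OF V(1,2)] obtain F where F: "basic F" "\<forall>y\<in>\<Inter>F. 0 + y \<in> V"
      by (elim exE conjE) (rule that)
    then have "\<Inter>F \<subseteq> U" using V(3) by auto
    then show "\<exists>F. basic F \<and> \<Inter>F \<subseteq> U" using F(1) by blast
  next
    assume "\<exists>F. basic F \<and> \<Inter>F \<subseteq> U"
    then obtain F where F: "basic F" "\<Inter>F \<subseteq> U" by blast
    \<comment> \<open>The interior of \<open>U\<close>; it is open because finite intersections can be halved.\<close>
    define V where "V = {x. \<exists>F. basic F \<and> (\<forall>y\<in>\<Inter>F. x + y \<in> U)}"
    have "opn V" unfolding opn_def
    proof
      fix x assume "x \<in> V"
      then obtain G where G: "basic G" "\<forall>y\<in>\<Inter>G. x + y \<in> U" unfolding V_def by blast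
      have "x + z \<in> V" if z: "z \<in> \<Inter>(half ` G)" for z
      proof -
        have "x + z + y \<in> U" if "y \<in> \<Inter>(half ` G)" for y
          using G(2) add_half[OF G(1) z that] by (simp add: add.assoc)
        then show ?thesis unfolding V_def using basic_half[OF G(1)] by blast
      qed
      then show "\<exists>F. basic F \<and> (\<forall>y\<in>\<Inter>F. x + y \<in> V)" using basic_half[OF G(1)] by blast
    qed
    moreover have "0 \<in> V" unfolding V_def using F by auto
    moreover have "V \<subseteq> U"
    proof
      fix x assume "x \<in> V"
      then obtain G where G: "basic G" "\<forall>y\<in>\<Inter>G. x + y \<in> U" unfolding V_def by blast
      have "0 \<in> \<Inter>G" using G(1) zero unfolding basic_def by blast
      then have "x + 0 \<in> U" using G(2) by blast
      then show "x \<in> U" by simp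
    qed
    ultimately show "nbhd0 T U" unfolding nbhd0_def openin_T by blast
  qed
  have op_translate: "opn {x. c + x \<in> U}" if "opn U" for U c
    unfolding opn_def
  proof
    fix x assume "x \<in> {x. c + x \<in> U}"
    then have "c + x \<in> U" by simp
    from opnD[OF that this] obtain F where "basic F" "\<forall>y\<in>\<Inter>F. (c + x) + y \<in> U"
      by (elim exE conjE) (rule that)
    then show "\<exists>F. basic F \<and> (\<forall>y\<in>\<Inter>F. x + y \<in> {x. c + x \<in> U})"
      by (intro exI[of _ F]) (simp add: add.assoc)
  qed
  have add: "continuous_map (prod_topology T T) T (\<lambda>(x, y). x + y)"
    unfolding continuous_map_def
  proof (intro conjI allI impI)
    fix U assume "openin T U"
    then have U: "opn U" unfolding openin_T .
    have "\<exists>A B. openin T A \<and> openin T B \<and> a \<in> A \<and> b \<in> B \<and> A \<times> B \<subseteq> {p. fst p + snd p \<in> U}"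
      if "a + b \<in> U" for a b
    proof -
      from opnD[OF U that] obtain F where F: "basic F" "\<forall>y\<in>\<Inter>F. (a + b) + y \<in> U"
        by (elim exE conjE) (rule that)
      have "nbhd0 T (\<Inter>(half ` F))" unfolding nbhd using basic_half[OF F(1)] by blast
      then obtain W where W: "opn W" "0 \<in> W" "W \<subseteq> \<Inter>(half ` F)" unfolding nbhd0_def openin_T by blast
      have "x + y \<in> U" if "- a + x \<in> W" "- b + y \<in> W" for x y
      proof -
        have "(- a + x) + (- b + y) \<in> \<Inter>F" using add_half[OF F(1)] W(3) that by blast
        then have "(a + b) + ((- a + x) + (- b + y)) \<in> U" using F(2) by blast
        then show ?thesis by (simp add: algebra_simps)
      qed
      then show ?thesis
        using op_translate[OF W(1), of "- a"] op_translate[OF W(1), of "- b"] W(2)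
        by (intro exI[of _ "{x. - a + x \<in> W}"] exI[of _ "{x. - b + x \<in> W}"]) (auto simp: openin_T)
    qed
    then have "openin (prod_topology T T) {p. fst p + snd p \<in> U}"
      unfolding openin_prod_topology_alt by simp
    then show "openin (prod_topology T T)
        {p \<in> topspace (prod_topology T T). (case p of (x, y) \<Rightarrow> x + y) \<in> U}"
      by (simp add: ts split_def)
  qed (simp add: ts)
  have neg: "continuous_map T T uminus"
    unfolding continuous_map_def
  proof (intro conjI allI impI)
    fix U assume "openin T U"
    then have U: "opn U" unfolding openin_T .
    have "opn {x. - x \<in> U}" unfolding opn_def
    proof
      fix x assume "x \<in> {x. - x \<in> U}"
      then have "- x \<in> U" by simp
      from opnD[OF U this] obtain F where F: "basic F" "\<forall>y\<in>\<Inter>F. - x + y \<in> U"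
        by (elim exE conjE) (rule that)
      have "x + y \<in> {x. - x \<in> U}" if "y \<in> \<Inter>(half ` F)" for y
      proof -
        have "- x + - y \<in> U" using F(2) uminus_half[OF F(1) that] by blast
        then show ?thesis by simp
      qed
      then show "\<exists>F. basic F \<and> (\<forall>y\<in>\<Inter>F. x + y \<in> {x. - x \<in> U})" using basic_half[OF F(1)] by blast
    qed
    then show "openin T {x \<in> topspace T. - x \<in> U}" by (simp add: ts openin_T)
  qed (simp add: ts)
  have "group_topology T" unfolding group_topology_def using ts add neg by blast
  then show ?thesis using that nbhd unfolding basic_def by (simp add: conj_assoc)
qed

section \<open>The finest precompact topology with a given null sequence\<close>

lemma precompactI:
  assumes "group_topology T" "Hausdorff_space T" "\<And>U. nbhd0 T U \<Longrightarrow> finitely_covering U"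
  shows "precompact_group_topology T"
  unfolding precompact_group_topology_def
proof (intro conjI allI impI assms(1,2))
  fix U assume "\<exists>V. openin T V \<and> 0 \<in> V \<and> V \<subseteq> U"
  then have "finitely_covering U" using assms(3) unfolding nbhd0_def by simp
  then obtain F where F: "finite F" "\<And>x. \<exists>g\<in>F. x - g \<in> U" by (rule finitely_covering_reps) (rule that)
  have "x \<in> {f + x | f x. f \<in> F \<and> x \<in> U}" for x
  proof -
    obtain g where g: "g \<in> F" "x - g \<in> U" using F(2)[of x] by auto
    have "x = g + (x - g)" by simp
    then show ?thesis using g by blast
  qed
  then have "{f + x | f x. f \<in> F \<and> x \<in> U} = UNIV" by (intro equalityI subset_UNIV subsetI)
  then show "\<exists>F. finite F \<and> {f + x | f x. f \<in> F \<and> x \<in> U} = UNIV" using F(1) by (intro exI[of _ F] conjI)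
qed

lemma limitin_zero_iff:
  assumes "group_topology T"
  shows "limitin T u 0 sequentially \<longleftrightarrow> (\<forall>U. nbhd0 T U \<longrightarrow> eventually (\<lambda>n. u n \<in> U) sequentially)"
proof -
  have ts: "topspace T = UNIV" using assms unfolding group_topology_def by simp
  have "(\<forall>U. openin T U \<and> 0 \<in> U \<longrightarrow> eventually (\<lambda>n. u n \<in> U) sequentially)
      \<longleftrightarrow> (\<forall>U. nbhd0 T U \<longrightarrow> eventually (\<lambda>n. u n \<in> U) sequentially)"
  proof (intro iffI allI impI)
    fix U assume *: "\<forall>U. openin T U \<and> 0 \<in> U \<longrightarrow> eventually (\<lambda>n. u n \<in> U) sequentially" and "nbhd0 T U"
    then obtain V where V: "openin T V" "0 \<in> V" "V \<subseteq> U" unfolding nbhd0_def by auto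
    then have "eventually (\<lambda>n. u n \<in> V) sequentially" using * by simp
    then show "eventually (\<lambda>n. u n \<in> U) sequentially" by (rule eventually_mono) (use V(3) in auto)
  next
    fix U assume *: "\<forall>U. nbhd0 T U \<longrightarrow> eventually (\<lambda>n. u n \<in> U) sequentially" and "openin T U \<and> 0 \<in> U"
    then have "nbhd0 T U" unfolding nbhd0_def by auto
    then show "eventually (\<lambda>n. u n \<in> U) sequentially" using * by simp
  qed
  then show ?thesis unfolding limitin_def ts by simp
qed

lemma openin_finer:
  assumes "group_topology T" "group_topology T'" "\<And>U. nbhd0 T' U \<Longrightarrow> nbhd0 T U" "openin T' U"
  shows "openin T U"
  using assms(3,4) unfolding openin_iff_nbhd0[OF assms(1)] openin_iff_nbhd0[OF assms(2)] by simp

text \<open>All properties of a precompact topology with null sequence \<open>u\<close> pass from a subbase of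
  neighbourhoods of zero to finite intersections; the Hausdorff property comes from the coarser
  topology \<open>T0\<close>.\<close>

lemma precompact_topology_from_subbase:
  assumes zero: "\<And>S. S \<in> \<S> \<Longrightarrow> 0 \<in> S"
    and diff: "\<And>S. S \<in> \<S> \<Longrightarrow> \<exists>M\<in>\<S>. \<forall>x\<in>M. \<forall>y\<in>M. x - y \<in> S"
    and cover: "\<And>S. S \<in> \<S> \<Longrightarrow> finitely_covering S"
    and null: "\<And>S. S \<in> \<S> \<Longrightarrow> eventually (\<lambda>n. u n \<in> S) sequentially"
    and T0: "precompact_group_topology T0" "\<And>U. nbhd0 T0 U \<Longrightarrow> U \<in> \<S>"
  obtains T where "precompact_group_topology T" "limitin T u 0 sequentially"
    "\<And>S. S \<in> \<S> \<Longrightarrow> nbhd0 T S"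
proof -
  obtain T where T: "group_topology T"
    and nbhd: "\<And>U. nbhd0 T U \<longleftrightarrow> (\<exists>F. finite F \<and> F \<subseteq> \<S> \<and> \<Inter>F \<subseteq> U)"
  proof (rule group_topology_from_subbase[of \<S>])
    show "0 \<in> S" if "S \<in> \<S>" for S using that by (rule zero)
    show "\<exists>M\<in>\<S>. \<forall>x\<in>M. \<forall>y\<in>M. x - y \<in> S" if "S \<in> \<S>" for S using that by (rule diff)
  qed (rule that)
  have nbhd_S: "nbhd0 T S" if "S \<in> \<S>" for S
    unfolding nbhd using that by (intro exI[of _ "{S}"]) simp
  have "finitely_covering U" if U: "nbhd0 T U" for U
  proof -
    from U obtain F where F: "finite F" "F \<subseteq> \<S>" "\<Inter>F \<subseteq> U"
      unfolding nbhd by (elim exE conjE) (rule that)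
    from F(1,2) have "finitely_covering (\<Inter>F)"
      by (induction F rule: finite_induct) (simp_all add: finitely_covering_Int cover)
    then show ?thesis by (rule finitely_covering_mono[OF _ F(3)])
  qed
  moreover have "Hausdorff_space T"
    unfolding Hausdorff_space_def
  proof (intro allI impI)
    have op: "openin T U" if "openin T0 U" for U
      using openin_finer[OF T precompactD(1)[OF T0(1)] _ that] nbhd_S T0(2) by simp
    have ts: "topspace T = UNIV" "topspace T0 = UNIV"
      using T precompactD(1)[OF T0(1)] unfolding group_topology_def by simp_all
    fix x y assume "x \<in> topspace T \<and> y \<in> topspace T \<and> x \<noteq> y"
    then obtain U V where "openin T0 U" "openin T0 V" "x \<in> U" "y \<in> V" "disjnt U V"
      using precompactD(2)[OF T0(1)] unfolding Hausdorff_space_def ts by (metis UNIV_I)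
    then show "\<exists>U V. openin T U \<and> openin T V \<and> x \<in> U \<and> y \<in> V \<and> disjnt U V"
      using op by (intro exI[of _ U] exI[of _ V]) simp
  qed
  ultimately have "precompact_group_topology T" by (intro precompactI[OF T])
  moreover have "limitin T u 0 sequentially"
    unfolding limitin_zero_iff[OF T]
  proof (intro allI impI)
    fix U assume "nbhd0 T U"
    then obtain F where F: "finite F" "F \<subseteq> \<S>" "\<Inter>F \<subseteq> U"
      unfolding nbhd by (elim exE conjE) (rule that)
    have "eventually (\<lambda>n. \<forall>S\<in>F. u n \<in> S) sequentially"
      using F(1,2) null by (intro eventually_ball_finite) auto
    then show "eventually (\<lambda>n. u n \<in> U) sequentially" by (rule eventually_mono) (use F(3) in auto)
  qed
  ultimately show ?thesis using nbhd_S by (rule that)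
qed

definition finest_precompact_null :: "(nat \<Rightarrow> 'a::ab_group_add) \<Rightarrow> 'a topology \<Rightarrow> bool" where
  "finest_precompact_null u T \<longleftrightarrow> precompact_group_topology T \<and> limitin T u 0 sequentially \<and>
     (\<forall>T'. precompact_group_topology T' \<and> limitin T' u 0 sequentially \<longrightarrow>
        (\<forall>U. openin T' U \<longrightarrow> openin T U))"

lemma tau_eqI:
  assumes "finest_precompact_null u T" shows "tau u = T"
  unfolding tau_def finest_precompact_null_def[symmetric]
proof (rule the_equality)
  show "finest_precompact_null u T" by (rule assms)
  fix T' assume T': "finest_precompact_null u T'"
  show "T' = T"
    unfolding topology_eq using assms T' unfolding finest_precompact_null_def by blast
qed

text \<open>The supremum of all precompact topologies with null sequence \<open>u\<close>: its subbase consists of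
  the neighbourhoods of zero of all of them.\<close>

lemma finest_precompact_null_exists:
  assumes "TB_sequence u"
  shows "finest_precompact_null u (tau u)"
proof -
  define P where "P T \<longleftrightarrow> precompact_group_topology T \<and> limitin T u 0 sequentially" for T
  obtain T0 where T0: "P T0" using assms unfolding TB_sequence_def P_def by auto
  define \<S> where "\<S> = {S. \<exists>T. P T \<and> nbhd0 T S}"
  have SD: "\<exists>T. P T \<and> nbhd0 T S" if "S \<in> \<S>" for S using that unfolding \<S>_def by simp
  have SI: "S \<in> \<S>" if "P T" "nbhd0 T S" for S T using that unfolding \<S>_def by auto
  obtain T where T: "precompact_group_topology T" "limitin T u 0 sequentially"
    "\<And>S. S \<in> \<S> \<Longrightarrow> nbhd0 T S"
  proof (rule precompact_topology_from_subbase[of \<S> u T0])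
    fix S assume "S \<in> \<S>"
    then obtain T where T: "P T" "nbhd0 T S" using SD by auto
    note gT = precompactD(1)[of T]
    show "0 \<in> S" using T(2) by (rule nbhd0_zero)
    show "\<exists>M\<in>\<S>. \<forall>x\<in>M. \<forall>y\<in>M. x - y \<in> S"
    proof -
      obtain M where "nbhd0 T M" "\<And>x y. x \<in> M \<Longrightarrow> y \<in> M \<Longrightarrow> x - y \<in> S"
        by (rule nbhd0_diff[OF gT T(2)]) (use T(1) in \<open>auto simp: P_def intro: that\<close>)
      then show ?thesis using SI[OF T(1)] by (intro bexI[of _ M]) auto
    qed
    show "finitely_covering S" using precompact_finitely_covering T unfolding P_def by auto
    show "eventually (\<lambda>n. u n \<in> S) sequentially" using limitin_zero_iff[OF gT] T unfolding P_def by auto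
  next
    show "precompact_group_topology T0" using T0 unfolding P_def by simp
    show "U \<in> \<S>" if "nbhd0 T0 U" for U using SI[OF T0 that] .
  qed (rule that)
  have "finest_precompact_null u T"
    unfolding finest_precompact_null_def
  proof (intro conjI allI impI T(1,2))
    fix T' U assume T': "precompact_group_topology T' \<and> limitin T' u 0 sequentially" and U: "openin T' U"
    have "nbhd0 T V" if "nbhd0 T' V" for V using T(3) SI[of T' V] T' that unfolding P_def by simp
    then show "openin T U" using U T' by (intro openin_finer[OF precompactD(1)[OF T(1)] precompactD(1), of T']) auto
  qed
  then show ?thesis using tau_eqI[of u T] by simp
qed

text \<open>The sets where \<open>\<phi>\<close> is close to 1, together with the neighbourhoods of zero of \<open>T\<close>, generate
  a precompact topology in which \<open>u\<close> is still null.\<close>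

lemma character_continuous_finest:
  assumes T: "finest_precompact_null u T" and \<phi>: "character \<phi>" and lim: "(\<lambda>n. \<phi> (u n)) \<longlonglongrightarrow> 1"
  shows "\<phi> \<in> continuous_characters T"
proof -
  have pT: "precompact_group_topology T" and uT: "limitin T u 0 sequentially"
    using T unfolding finest_precompact_null_def by auto
  note gT = precompactD(1)[OF pT]
  define B where "B e = {x. cmod (\<phi> x - 1) \<le> e}" for e
  define \<S> where "\<S> = {U. nbhd0 T U} \<union> B ` {0<..}"
  have B_S: "B e \<in> \<S>" if "e > 0" for e using that unfolding \<S>_def by simp
  obtain T' where T': "precompact_group_topology T'" "limitin T' u 0 sequentially"
    "\<And>S. S \<in> \<S> \<Longrightarrow> nbhd0 T' S"
  proof (rule precompact_topology_from_subbase[of \<S> u T])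
    fix S assume "S \<in> \<S>"
    then consider "nbhd0 T S" | e where "e > 0" "S = B e" unfolding \<S>_def by auto
    note S_cases = this
    show "0 \<in> S" by (cases rule: S_cases) (auto simp: nbhd0_zero B_def character_0[OF \<phi>])
    show "\<exists>M\<in>\<S>. \<forall>x\<in>M. \<forall>y\<in>M. x - y \<in> S"
    proof (cases rule: S_cases)
      case 1
      then obtain M where "nbhd0 T M" "\<And>x y. x \<in> M \<Longrightarrow> y \<in> M \<Longrightarrow> x - y \<in> S"
        by (rule nbhd0_diff[OF gT]) (rule that)
      then show ?thesis unfolding \<S>_def by (intro bexI[of _ M]) auto
    next
      case (2 e)
      have "x - y \<in> S" if "x \<in> B (e/2)" "y \<in> B (e/2)" for x y
      proof -
        have "cmod (\<phi> x - \<phi> y) \<le> e"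
          by (rule norm_diff_triangle_half[of _ 1]) (use that in \<open>simp_all add: B_def norm_minus_commute\<close>)
        then show ?thesis unfolding 2 B_def by (simp add: cmod_character_diff[OF \<phi>])
      qed
      then show ?thesis using 2(1) by (intro bexI[of _ "B (e/2)"] B_S) auto
    qed
    show "finitely_covering S"
      by (cases rule: S_cases)
         (auto simp: B_def intro: precompact_finitely_covering[OF pT] character_finitely_covering[OF \<phi>])
    show "eventually (\<lambda>n. u n \<in> S) sequentially"
    proof (cases rule: S_cases)
      case 1
      then show ?thesis using uT unfolding limitin_zero_iff[OF gT] by simp
    next
      case (2 e)
      have "eventually (\<lambda>n. dist (\<phi> (u n)) 1 < e) sequentially" using lim 2(1) by (rule tendstoD)
      then show ?thesis unfolding 2 B_def by (rule eventually_mono) (simp add: dist_norm)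
    qed
  next
    show "U \<in> \<S>" if "nbhd0 T U" for U using that unfolding \<S>_def by simp
  qed (rule pT, rule that)
  have "nbhd0 T (B (1/4))"
  proof -
    have "nbhd0 T' (B (1/4))" by (intro T'(3) B_S) simp
    then obtain V where "openin T' V" "0 \<in> V" "V \<subseteq> B (1/4)" unfolding nbhd0_def by auto
    moreover from this have "openin T V" using T T'(1,2) unfolding finest_precompact_null_def by auto
    ultimately show ?thesis unfolding nbhd0_def by auto
  qed
  then show ?thesis by (rule continuous_characterI[OF gT \<phi>]) (simp add: B_def)
qed

section \<open>Characterizing countable groups of characters\<close>

lemma finite_witnesses:
  assumes "finite A" "\<And>a. a \<in> A \<Longrightarrow> \<exists>x\<in>W. P a x"
  shows "\<exists>F. finite F \<and> F \<subseteq> W \<and> (\<forall>a\<in>A. \<exists>x\<in>F. P a x)"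
proof -
  from assms(2) have "\<forall>a\<in>A. \<exists>x. x \<in> W \<and> P a x" by auto
  from bchoice[OF this] obtain f where "\<forall>a\<in>A. f a \<in> W \<and> P a (f a)" ..
  then show ?thesis using assms(1) by (intro exI[of _ "f ` A"]) auto
qed

lemma character_limit:
  assumes "\<And>j. character (f j)" "\<And>x. (\<lambda>j. f j x) \<longlonglongrightarrow> \<phi> x"
  shows "character \<phi>"
  unfolding character_def
proof (intro conjI allI)
  fix x y
  have "(\<lambda>j. f j x * f j y) \<longlonglongrightarrow> \<phi> x * \<phi> y" by (intro tendsto_mult assms(2))
  then show "\<phi> (x + y) = \<phi> x * \<phi> y"
    using assms(2)[of "x + y"] unfolding character_add[OF assms(1)] by (metis LIMSEQ_unique)
  have "(\<lambda>j. cmod (f j x)) \<longlonglongrightarrow> cmod (\<phi> x)" by (intro tendsto_norm assms(2))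
  then show "cmod (\<phi> x) = 1"
    unfolding character_norm[OF assms(1)] using LIMSEQ_unique tendsto_const by metis
qed

text \<open>Compactness of the space of characters in the topology of pointwise convergence, applied to
  an increasing sequence of finite subsets exhausting \<open>W\<close>.\<close>

lemma finite_test_set:
  fixes W E :: "'a::ab_group_add set"
  assumes "countable (UNIV :: 'a set)" and E: "finite E" and "\<epsilon> > 0"
  shows "\<exists>R. finite R \<and> R \<subseteq> W \<and>
    (\<forall>\<phi>. character \<phi> \<longrightarrow> (\<forall>x\<in>R. cmod (\<phi> x - 1) \<le> \<epsilon>) \<longrightarrow>
      (\<exists>h. character h \<and> (\<forall>x\<in>W. cmod (h x - 1) \<le> \<epsilon>) \<and> (\<forall>x\<in>E. cmod (\<phi> x - h x) \<le> \<epsilon>)))"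
proof (rule ccontr)
  assume neg: "\<not> ?thesis"
  define g where "g = from_nat_into (UNIV :: 'a set)"
  have g: "range g = UNIV" unfolding g_def using assms(1) by (intro range_from_nat_into) auto
  define R where "R j = g ` {..j} \<inter> W" for j
  define near where "near \<phi> \<longleftrightarrow>
    (\<exists>h. character h \<and> (\<forall>x\<in>W. cmod (h x - 1) \<le> \<epsilon>) \<and> (\<forall>x\<in>E. cmod (\<phi> x - h x) \<le> \<epsilon>))" for \<phi>
  have "\<exists>\<phi>. character \<phi> \<and> (\<forall>x\<in>R j. cmod (\<phi> x - 1) \<le> \<epsilon>) \<and> \<not> near \<phi>" for j
  proof -
    have Rj: "finite (R j)" "R j \<subseteq> W" unfolding R_def by auto
    show ?thesis
    proof (rule ccontr)
      assume "\<not> (\<exists>\<phi>. character \<phi> \<and> (\<forall>x\<in>R j. cmod (\<phi> x - 1) \<le> \<epsilon>) \<and> \<not> near \<phi>)"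
      then have "\<forall>\<phi>. character \<phi> \<longrightarrow> (\<forall>x\<in>R j. cmod (\<phi> x - 1) \<le> \<epsilon>) \<longrightarrow> near \<phi>" by blast
      with Rj have "finite (R j) \<and> R j \<subseteq> W \<and>
        (\<forall>\<phi>. character \<phi> \<longrightarrow> (\<forall>x\<in>R j. cmod (\<phi> x - 1) \<le> \<epsilon>) \<longrightarrow> near \<phi>)" by (intro conjI)
      from neg[unfolded near_def[symmetric] not_ex, THEN spec, of "R j"] this show False by (rule notE)
    qed
  qed
  then have "\<forall>j. \<exists>\<phi>. character \<phi> \<and> (\<forall>x\<in>R j. cmod (\<phi> x - 1) \<le> \<epsilon>) \<and> \<not> near \<phi>" ..
  from choice[OF this] obtain f where
    f: "\<forall>j. character (f j) \<and> (\<forall>x\<in>R j. cmod (f j x - 1) \<le> \<epsilon>) \<and> \<not> near (f j)" ..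
  have f_char: "character (f j)" for j using f by simp
  obtain r where r: "strict_mono (r :: nat \<Rightarrow> nat)" "\<And>x. x \<in> UNIV \<Longrightarrow> \<exists>l. (\<lambda>j. f (r j) x) \<longlonglongrightarrow> l"
    by (rule function_convergent_subsequence[of UNIV f 1, OF assms(1)])
       (use character_norm[OF f_char] in simp, rule that)
  from r(2) have "\<forall>x. \<exists>l. (\<lambda>j. f (r j) x) \<longlonglongrightarrow> l" by simp
  from choice[OF this] obtain h where "\<forall>x. (\<lambda>j. f (r j) x) \<longlonglongrightarrow> h x" ..
  then have h: "(\<lambda>j. f (r j) x) \<longlonglongrightarrow> h x" for x by simp
  have h_char: "character h" by (rule character_limit[OF f_char h])
  have "cmod (h x - 1) \<le> \<epsilon>" if x: "x \<in> W" for x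
  proof (rule tendsto_upperbound)
    show "(\<lambda>j. cmod (f (r j) x - 1)) \<longlonglongrightarrow> cmod (h x - 1)"
      by (intro tendsto_intros h)
    obtain i where i: "x = g i" using g by (metis UNIV_I imageE)
    have "cmod (f (r j) x - 1) \<le> \<epsilon>" if "j \<ge> i" for j
    proof -
      have "i \<le> r j" using that seq_suble[OF r(1), of j] by simp
      then have "x \<in> R (r j)" using x unfolding R_def i by simp
      then show ?thesis using f by simp
    qed
    then show "\<forall>\<^sub>F j in sequentially. cmod (f (r j) x - 1) \<le> \<epsilon>"
      unfolding eventually_sequentially by auto
  qed simp
  moreover have "\<forall>\<^sub>F j in sequentially. \<forall>x\<in>E. cmod (f (r j) x - h x) \<le> \<epsilon>"
  proof (rule eventually_ball_finite[OF E], rule ballI)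
    fix x
    have "\<forall>\<^sub>F j in sequentially. dist (f (r j) x) (h x) < \<epsilon>" using h assms(3) by (rule tendstoD)
    then show "\<forall>\<^sub>F j in sequentially. cmod (f (r j) x - h x) \<le> \<epsilon>"
      by (rule eventually_mono) (simp add: dist_norm)
  qed
  then obtain j where "\<forall>x\<in>E. cmod (f (r j) x - h x) \<le> \<epsilon>"
    unfolding eventually_sequentially by auto
  ultimately have "near (f (r j))" unfolding near_def using h_char by (intro exI[of _ h]) simp
  then show False using f by simp
qed

text \<open>Let \<open>H n\<close> be the finite set of characters within \<open>1/4\<close> of 1 on \<open>W n\<close>. The set \<open>S n\<close> contains
  witnesses \<open>P n\<close> that expose the elements of \<open>H (n + 1)\<close> outside \<open>H n\<close>, and a test set \<open>R n\<close>
  ensuring that a character close to 1 on it agrees up to \<open>1/16\<close> with some \<open>h n \<in> H n\<close> on the finite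
  set \<open>E n\<close>. As \<open>E n\<close> separates both \<open>H n\<close> and \<open>H (n - 1)\<close> and contains \<open>P (n - 1)\<close>, consecutive
  \<open>h n\<close> coincide; as the \<open>E n\<close> exhaust the group, the character equals their common value.\<close>

lemma characterizing_finite_sets:
  fixes W :: "nat \<Rightarrow> 'a::ab_group_add set"
  assumes count: "countable (UNIV :: 'a set)"
    and cover: "\<And>n. finitely_covering (W n)" and dec: "\<And>n. W (Suc n) \<subseteq> W n"
  obtains S where "\<And>n. finite (S n)" "\<And>n. S n \<subseteq> W n"
    "\<And>\<phi> N. character \<phi> \<longrightarrow> (\<forall>n\<ge>N. \<forall>x\<in>S n. cmod (\<phi> x - 1) \<le> 1/16) \<longrightarrow>
       (\<forall>x\<in>W N. cmod (\<phi> x - 1) \<le> 1/4)"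
proof -
  define g where "g = from_nat_into (UNIV :: 'a set)"
  have g: "range g = UNIV" unfolding g_def using count by (intro range_from_nat_into) auto
  define H where "H n = {\<phi>. character \<phi> \<and> (\<forall>x\<in>W n. cmod (\<phi> x - 1) \<le> 1/4)}" for n
  have H_fin: "finite (H n)" for n unfolding H_def by (rule finite_small_characters[OF cover])
  have "\<forall>n. \<exists>P. finite P \<and> P \<subseteq> W n \<and> (\<forall>h\<in>H (Suc n) - H n. \<exists>x\<in>P. \<not> cmod (h x - 1) \<le> 1/4)"
  proof
    fix n
    show "\<exists>P. finite P \<and> P \<subseteq> W n \<and> (\<forall>h\<in>H (Suc n) - H n. \<exists>x\<in>P. \<not> cmod (h x - 1) \<le> 1/4)"
      using H_fin by (intro finite_witnesses) (auto simp: H_def)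
  qed
  from choice[OF this] obtain P where
    P: "\<forall>n. finite (P n) \<and> P n \<subseteq> W n \<and> (\<forall>h\<in>H (Suc n) - H n. \<exists>x\<in>P n. \<not> cmod (h x - 1) \<le> 1/4)" ..
  \<comment> \<open>Distinct characters differ by more than \<open>3/4\<close> somewhere, so finitely many points separate \<open>H n\<close>.\<close>
  have "\<forall>n. \<exists>D. finite D \<and> D \<subseteq> UNIV \<and>
      (\<forall>p\<in>(H n \<times> H n) \<inter> {p. fst p \<noteq> snd p}. \<exists>x\<in>D. \<not> cmod (fst p x - snd p x) \<le> 3/4)"
  proof
    fix n
    have "\<exists>x\<in>UNIV. \<not> cmod (fst p x - snd p x) \<le> 3/4" if "p \<in> (H n \<times> H n) \<inter> {p. fst p \<noteq> snd p}" for p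
      using close_characters_eq[of "fst p" "snd p"] that unfolding H_def by auto
    then show "\<exists>D. finite D \<and> D \<subseteq> UNIV \<and>
      (\<forall>p\<in>(H n \<times> H n) \<inter> {p. fst p \<noteq> snd p}. \<exists>x\<in>D. \<not> cmod (fst p x - snd p x) \<le> 3/4)"
      using H_fin by (intro finite_witnesses) auto
  qed
  from choice[OF this] obtain D where D: "\<forall>n. finite (D n) \<and> D n \<subseteq> UNIV \<and>
      (\<forall>p\<in>(H n \<times> H n) \<inter> {p. fst p \<noteq> snd p}. \<exists>x\<in>D n. \<not> cmod (fst p x - snd p x) \<le> 3/4)" ..
  \<comment> \<open>For \<open>n = 0\<close> the truncated index \<open>n - 1\<close> is 0, so \<open>E 0\<close> contains \<open>P 0\<close> and \<open>D 0\<close>.\<close>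
  define E where "E n = g ` {..n} \<union> P (n - 1) \<union> D n \<union> D (n - 1)" for n
  have E_fin: "finite (E n)" for n unfolding E_def using P D by simp
  have "\<forall>n. \<exists>R. finite R \<and> R \<subseteq> W n \<and>
    (\<forall>\<phi>. character \<phi> \<longrightarrow> (\<forall>x\<in>R. cmod (\<phi> x - 1) \<le> 1/16) \<longrightarrow>
      (\<exists>h. character h \<and> (\<forall>x\<in>W n. cmod (h x - 1) \<le> 1/16) \<and> (\<forall>x\<in>E n. cmod (\<phi> x - h x) \<le> 1/16)))"
    by (intro allI finite_test_set count E_fin) simp
  from choice[OF this] obtain R where R: "\<forall>n. finite (R n) \<and> R n \<subseteq> W n \<and>
    (\<forall>\<phi>. character \<phi> \<longrightarrow> (\<forall>x\<in>R n. cmod (\<phi> x - 1) \<le> 1/16) \<longrightarrow>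
      (\<exists>h. character h \<and> (\<forall>x\<in>W n. cmod (h x - 1) \<le> 1/16) \<and> (\<forall>x\<in>E n. cmod (\<phi> x - h x) \<le> 1/16)))" ..
  define S where "S n = P n \<union> R n" for n
  have S: "finite (S n)" "S n \<subseteq> W n" for n unfolding S_def using P R by simp_all
  have main: "\<forall>x\<in>W N. cmod (\<phi> x - 1) \<le> 1/4"
    if \<phi>: "character \<phi>" and small: "\<forall>n\<ge>N. \<forall>x\<in>S n. cmod (\<phi> x - 1) \<le> 1/16" for \<phi> N
  proof -
    have "\<forall>n\<in>{N..}. \<exists>h. h \<in> H n \<and> (\<forall>x\<in>E n. cmod (\<phi> x - h x) \<le> 1/16)"
    proof
      fix n assume "n \<in> {N..}"
      then have Rn: "\<forall>x\<in>R n. cmod (\<phi> x - 1) \<le> 1/16" using small unfolding S_def by simp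
      from spec[OF R, of n, THEN conjunct2, THEN conjunct2, THEN spec, of \<phi>, THEN mp, OF \<phi>, THEN mp, OF Rn]
      obtain h where h: "character h" "\<forall>x\<in>W n. cmod (h x - 1) \<le> 1/16"
        "\<forall>x\<in>E n. cmod (\<phi> x - h x) \<le> 1/16" by (elim exE conjE) (rule that)
      have "cmod (h x - 1) \<le> 1/4" if "x \<in> W n" for x using bspec[OF h(2) that] by simp
      then have "h \<in> H n" unfolding H_def using h(1) by simp
      then show "\<exists>h. h \<in> H n \<and> (\<forall>x\<in>E n. cmod (\<phi> x - h x) \<le> 1/16)" using h(3) by auto
    qed
    from bchoice[OF this] obtain h where
      h: "\<forall>n\<in>{N..}. h n \<in> H n \<and> (\<forall>x\<in>E n. cmod (\<phi> x - h n x) \<le> 1/16)" ..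
    have h_mem: "h n \<in> H n" if "n \<ge> N" for n using h that by simp
    have h_close: "cmod (\<phi> x - h n x) \<le> 1/16" if "n \<ge> N" "x \<in> E n" for n x using h that by simp
    have step: "h (Suc n) = h n" if n: "n \<ge> N" for n
    proof -
      have "cmod (h (Suc n) x - 1) \<le> 1/4" if "x \<in> P n" for x
      proof -
        have 1: "cmod (\<phi> x - h (Suc n) x) \<le> 1/16" using n that by (intro h_close) (auto simp: E_def)
        have 2: "cmod (\<phi> x - 1) \<le> 1/16" using small n that unfolding S_def by simp
        have "cmod (h (Suc n) x - 1) \<le> 1/16 + 1/16"
          by (rule norm_diff_triangle_le[OF _ 2]) (use 1 in \<open>simp add: norm_minus_commute\<close>)
        then show ?thesis by simp
      qed
      then have "\<not> (\<exists>x\<in>P n. \<not> cmod (h (Suc n) x - 1) \<le> 1/4)" by simp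
      then have "h (Suc n) \<notin> H (Suc n) - H n"
        using spec[OF P, of n, THEN conjunct2, THEN conjunct2] by (meson bspec)
      then have mem: "h (Suc n) \<in> H n" using h_mem[of "Suc n"] n by simp
      have "cmod (h (Suc n) x - h n x) \<le> 3/4" if "x \<in> D n" for x
      proof -
        have 1: "cmod (\<phi> x - h (Suc n) x) \<le> 1/16" using n that by (intro h_close) (auto simp: E_def)
        have 2: "cmod (\<phi> x - h n x) \<le> 1/16" using n that by (intro h_close) (auto simp: E_def)
        have "cmod (h (Suc n) x - h n x) \<le> 1/16 + 1/16"
          by (rule norm_diff_triangle_le[OF _ 2]) (use 1 in \<open>simp add: norm_minus_commute\<close>)
        then show ?thesis by simp
      qed
      then have no_witness: "\<not> (\<exists>x\<in>D n. \<not> cmod (h (Suc n) x - h n x) \<le> 3/4)" by simp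
      show ?thesis
      proof (rule ccontr)
        assume "h (Suc n) \<noteq> h n"
        then have "(h (Suc n), h n) \<in> (H n \<times> H n) \<inter> {p. fst p \<noteq> snd p}" using mem h_mem[OF n] by simp
        from bspec[OF spec[OF D, of n, THEN conjunct2, THEN conjunct2] this] no_witness show False by simp
      qed
    qed
    have h_eq: "h n = h N" if "n \<ge> N" for n
      using that by (induction n rule: dec_induct) (simp_all add: step)
    have "cmod (\<phi> x - h N x) \<le> 3/4" for x
    proof -
      obtain i where i: "x = g i" using g by (metis UNIV_I imageE)
      have "cmod (\<phi> x - h (max N i) x) \<le> 1/16" by (intro h_close) (auto simp: E_def i)
      then show ?thesis using h_eq[of "max N i"] by simp
    qed
    then have "\<phi> = h N"
      using close_characters_eq[OF \<phi>, of "h N"] h_mem[of N] unfolding H_def by simp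
    then show ?thesis using h_mem[of N] unfolding H_def by simp
  qed
  show ?thesis by (rule that[of S]) (rule S, rule S, intro impI, rule main)
qed

text \<open>The pairing function lists the \<open>j\<close>-th element of \<open>S n\<close> at a position not smaller than \<open>n\<close>;
  positions with \<open>j\<close> out of range are filled with 0, which is harmless for a null sequence.\<close>

lemma enumerate_finite_sets:
  fixes S :: "nat \<Rightarrow> 'a::ab_group_add set"
  assumes "\<And>n. finite (S n)"
  obtains u :: "nat \<Rightarrow> 'a" where "\<And>N. finite {m. u m \<notin> insert 0 (\<Union>n\<in>{N..}. S n)}"
    "\<And>n x. x \<in> S n \<Longrightarrow> \<exists>m\<ge>n. u m = x"
proof -
  from assms have "\<forall>n. \<exists>l. set l = S n" by (simp add: finite_list)
  from choice[OF this] obtain L where L: "\<forall>n. set (L n) = S n" ..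
  define v where "v n j = (if j < length (L n) then L n ! j else 0)" for n j
  define u where "u m = v (fst (prod_decode m)) (snd (prod_decode m))" for m
  have u_enc: "u (prod_encode (n, j)) = v n j" for n j unfolding u_def by simp
  show ?thesis
  proof
    fix N
    have "{m. u m \<notin> insert 0 (\<Union>n\<in>{N..}. S n)} \<subseteq> prod_encode ` (SIGMA n:{..<N}. {..<length (L n)})"
    proof
      fix m assume m: "m \<in> {m. u m \<notin> insert 0 (\<Union>n\<in>{N..}. S n)}"
      obtain n j where nj: "m = prod_encode (n, j)" by (metis prod_decode_inverse surj_pair)
      have j: "j < length (L n)" using m unfolding nj by (auto simp: u_enc v_def split: if_splits)
      then have "v n j \<in> S n" using L unfolding v_def by (metis nth_mem)
      then have "n < N" using m unfolding nj by (auto simp: u_enc)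
      then show "m \<in> prod_encode ` (SIGMA n:{..<N}. {..<length (L n)})" using j nj by auto
    qed
    then show "finite {m. u m \<notin> insert 0 (\<Union>n\<in>{N..}. S n)}" by (rule finite_subset) auto
  next
    fix n x assume "x \<in> S n"
    then obtain j where "j < length (L n)" "L n ! j = x" using L by (metis in_set_conv_nth)
    then have "u (prod_encode (n, j)) = x" by (simp add: u_enc v_def)
    then show "\<exists>m\<ge>n. u m = x" using le_prod_encode_1 by blast
  qed
qed

lemma characterizing_sequence_exists:
  fixes T :: "'a::ab_group_add topology"
  assumes T: "precompact_group_topology T" and met: "metrizable_space T" and count: "countable (UNIV :: 'a set)"
  obtains u where "limitin T u 0 sequentially"
    "\<And>\<phi>. character \<phi> \<and> (\<lambda>n. \<phi> (u n)) \<longlonglongrightarrow> 1 \<longrightarrow> \<phi> \<in> continuous_characters T"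
proof -
  note gT = precompactD(1)[OF T]
  have ts: "topspace T = UNIV" using gT unfolding group_topology_def by simp
  have "\<exists>\<B>. countable \<B> \<and> (\<forall>V\<in>\<B>. openin T V) \<and> (\<forall>U. openin T U \<and> 0 \<in> U \<longrightarrow> (\<exists>V\<in>\<B>. 0 \<in> V \<and> V \<subseteq> U))"
    using metrizable_imp_first_countable[OF met] unfolding first_countable_def ts by simp
  then obtain \<B> where \<B>: "countable \<B>" "\<And>V. V \<in> \<B> \<Longrightarrow> openin T V"
    "\<And>U. openin T U \<Longrightarrow> 0 \<in> U \<Longrightarrow> \<exists>V\<in>\<B>. 0 \<in> V \<and> V \<subseteq> U" by auto
  define \<B>0 where "\<B>0 = insert UNIV {V \<in> \<B>. 0 \<in> V}"
  have "countable \<B>0" "\<B>0 \<noteq> {}" unfolding \<B>0_def using \<B>(1) by auto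
  then have enum: "range (from_nat_into \<B>0) = \<B>0" by (rule range_from_nat_into[rotated])
  have B0_nbhd: "nbhd0 T V" if "V \<in> \<B>0" for V
    using that \<B>(2) nbhd0_UNIV[OF gT] unfolding \<B>0_def nbhd0_def by auto
  define W where "W n = (\<Inter>i\<le>n. from_nat_into \<B>0 i)" for n
  have W_nbhd: "nbhd0 T (W n)" for n
  proof (induction n)
    case 0
    then show ?case unfolding W_def using B0_nbhd enum by auto
  next
    case (Suc n)
    have "W (Suc n) = from_nat_into \<B>0 (Suc n) \<inter> W n" unfolding W_def by (simp add: atMost_Suc)
    moreover have "nbhd0 T (from_nat_into \<B>0 (Suc n))" using B0_nbhd enum by auto
    ultimately show ?case using Suc.IH by (simp add: nbhd0_Int)
  qed
  have W_base: "\<exists>n. W n \<subseteq> U" if U: "nbhd0 T U" for U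
  proof -
    obtain V where V: "openin T V" "0 \<in> V" "V \<subseteq> U" using U unfolding nbhd0_def by auto
    obtain V' where V': "V' \<in> \<B>" "0 \<in> V'" "V' \<subseteq> V" using \<B>(3)[OF V(1,2)] by auto
    then have "V' \<in> \<B>0" unfolding \<B>0_def by simp
    then have "V' \<in> range (from_nat_into \<B>0)" by (simp only: enum)
    then obtain n where "V' = from_nat_into \<B>0 n" by auto
    then have "W n \<subseteq> V'" unfolding W_def by auto
    then show ?thesis using V'(3) V(3) by auto
  qed
  have W_dec: "W n \<subseteq> W m" if "m \<le> n" for m n unfolding W_def using that by force
  have W_Suc: "W (Suc n) \<subseteq> W n" for n by (rule W_dec) simp
  have W_cover: "finitely_covering (W n)" for n by (rule precompact_finitely_covering[OF T W_nbhd])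
  obtain S where S: "\<And>n. finite (S n)" "\<And>n. S n \<subseteq> W n"
    and S_char: "\<And>\<phi> N. character \<phi> \<longrightarrow> (\<forall>n\<ge>N. \<forall>x\<in>S n. cmod (\<phi> x - 1) \<le> 1/16) \<longrightarrow>
       (\<forall>x\<in>W N. cmod (\<phi> x - 1) \<le> 1/4)"
    by (rule characterizing_finite_sets[where W = W, OF count W_cover W_Suc]) (rule that)
  obtain u where u: "\<And>N. finite {m. u m \<notin> insert 0 (\<Union>n\<in>{N..}. S n)}"
    "\<And>n x. x \<in> S n \<Longrightarrow> \<exists>m\<ge>n. u m = x" by (rule enumerate_finite_sets[of S, OF S(1)]) (rule that)
  have "limitin T u 0 sequentially"
    unfolding limitin_zero_iff[OF gT]
  proof (intro allI impI)
    fix U assume "nbhd0 T U"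
    then obtain N where N: "W N \<subseteq> U" using W_base by auto
    have "S n \<subseteq> U" if "n \<ge> N" for n using S(2)[of n] W_dec[OF that] N by (meson order_trans)
    then have "insert 0 (\<Union>n\<in>{N..}. S n) \<subseteq> U" using nbhd0_zero[OF \<open>nbhd0 T U\<close>] by auto
    then have "{m. u m \<notin> U} \<subseteq> {m. u m \<notin> insert 0 (\<Union>n\<in>{N..}. S n)}" by auto
    then have "finite {m. u m \<notin> U}" using u(1)[of N] by (rule finite_subset)
    then show "eventually (\<lambda>n. u n \<in> U) sequentially"
      unfolding cofinite_eq_sequentially[symmetric] eventually_cofinite .
  qed
  moreover have "\<phi> \<in> continuous_characters T"
    if \<phi>: "character \<phi>" and lim: "(\<lambda>n. \<phi> (u n)) \<longlonglongrightarrow> 1" for \<phi>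
  proof -
    have "eventually (\<lambda>n. dist (\<phi> (u n)) 1 < 1/16) sequentially" using lim by (rule tendstoD) simp
    then obtain N where N: "\<And>m. m \<ge> N \<Longrightarrow> cmod (\<phi> (u m) - 1) \<le> 1/16"
      unfolding eventually_sequentially dist_norm by (meson less_imp_le)
    have "cmod (\<phi> x - 1) \<le> 1/16" if n: "n \<ge> N" and x: "x \<in> S n" for n x
    proof -
      obtain m where "m \<ge> n" "u m = x" using u(2)[OF x] by auto
      then show ?thesis using N[of m] n by simp
    qed
    then have "\<forall>x\<in>W N. cmod (\<phi> x - 1) \<le> 1/4" using S_char[of \<phi> N] \<phi> by simp
    then show ?thesis by (intro continuous_characterI[OF gT \<phi> W_nbhd[of N]]) simp
  qed
  ultimately show ?thesis by (intro that[of u]) simp_all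
qed

text \<open>For a competing topology \<open>T'\<close> all continuous characters tend to 1 along \<open>u\<close> and are hence
  continuous for \<open>T\<close>; since they generate \<open>T'\<close>, the topology \<open>T\<close> is finer.\<close>

lemma ss_characterizedI:
  fixes T :: "'a::ab_group_add topology"
  assumes T: "precompact_group_topology T" and met: "metrizable_space T" and count: "countable (UNIV :: 'a set)"
  shows "ss_characterized T"
proof -
  obtain u where u: "limitin T u 0 sequentially"
    "\<And>\<phi>. character \<phi> \<and> (\<lambda>n. \<phi> (u n)) \<longlonglongrightarrow> 1 \<longrightarrow> \<phi> \<in> continuous_characters T"
    by (rule characterizing_sequence_exists[OF assms]) (rule that)
  have "finest_precompact_null u T"
    unfolding finest_precompact_null_def
  proof (intro conjI allI impI T u(1))
    fix T' U assume T': "precompact_group_topology T' \<and> limitin T' u 0 sequentially" and U: "openin T' U"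
    have pT': "precompact_group_topology T'" and gT': "group_topology T'"
      using T' precompactD(1) by auto
    have null: "eventually (\<lambda>n. u n \<in> V) sequentially" if "nbhd0 T' V" for V
      using T' that limitin_zero_iff[OF gT', of u] by simp
    have "nbhd0 T V" if V: "nbhd0 T' V" for V
    proof -
      obtain F where F: "finite F" "F \<subseteq> continuous_characters T'"
        "{x. \<forall>\<phi>\<in>F. cmod (\<phi> x - 1) \<le> 1/4} \<subseteq> V"
        by (rule nbhd0_contains_Bohr_set[OF pT' V]) (rule that)
      have "nbhd0 T {x. cmod (\<phi> x - 1) \<le> 1/4}" if \<phi>: "\<phi> \<in> F" for \<phi>
      proof -
        have c: "character \<phi>" and cont: "\<And>\<epsilon>. \<epsilon> > 0 \<Longrightarrow> nbhd0 T' {x. cmod (\<phi> x - 1) \<le> \<epsilon>}"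
          using F(2) \<phi> unfolding continuous_characters_def by auto
        have "(\<lambda>n. \<phi> (u n)) \<longlonglongrightarrow> 1"
        proof (rule tendstoI)
          fix e :: real assume e: "e > 0"
          then have "nbhd0 T' {x. cmod (\<phi> x - 1) \<le> e/2}" by (intro cont) simp
          from null[OF this] have "eventually (\<lambda>n. u n \<in> {x. cmod (\<phi> x - 1) \<le> e/2}) sequentially" .
          then show "eventually (\<lambda>n. dist (\<phi> (u n)) 1 < e) sequentially"
            by (rule eventually_mono) (use e in \<open>simp add: dist_norm\<close>)
        qed
        then have "\<phi> \<in> continuous_characters T" using u(2) c by simp
        then have "\<forall>\<epsilon>>0. nbhd0 T {x. cmod (\<phi> x - 1) \<le> \<epsilon>}"
          unfolding continuous_characters_def by simp
        then show ?thesis by (elim allE[of _ "1/4"]) simp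
      qed
      then have "nbhd0 T {x. \<forall>\<phi>\<in>F. x \<in> {x. cmod (\<phi> x - 1) \<le> 1/4}}"
        by (intro nbhd0_Inter F(1) precompactD(1)[OF T])
      then show ?thesis using F(3) by (intro nbhd0_mono[of T _ V]) auto
    qed
    then show "openin T U" using U by (intro openin_finer[OF precompactD(1)[OF T] gT'])
  qed
  then have "tau u = T" by (rule tau_eqI)
  moreover have "TB_sequence u" unfolding TB_sequence_def using T u(1) by auto
  ultimately show ?thesis unfolding ss_characterized_def by auto
qed

section \<open>Abelian groups have many characters\<close>

definition subgroup_span :: "'a::ab_group_add set \<Rightarrow> 'a set" where
  "subgroup_span A = {sum_list xs | xs. xs \<in> lists (A \<union> uminus ` A)}"

lemma subgroup_span_base: "x \<in> A \<Longrightarrow> x \<in> subgroup_span A"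
  unfolding subgroup_span_def by (intro CollectI exI[of _ "[x]"]) simp

lemma subgroup_span_zero: "0 \<in> subgroup_span A"
  unfolding subgroup_span_def by (intro CollectI exI[of _ "[]"]) simp

lemma subgroup_span_diff:
  assumes "x \<in> subgroup_span A" "y \<in> subgroup_span A" shows "x - y \<in> subgroup_span A"
proof -
  define B where "B = A \<union> uminus ` A"
  have span: "subgroup_span A = {sum_list xs | xs. xs \<in> lists B}" unfolding subgroup_span_def B_def ..
  obtain xs where xs: "xs \<in> lists B" "x = sum_list xs" using assms(1) unfolding span by auto
  obtain ys where ys: "ys \<in> lists B" "y = sum_list ys" using assms(2) unfolding span by auto
  have "- a \<in> B" if "a \<in> B" for a using that unfolding B_def by auto
  then have "map uminus zs \<in> lists B" if "zs \<in> lists B" for zs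
    using that by (induction zs) auto
  then have "xs @ map uminus ys \<in> lists B" using xs(1) ys(1) by simp
  moreover have "sum_list (map uminus ys) = - sum_list ys" by (induction ys) auto
  then have "x - y = sum_list (xs @ map uminus ys)" using xs ys by simp
  ultimately show ?thesis unfolding span by (intro CollectI exI[of _ "xs @ map uminus ys"] conjI)
qed

definition is_subgroup :: "'a::ab_group_add set \<Rightarrow> bool" where
  "is_subgroup K \<longleftrightarrow> 0 \<in> K \<and> (\<forall>x\<in>K. \<forall>y\<in>K. x - y \<in> K)"

lemma is_subgroup_span: "is_subgroup (subgroup_span A)"
  unfolding is_subgroup_def using subgroup_span_zero subgroup_span_diff by auto

lemma is_subgroup_add:
  assumes "is_subgroup K" "x \<in> K" "y \<in> K" shows "x + y \<in> K"
proof -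
  have "0 - y \<in> K" using assms unfolding is_subgroup_def by blast
  then have "x - (0 - y) \<in> K" using assms unfolding is_subgroup_def by blast
  then show ?thesis by simp
qed

lemma subgroup_span_minimal:
  assumes K: "is_subgroup K" and A: "A \<subseteq> K" shows "subgroup_span A \<subseteq> K"
proof -
  have "- x \<in> K" if "x \<in> K" for x
  proof -
    have "0 - x \<in> K" using that K unfolding is_subgroup_def by blast
    then show ?thesis by simp
  qed
  then have mem: "x \<in> K" if "x \<in> A \<union> uminus ` A" for x using that A by auto
  have "sum_list xs \<in> K" if "xs \<in> lists (A \<union> uminus ` A)" for xs
    using that
  proof (induction xs)
    case Nil
    then show ?case using K unfolding is_subgroup_def by simp
  next
    case (Cons x xs)
    have "x \<in> K" using mem Cons.hyps(1) .
    then show ?case using is_subgroup_add[OF K] Cons.IH by simp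
  qed
  then show ?thesis unfolding subgroup_span_def by auto
qed

lemma subgroup_span_mono: "A \<subseteq> B \<Longrightarrow> subgroup_span A \<subseteq> subgroup_span B"
  by (rule subgroup_span_minimal[OF is_subgroup_span]) (auto intro: subgroup_span_base)

definition nmul :: "nat \<Rightarrow> 'a::ab_group_add \<Rightarrow> 'a" where
  "nmul n x = (\<Sum>i<n. x)"

lemma nmul_simps [simp]: "nmul 0 x = 0" "nmul (Suc n) x = nmul n x + x"
  unfolding nmul_def by simp_all

lemma nmul_add: "nmul (m + n) x = nmul m x + nmul n x"
  by (induction n) (simp_all add: add.assoc)

lemma nmul_mult: "nmul (q * d) x = nmul q (nmul d x)"
  by (induction q) (simp_all add: nmul_add add.commute)

lemma nmul_mem: "is_subgroup K \<Longrightarrow> x \<in> K \<Longrightarrow> nmul n x \<in> K"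
  by (induction n) (auto simp: is_subgroup_add is_subgroup_def[of K])

text \<open>A second root is obtained by a rotation through \<open>2 * pi / d\<close>, which is not a full turn.\<close>

lemma two_roots:
  assumes "cmod v = 1" "d \<ge> 2"
  shows "\<exists>w. cmod w = 1 \<and> w ^ d = v \<and> w \<noteq> z"
proof -
  obtain t where t: "v = cis t" using assms(1) by (metis complex_norm_eq_1_exp cis_conv_exp)
  define w1 where "w1 = cis (t / real d)"
  define w2 where "w2 = cis (t / real d) * cis (2 * pi / real d)"
  have d: "real d > 0" using assms(2) by simp
  have "w1 ^ d = v" unfolding w1_def t using d by (simp add: Complex.DeMoivre)
  moreover have "w2 ^ d = v"
    unfolding w2_def power_mult_distrib t using d by (simp add: Complex.DeMoivre)
  moreover have "w1 \<noteq> w2"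
  proof
    assume "w1 = w2"
    then have "cis (2 * pi / real d) = 1" unfolding w1_def w2_def by simp
    then have c: "cos (2 * pi / real d) = 1" by (simp add: complex_eq_iff)
    have "0 < 2 * pi / real d" "2 * pi / real d \<le> pi" using assms(2) d by (auto simp: field_simps)
    then have "cos (2 * pi / real d) < cos 0" by (intro cos_monotone_0_pi) auto
    then show False using c by simp
  qed
  moreover have "cmod w1 = 1" "cmod w2 = 1" unfolding w1_def w2_def by (simp_all add: norm_mult)
  ultimately show ?thesis by metis
qed

text \<open>A character on a subgroup, given by its graph. Graphs make the union of a chain of
  extensions a plain union of sets.\<close>

definition partial_character :: "('a::ab_group_add \<times> complex) set \<Rightarrow> bool" where
  "partial_character f \<longleftrightarrow> (0, 1) \<in> f \<and>
     (\<forall>x v y w. (x, v) \<in> f \<longrightarrow> (y, w) \<in> f \<longrightarrow> (x - y, v * cnj w) \<in> f) \<and>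
     (\<forall>x v. (x, v) \<in> f \<longrightarrow> cmod v = 1) \<and> (\<forall>v. (0, v) \<in> f \<longrightarrow> v = 1)"

lemma partial_character_0: "partial_character f \<Longrightarrow> (0, 1) \<in> f"
  and partial_character_diff: "partial_character f \<Longrightarrow> (x, v) \<in> f \<Longrightarrow> (y, w) \<in> f \<Longrightarrow> (x - y, v * cnj w) \<in> f"
  and partial_character_norm: "partial_character f \<Longrightarrow> (x, v) \<in> f \<Longrightarrow> cmod v = 1"
  and partial_character_one: "partial_character f \<Longrightarrow> (0, v) \<in> f \<Longrightarrow> v = 1"
  unfolding partial_character_def by simp_all

lemma unit_mult_cnj: "cmod w = 1 \<Longrightarrow> w * cnj w = 1"
  by (simp add: complex_norm_square[symmetric])

lemma unit_cnj_eqI: "cmod w = 1 \<Longrightarrow> v * cnj w = 1 \<Longrightarrow> v = w"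
  by (metis mult.assoc mult.commute mult.right_neutral unit_mult_cnj)

lemma partial_character_unique:
  assumes f: "partial_character f" and "(x, v) \<in> f" "(x, w) \<in> f" shows "v = w"
proof -
  have "(x - x, v * cnj w) \<in> f" using assms by (intro partial_character_diff)
  then have "v * cnj w = 1" using partial_character_one[OF f] by simp
  then show ?thesis using partial_character_norm[OF f assms(3)] unit_cnj_eqI by simp
qed

lemma partial_character_uminus:
  assumes "partial_character f" "(x, v) \<in> f" shows "(- x, cnj v) \<in> f"
  using partial_character_diff[OF assms(1) partial_character_0[OF assms(1)] assms(2)] by simp

lemma partial_character_add:
  assumes f: "partial_character f" and "(x, v) \<in> f" "(y, w) \<in> f" shows "(x + y, v * w) \<in> f"
  using partial_character_diff[OF f assms(2) partial_character_uminus[OF f assms(3)]] by simp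

lemma partial_character_nmul:
  assumes f: "partial_character f" and "(x, v) \<in> f" shows "(nmul n x, v ^ n) \<in> f"
proof (induction n)
  case 0
  then show ?case using partial_character_0[OF f] by simp
next
  case (Suc n)
  then show ?case using partial_character_add[OF f Suc assms(2)] by (simp add: mult.commute)
qed

text \<open>If no positive multiple of \<open>g\<close> lies in the domain, every unimodular value is admissible.
  Otherwise the value has to be a \<open>d0\<close>-th root of a prescribed number, where \<open>d0\<close> is the least
  positive multiplier. As \<open>g\<close> itself is not in the domain, \<open>d0 \<ge> 2\<close>, and there are two roots to choose
  from.\<close>

lemma compatible_value_exists:
  assumes f: "partial_character f" and g: "g \<notin> Domain f"
  shows "\<exists>w. cmod w = 1 \<and> (\<forall>d v. (nmul d g, v) \<in> f \<longrightarrow> w ^ d = v) \<and> w \<noteq> z"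
proof (cases "\<exists>d>0. nmul d g \<in> Domain f")
  case False
  have "\<exists>w::complex. cmod w = 1 \<and> w \<noteq> z"
  proof (cases "z = 1")
    case True
    then show ?thesis by (intro exI[of _ "-1"]) simp
  qed (auto intro: exI[of _ 1])
  moreover have "w ^ d = v" if "(nmul d g, v) \<in> f" for w d v
  proof -
    have mem: "nmul d g \<in> Domain f" using that by (rule DomainI)
    have "\<not> d > 0"
    proof
      assume "d > 0"
      with mem have "\<exists>d>0. nmul d g \<in> Domain f" by (intro exI[of _ d] conjI)
      with False show False by (rule notE)
    qed
    then have "d = 0" by simp
    then show ?thesis using partial_character_one[OF f] that by simp
  qed
  ultimately show ?thesis by auto
next
  case True
  define d0 where "d0 = (LEAST d. d > 0 \<and> nmul d g \<in> Domain f)"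
  have d0: "d0 > 0" "nmul d0 g \<in> Domain f" using LeastI_ex[OF True] unfolding d0_def by simp_all
  have least: "d0 \<le> d" if "d > 0" "nmul d g \<in> Domain f" for d
    unfolding d0_def using that by (intro Least_le) simp
  obtain v0 where v0: "(nmul d0 g, v0) \<in> f" using d0(2) by auto
  have "d0 \<noteq> 1"
  proof
    assume "d0 = 1"
    then have "g \<in> Domain f" using d0(2) by (simp add: numeral_eq_Suc One_nat_def)
    then show False using g by simp
  qed
  then have "d0 \<ge> 2" using d0(1) by simp
  then obtain w where w: "cmod w = 1" "w ^ d0 = v0" "w \<noteq> z"
    using two_roots[OF partial_character_norm[OF f v0]] by auto
  have "w ^ d = v" if dv: "(nmul d g, v) \<in> f" for d v
  proof -
    \<comment> \<open>Division with remainder shows that the multipliers leading into the domain are the multiples of \<open>d0\<close>.\<close>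
    define q r where "q = d div d0" and "r = d mod d0"
    have d: "d = q * d0 + r" unfolding q_def r_def by simp
    have qd: "(nmul (q * d0) g, v0 ^ q) \<in> f"
      unfolding nmul_mult by (rule partial_character_nmul[OF f v0])
    have "nmul d g - nmul (q * d0) g = nmul r g" unfolding d nmul_add by simp
    then have r_mem: "(nmul r g, v * cnj (v0 ^ q)) \<in> f"
      using partial_character_diff[OF f dv qd] by simp
    have "r = 0"
    proof (rule ccontr)
      assume "r \<noteq> 0"
      then have "d0 \<le> r" using least[of r] r_mem by auto
      moreover have "r < d0" unfolding r_def using d0(1) by simp
      ultimately show False by simp
    qed
    then have "v * cnj (v0 ^ q) = 1" using r_mem partial_character_one[OF f] by simp
    then have "v = v0 ^ q" using unit_cnj_eqI partial_character_norm[OF f qd] by simp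
    then show ?thesis unfolding d \<open>r = 0\<close> w(2)[symmetric] by (simp add: power_mult mult.commute)
  qed
  then show ?thesis using w by auto
qed

text \<open>The freedom to avoid one value \<open>z\<close> at \<open>g\<close> is what later produces many characters.\<close>

lemma partial_character_extend:
  assumes f: "partial_character f" and g: "g \<notin> Domain f"
  obtains f' w where "partial_character f'" "f \<subseteq> f'" "(g, w) \<in> f'" "w \<noteq> z"
    "Domain f' \<subseteq> subgroup_span (insert g (Domain f))"
proof -
  from compatible_value_exists[OF f g, of z]
  obtain w where w: "cmod w = 1" "\<forall>d v. (nmul d g, v) \<in> f \<longrightarrow> w ^ d = v" "w \<noteq> z"
    by (elim exE conjE) (rule that)
  have ww: "w * cnj w = 1" by (rule unit_mult_cnj[OF w(1)])
  have wn: "w ^ n * cnj w ^ n = 1" for n by (simp add: ww flip: power_mult_distrib)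
  define f' where "f' = {(k + nmul m g - nmul n g, v * w ^ m * cnj w ^ n) | k v m n. (k, v) \<in> f}"
  have f'I: "(k + nmul m g - nmul n g, v * w ^ m * cnj w ^ n) \<in> f'" if "(k, v) \<in> f" for k v m n
    unfolding f'_def using that by auto
  have f'E: "\<exists>k v' m n. x = k + nmul m g - nmul n g \<and> v = v' * w ^ m * cnj w ^ n \<and> (k, v') \<in> f"
    if "(x, v) \<in> f'" for x v using that unfolding f'_def by auto
  have sub: "f \<subseteq> f'"
  proof
    fix p assume "p \<in> f"
    then show "p \<in> f'" using f'I[of "fst p" "snd p" 0 0] by simp
  qed
  \<comment> \<open>The extension is single-valued: a representation of 0 gets the value 1.\<close>
  have one: "v * w ^ m * cnj w ^ n = 1" if kv: "(k, v) \<in> f" and eq: "k + nmul m g - nmul n g = 0" for k v m n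
  proof (cases "m \<le> n")
    case True
    then have n: "n = m + (n - m)" by simp
    have "k + nmul m g - (nmul m g + nmul (n - m) g) = 0" using eq unfolding n[symmetric] nmul_add[symmetric] .
    then have "k = nmul (n - m) g" by simp
    then have v: "w ^ (n - m) = v" using w(2) kv by simp
    have "v * w ^ m = w ^ n" unfolding v[symmetric] power_add[symmetric] using True by simp
    then show ?thesis using wn by simp
  next
    case False
    then have m: "m = n + (m - n)" by simp
    have "k + (nmul n g + nmul (m - n) g) - nmul n g = 0" using eq unfolding m[symmetric] nmul_add[symmetric] .
    then have "k + nmul (m - n) g = 0" by simp
    then have "nmul (m - n) g = - k" by (simp add: add_eq_0_iff)
    then have v: "w ^ (m - n) = cnj v" using w(2) partial_character_uminus[OF f kv] by simp
    have "w ^ m = cnj v * w ^ n" unfolding v[symmetric] power_add[symmetric] using False by simp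
    then have "v * w ^ m * cnj w ^ n = (v * cnj v) * (w ^ n * cnj w ^ n)" by (simp add: mult_ac)
    then show ?thesis using wn unit_mult_cnj[OF partial_character_norm[OF f kv]] by simp
  qed
  have "partial_character f'"
    unfolding partial_character_def
  proof (intro conjI allI impI)
    show "(0, 1) \<in> f'" using sub partial_character_0[OF f] by auto
  next
    fix x v y u assume "(x, v) \<in> f'" "(y, u) \<in> f'"
    then obtain k v' m n l u' p q where
      x: "x = k + nmul m g - nmul n g" "v = v' * w ^ m * cnj w ^ n" "(k, v') \<in> f" and
      y: "y = l + nmul p g - nmul q g" "u = u' * w ^ p * cnj w ^ q" "(l, u') \<in> f"
      using f'E by meson
    have "(k - l + nmul (m + q) g - nmul (n + p) g, (v' * cnj u') * w ^ (m + q) * cnj w ^ (n + p)) \<in> f'"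
      by (intro f'I partial_character_diff[OF f] x y)
    moreover have "k - l + nmul (m + q) g - nmul (n + p) g = x - y"
      unfolding x(1) y(1) nmul_add by (simp add: algebra_simps)
    moreover have "(v' * cnj u') * w ^ (m + q) * cnj w ^ (n + p) = v * cnj u"
      unfolding x(2) y(2) power_add by (simp add: mult_ac)
    ultimately show "(x - y, v * cnj u) \<in> f'" by simp
  next
    fix x v assume "(x, v) \<in> f'"
    then obtain k v' m n where "v = v' * w ^ m * cnj w ^ n" "(k, v') \<in> f" using f'E by meson
    then show "cmod v = 1" using partial_character_norm[OF f] w(1) by (simp add: norm_mult norm_power)
  next
    fix v assume "(0, v) \<in> f'"
    then obtain k v' m n where "0 = k + nmul m g - nmul n g" "v = v' * w ^ m * cnj w ^ n" "(k, v') \<in> f"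
      using f'E by meson
    then show "v = 1" using one by simp
  qed
  moreover have "(g, w) \<in> f'" using f'I[OF partial_character_0[OF f], of 1 0] by simp
  moreover have "Domain f' \<subseteq> subgroup_span (insert g (Domain f))"
  proof
    fix x assume "x \<in> Domain f'"
    then obtain v where "(x, v) \<in> f'" by auto
    then obtain k v' m n where x: "x = k + nmul m g - nmul n g" "(k, v') \<in> f" using f'E by meson
    have "k \<in> subgroup_span (insert g (Domain f))" "g \<in> subgroup_span (insert g (Domain f))"
      using x(2) by (auto intro: subgroup_span_base)
    then show "x \<in> subgroup_span (insert g (Domain f))"
      unfolding x(1) by (intro subgroup_span_diff is_subgroup_add nmul_mem is_subgroup_span)
  qed
  ultimately show ?thesis using that sub w(3) by blast
qed

unbundle cardinal_syntax

lemma countable_ordLeq_infinite: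
  assumes "countable A" "infinite B" shows "|A| \<le>o |B|"
proof -
  obtain f :: "_ \<Rightarrow> nat" where "inj_on f A" using assms(1) unfolding countable_def by auto
  then have "|A| \<le>o |UNIV :: nat set|" by (intro card_of_ordLeqI[of f]) auto
  moreover have "|UNIV :: nat set| \<le>o |B|" using assms(2) infinite_iff_card_of_nat by auto
  ultimately show ?thesis by (rule ordLeq_transitive)
qed

lemma finite_ordLeq_infinite: "finite A \<Longrightarrow> infinite B \<Longrightarrow> |A| \<le>o |B|"
  by (intro countable_ordLeq_infinite countable_finite)

lemma Un_ordLeq_infinite:
  assumes "infinite C" "|A| \<le>o |C|" "|B| \<le>o |C|" shows "|A \<union> B| \<le>o |C|"
proof -
  have "|UNIV :: bool set| \<le>o |C|" using assms(1) by (intro finite_ordLeq_infinite) simp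
  then have "|\<Union>i\<in>(UNIV :: bool set). if i then A else B| \<le>o |C|"
    using assms by (intro card_of_UNION_ordLeq_infinite) simp_all
  moreover have "(\<Union>i\<in>(UNIV :: bool set). if i then A else B) = A \<union> B"
    unfolding UNIV_bool by (simp add: Un_commute)
  ultimately show ?thesis by simp
qed

text \<open>The elements that are sums of \<open>n\<close> generators or their negatives are counted by induction
  on \<open>n\<close>.\<close>

lemma subgroup_span_ordLeq:
  assumes "infinite A" shows "|subgroup_span A| \<le>o |A|"
proof -
  define B where "B = A \<union> uminus ` A"
  have B: "|B| \<le>o |A|"
    unfolding B_def by (intro Un_ordLeq_infinite assms card_of_image ordLeq_refl card_of_Card_order)
  define L where "L n = {sum_list xs | xs. xs \<in> lists B \<and> length xs = n}" for n
  have L: "|L n| \<le>o |A|" for n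
  proof (induction n)
    case 0
    have "finite (L 0)" unfolding L_def by simp
    then show ?case using assms by (rule finite_ordLeq_infinite)
  next
    case (Suc n)
    have "L (Suc n) \<subseteq> (\<lambda>p. fst p + snd p) ` (SIGMA b:B. L n)"
    proof
      fix x assume "x \<in> L (Suc n)"
      then obtain xs where xs: "x = sum_list xs" "xs \<in> lists B" "length xs = Suc n"
        unfolding L_def by auto
      then obtain y ys where ys: "xs = y # ys" by (cases xs) auto
      have "sum_list ys \<in> L n" unfolding L_def using xs ys by auto
      then have "(y, sum_list ys) \<in> (SIGMA b:B. L n)" using xs ys by simp
      moreover have "x = fst (y, sum_list ys) + snd (y, sum_list ys)" using xs ys by simp
      ultimately show "x \<in> (\<lambda>p. fst p + snd p) ` (SIGMA b:B. L n)" by (rule rev_image_eqI)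
    qed
    then have "|L (Suc n)| \<le>o |(\<lambda>p. fst p + snd p) ` (SIGMA b:B. L n)|" by (rule card_of_mono1)
    also have "|(\<lambda>p. fst p + snd p) ` (SIGMA b:B. L n)| \<le>o |SIGMA b:B. L n|" by (rule card_of_image)
    also have "|SIGMA b:B. L n| \<le>o |A|"
      using assms B Suc.IH by (intro card_of_Sigma_ordLeq_infinite) auto
    finally show ?case .
  qed
  have "subgroup_span A = (\<Union>n. L n)" unfolding subgroup_span_def L_def B_def by auto
  also have "|\<Union>n. L n| \<le>o |A|"
    using assms L by (intro card_of_UNION_ordLeq_infinite countable_ordLeq_infinite) auto
  finally show ?thesis .
qed

lemma countable_subgroup_span: "countable A \<Longrightarrow> countable (subgroup_span A)"
proof -
  assume "countable A"
  then have "countable (sum_list ` lists (A \<union> uminus ` A))" by (intro countable_image countable_lists) auto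
  moreover have "subgroup_span A = sum_list ` lists (A \<union> uminus ` A)" unfolding subgroup_span_def by auto
  ultimately show ?thesis by simp
qed

locale well_ordered_group =
  fixes lt :: "'a::ab_group_add \<Rightarrow> 'a \<Rightarrow> bool" and Z :: "'a set"
  assumes wf: "wf {(x, y). lt x y}" and total: "x \<noteq> y \<Longrightarrow> lt x y \<or> lt y x"
begin

definition level :: "'a \<Rightarrow> 'a set" where
  "level a = subgroup_span (Z \<union> {h. lt h a})"

text \<open>The elements that are not generated by \<open>Z\<close> and their predecessors in the well-order. At
  each of them a character has at least two possible values once it is fixed on \<open>Z\<close> and the predecessors.\<close>

definition jumps :: "'a set" where
  "jumps = {a. a \<notin> level a}"

lemma jumps_generate: "subgroup_span (Z \<union> jumps) = UNIV"
proof -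
  have "a \<in> subgroup_span (Z \<union> jumps)" for a
  proof (induction a rule: wf_induct_rule[OF wf])
    case (1 a)
    show ?case
    proof (cases "a \<in> jumps")
      case True
      then show ?thesis by (auto intro: subgroup_span_base)
    next
      case False
      have "level a \<subseteq> subgroup_span (Z \<union> jumps)"
        unfolding level_def using 1
        by (intro subgroup_span_minimal is_subgroup_span) (auto intro: subgroup_span_base)
      then show ?thesis using False unfolding jumps_def by auto
    qed
  qed
  then show ?thesis by auto
qed

text \<open>The third condition makes \<open>f\<close> avoid the values \<open>c\<close> at all jumps. The last condition says
  that the domain looks like an initial segment, so that an extension by the least missing element
  picks up only one new jump.\<close>

definition admissible :: "('a \<Rightarrow> complex) \<Rightarrow> ('a \<times> complex) set \<Rightarrow> bool" where
  "admissible c f \<longleftrightarrow> partial_character f \<and> (\<forall>z\<in>Z. (z, 1) \<in> f) \<and>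
     (\<forall>a v. a \<in> jumps \<longrightarrow> (a, v) \<in> f \<longrightarrow> v \<noteq> c a) \<and>
     (\<forall>a\<in>jumps. a \<notin> Domain f \<longrightarrow> Domain f \<subseteq> level a)"

lemma admissible_trivial: "admissible c (subgroup_span Z \<times> {1})"
proof -
  have sub: "subgroup_span Z \<subseteq> level a" for a unfolding level_def by (rule subgroup_span_mono) auto
  have "partial_character (subgroup_span Z \<times> {1})"
    unfolding partial_character_def by (auto intro: subgroup_span_zero subgroup_span_diff)
  moreover have "a \<notin> subgroup_span Z" if "a \<in> jumps" for a using that sub unfolding jumps_def by auto
  ultimately show ?thesis
    unfolding admissible_def using sub by (auto intro: subgroup_span_base)
qed

lemma admissible_chain:
  assumes "C \<noteq> {}" "\<And>f. f \<in> C \<Longrightarrow> admissible c f"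
    and chain: "\<And>f g. f \<in> C \<Longrightarrow> g \<in> C \<Longrightarrow> f \<subseteq> g \<or> g \<subseteq> f"
  shows "admissible c (\<Union>C)"
proof -
  have pc: "partial_character f" if "f \<in> C" for f using assms(2)[OF that] unfolding admissible_def by simp
  obtain f0 where f0: "f0 \<in> C" using assms(1) by auto
  have "partial_character (\<Union>C)"
    unfolding partial_character_def
  proof (intro conjI allI impI)
    show "(0, 1) \<in> \<Union>C" using f0 partial_character_0[OF pc] by auto
  next
    fix x v y w assume "(x, v) \<in> \<Union>C" "(y, w) \<in> \<Union>C"
    then obtain f g where fg: "f \<in> C" "(x, v) \<in> f" "g \<in> C" "(y, w) \<in> g" by auto
    show "(x - y, v * cnj w) \<in> \<Union>C"
    proof (cases "f \<subseteq> g")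
      case True
      then have "(x, v) \<in> g" using fg(2) by auto
      from partial_character_diff[OF pc[OF fg(3)] this fg(4)] show ?thesis using fg(3) by auto
    next
      case False
      then have "g \<subseteq> f" using chain fg by auto
      then have "(y, w) \<in> f" using fg(4) by auto
      from partial_character_diff[OF pc[OF fg(1)] fg(2) this] show ?thesis using fg(1) by auto
    qed
  next
    fix x v assume "(x, v) \<in> \<Union>C"
    then show "cmod v = 1" using partial_character_norm[OF pc] by auto
  next
    fix v assume "(0, v) \<in> \<Union>C"
    then show "v = 1" using partial_character_one[OF pc] by auto
  qed
  moreover have "(z, 1) \<in> \<Union>C" if "z \<in> Z" for z
    using assms(2)[OF f0] that f0 unfolding admissible_def by auto
  moreover have "v \<noteq> c a" if a: "a \<in> jumps" "(a, v) \<in> \<Union>C" for a v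
  proof -
    obtain f where "f \<in> C" "(a, v) \<in> f" using a(2) by auto
    then show ?thesis using assms(2)[of f] a(1) unfolding admissible_def by simp
  qed
  moreover have "Domain (\<Union>C) \<subseteq> level a" if a: "a \<in> jumps" "a \<notin> Domain (\<Union>C)" for a
  proof
    fix x assume "x \<in> Domain (\<Union>C)"
    then obtain f where f: "f \<in> C" "x \<in> Domain f" by auto
    then have "a \<notin> Domain f" using a(2) by auto
    then have "Domain f \<subseteq> level a" using assms(2)[OF f(1)] a(1) unfolding admissible_def by simp
    then show "x \<in> level a" using f(2) by auto
  qed
  ultimately show ?thesis unfolding admissible_def by simp
qed

text \<open>The least element \<open>g\<close> outside the domain is adjoined, with a value different from \<open>c g\<close>. A
  jump \<open>a\<close> that enters the domain must be \<open>g\<close>: otherwise \<open>g\<close> precedes \<open>a\<close>, and the new domain is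
  contained in \<open>level a\<close>, which does not contain \<open>a\<close>.\<close>

lemma admissible_extend:
  assumes f: "admissible c f" and ne: "Domain f \<noteq> UNIV"
  obtains f' where "admissible c f'" "f \<subseteq> f'" "f' \<noteq> f"
proof -
  have pc: "partial_character f" and Zf: "\<And>z. z \<in> Z \<Longrightarrow> (z, 1) \<in> f"
    and avoid: "\<And>a v. a \<in> jumps \<Longrightarrow> (a, v) \<in> f \<Longrightarrow> v \<noteq> c a"
    and init: "\<And>a. a \<in> jumps \<Longrightarrow> a \<notin> Domain f \<Longrightarrow> Domain f \<subseteq> level a"
    using f unfolding admissible_def by simp_all
  have "- Domain f \<noteq> {}" using ne by auto
  then obtain g where g: "g \<in> - Domain f" and min: "\<And>y. (y, g) \<in> {(x, y). lt x y} \<Longrightarrow> y \<notin> - Domain f"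
    using wfE_min'[OF wf, of "- Domain f"] by auto
  have g': "g \<notin> Domain f" using g by simp
  have after: "lt g a" if "a \<notin> Domain f" "a \<noteq> g" for a
    using total[OF that(2)] min[of a] that(1) by auto
  obtain f' w where f': "partial_character f'" "f \<subseteq> f'" "(g, w) \<in> f'" "w \<noteq> c g"
    "Domain f' \<subseteq> subgroup_span (insert g (Domain f))"
    by (rule partial_character_extend[OF pc g', of "c g"]) (rule that)
  have level: "Domain f' \<subseteq> level a" if a: "a \<in> jumps" "a \<notin> Domain f" "a \<noteq> g" for a
  proof -
    have "g \<in> level a" unfolding level_def using after[OF a(2,3)] by (auto intro: subgroup_span_base)
    then have "insert g (Domain f) \<subseteq> level a" using init[OF a(1,2)] by simp
    then have "subgroup_span (insert g (Domain f)) \<subseteq> level a"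
      by (rule subgroup_span_minimal[rotated]) (simp add: level_def is_subgroup_span)
    then show ?thesis using f'(5) by auto
  qed
  have "v \<noteq> c a" if a: "a \<in> jumps" "(a, v) \<in> f'" for a v
  proof (cases "a \<in> Domain f")
    case True
    then obtain v' where v': "(a, v') \<in> f" by auto
    then have "(a, v') \<in> f'" using f'(2) by auto
    then have "v = v'" using partial_character_unique[OF f'(1) a(2)] by simp
    then show ?thesis using avoid[OF a(1) v'] by simp
  next
    case False
    have "a = g"
    proof (rule ccontr)
      assume "a \<noteq> g"
      then have "Domain f' \<subseteq> level a" using level a(1) False by simp
      then show False using a unfolding jumps_def by auto
    qed
    then have "v = w" using partial_character_unique[OF f'(1) a(2)] f'(3) by simp
    then show ?thesis using f'(4) \<open>a = g\<close> by simp
  qed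
  moreover have "Domain f' \<subseteq> level a" if a: "a \<in> jumps" "a \<notin> Domain f'" for a
    using f'(2,3) a by (intro level) auto
  moreover have "(z, 1) \<in> f'" if "z \<in> Z" for z using Zf[OF that] f'(2) by auto
  ultimately have "admissible c f'" unfolding admissible_def using f'(1) by simp
  moreover have "f' \<noteq> f" using f'(3) g' by auto
  ultimately show ?thesis using f'(2) that by simp
qed

lemma avoiding_character_exists:
  obtains \<phi> where "character \<phi>" "\<And>z. z \<in> Z \<Longrightarrow> \<phi> z = 1" "\<And>a. a \<in> jumps \<Longrightarrow> \<phi> a \<noteq> c a"
proof -
  have "\<exists>M\<in>{f. admissible c f}. \<forall>X\<in>{f. admissible c f}. M \<subseteq> X \<longrightarrow> X = M"
  proof (rule subset_Zorn_nonempty)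
    show "{f. admissible c f} \<noteq> {}" using admissible_trivial by auto
  next
    fix C assume C: "C \<noteq> {}" "subset.chain {f. admissible c f} C"
    show "\<Union>C \<in> {f. admissible c f}"
      using C unfolding subset_chain_def by (intro CollectI admissible_chain) auto
  qed
  then obtain M where M: "admissible c M" "\<And>X. admissible c X \<Longrightarrow> M \<subseteq> X \<Longrightarrow> X = M" by auto
  have pc: "partial_character M" using M(1) unfolding admissible_def by simp
  have "Domain M = UNIV"
  proof (rule ccontr)
    assume "Domain M \<noteq> UNIV"
    then obtain f' where "admissible c f'" "M \<subseteq> f'" "f' \<noteq> M"
      by (rule admissible_extend[OF M(1)]) (rule that)
    then show False using M(2) by simp
  qed
  then have ex: "\<exists>v. (x, v) \<in> M" for x by auto
  define \<phi> where "\<phi> x = (THE v. (x, v) \<in> M)" for x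
  have \<phi>_eq: "\<phi> x = v" if "(x, v) \<in> M" for x v
    unfolding \<phi>_def using that partial_character_unique[OF pc] by (intro the_equality) auto
  have \<phi>_mem: "(x, \<phi> x) \<in> M" for x using ex[of x] \<phi>_eq by auto
  have "character \<phi>" unfolding character_def
    using \<phi>_eq[OF partial_character_add[OF pc \<phi>_mem \<phi>_mem]] partial_character_norm[OF pc \<phi>_mem] by simp
  moreover have "\<phi> z = 1" if "z \<in> Z" for z using M(1) that unfolding admissible_def by (intro \<phi>_eq) simp
  moreover have "\<phi> a \<noteq> c a" if "a \<in> jumps" for a
    using M(1) that \<phi>_mem[of a] unfolding admissible_def by simp
  ultimately show ?thesis by (rule that)
qed

end

text \<open>Cantor's diagonal argument. The jumps together with \<open>Z\<close> generate the group, so there are as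
  many jumps as elements. If the characters trivial on \<open>Z\<close> could be indexed as \<open>e a\<close> by the jumps
  \<open>a\<close>, a character that differs from \<open>e a\<close> at \<open>a\<close> for every jump \<open>a\<close> would be missing from the list.\<close>

lemma many_annihilating_characters:
  fixes Z :: "'a::ab_group_add set"
  assumes unc: "uncountable (UNIV :: 'a set)" and Z: "countable Z"
  shows "\<not> |{\<phi>. character \<phi> \<and> (\<forall>z\<in>Z. \<phi> z = 1)}| \<le>o |UNIV :: 'a set|"
proof
  let ?A = "{\<phi>. character \<phi> \<and> (\<forall>z\<in>Z. \<phi> z = 1)}"
  assume le: "|?A| \<le>o |UNIV :: 'a set|"
  obtain r :: "'a rel" where r: "well_order_on UNIV r" using well_order_on by auto
  define lt where "lt x y \<longleftrightarrow> (x, y) \<in> r - Id" for x y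
  interpret well_ordered_group lt Z
  proof
    have "{(x, y). lt x y} = r - Id" unfolding lt_def by auto
    then show "wf {(x, y). lt x y}" using r unfolding well_order_on_def by simp
    show "lt x y \<or> lt y x" if "x \<noteq> y" for x y
      using r that unfolding well_order_on_def linear_order_on_def total_on_def lt_def by auto
  qed
  have inf: "infinite jumps"
  proof
    assume "finite jumps"
    then have "countable (Z \<union> jumps)" using Z countable_finite by auto
    then have "countable (subgroup_span (Z \<union> jumps))" by (rule countable_subgroup_span)
    then show False using unc unfolding jumps_generate by simp
  qed
  have "|UNIV :: 'a set| = |subgroup_span (Z \<union> jumps)|" unfolding jumps_generate ..
  also have "|subgroup_span (Z \<union> jumps)| \<le>o |Z \<union> jumps|" using inf by (intro subgroup_span_ordLeq) auto
  also have "|Z \<union> jumps| \<le>o |jumps|"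
    by (intro Un_ordLeq_infinite inf countable_ordLeq_infinite[OF Z] ordLeq_refl card_of_Card_order)
  finally have "|UNIV :: 'a set| \<le>o |jumps|" .
  with le have "|?A| \<le>o |jumps|" by (rule ordLeq_transitive)
  moreover have "(\<lambda>x. 1) \<in> ?A" unfolding character_def by simp
  then have "?A \<noteq> {}" by auto
  ultimately obtain e where e: "e ` jumps = ?A" using card_of_ordLeq2[of ?A jumps] by auto
  obtain \<phi> where \<phi>: "character \<phi>" "\<And>z. z \<in> Z \<Longrightarrow> \<phi> z = 1" "\<And>a. a \<in> jumps \<Longrightarrow> \<phi> a \<noteq> e a a"
    by (rule avoiding_character_exists[of "\<lambda>a. e a a"]) (rule that)
  then have "\<phi> \<in> e ` jumps" unfolding e by simp
  then obtain a where "a \<in> jumps" "\<phi> = e a" by auto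
  then show False using \<phi>(3)[of a] by simp
qed

section \<open>Precompact Arhangel'skii groups\<close>

lemma arhangelskii_base:
  fixes T :: "'a::ab_group_add topology"
  assumes "arhangelskii_group T"
  obtains \<B> where "|\<B>| \<le>o |UNIV :: 'a set|" "\<And>V. V \<in> \<B> \<Longrightarrow> openin T V"
    "\<And>U x. openin T U \<Longrightarrow> x \<in> U \<Longrightarrow> \<exists>V\<in>\<B>. x \<in> V \<and> V \<subseteq> U"
proof -
  define \<B> where "\<B> = (SOME B. minimal_base T B)"
  have "minimal_base T \<B>" unfolding \<B>_def by (rule someI_ex[OF minimal_base_exists])
  then have base: "arbitrary union_of (\<lambda>U. U \<in> \<B>) = openin T"
    unfolding minimal_base_def base_of_topology_def by simp
  have "|\<B>| \<le>o |UNIV :: 'a set|"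
    using assms unfolding arhangelskii_group_def weight_def \<B>_def by simp
  moreover have "openin T V" if "V \<in> \<B>" for V
    unfolding base[symmetric] union_of_def arbitrary_def using that by (intro exI[of _ "{V}"]) simp
  moreover have "\<exists>V\<in>\<B>. x \<in> V \<and> V \<subseteq> U" if "openin T U" "x \<in> U" for U x
    using that unfolding base[symmetric] union_of_def arbitrary_def by auto
  ultimately show ?thesis by (rule that)
qed

text \<open>Each continuous character is close to 1 on some basic neighbourhood of zero, and each
  neighbourhood serves only finitely many characters.\<close>

lemma continuous_characters_ordLeq:
  fixes T :: "'a::ab_group_add topology"
  assumes T: "precompact_group_topology T" "arhangelskii_group T" and inf: "infinite (UNIV :: 'a set)"
  shows "|continuous_characters T| \<le>o |UNIV :: 'a set|"
proof -
  obtain \<B> where \<B>: "|\<B>| \<le>o |UNIV :: 'a set|" "\<And>V. V \<in> \<B> \<Longrightarrow> openin T V"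
    "\<And>U x. openin T U \<Longrightarrow> x \<in> U \<Longrightarrow> \<exists>V\<in>\<B>. x \<in> V \<and> V \<subseteq> U"
    by (rule arhangelskii_base[OF T(2)]) (rule that)
  define \<B>0 where "\<B>0 = {V \<in> \<B>. 0 \<in> V}"
  define H where "H V = {\<phi>. character \<phi> \<and> (\<forall>x\<in>V. cmod (\<phi> x - 1) \<le> 1/4)}" for V :: "'a set"
  have "|\<B>0| \<le>o |UNIV :: 'a set|"
    by (rule ordLeq_transitive[OF card_of_mono1 \<B>(1)]) (auto simp: \<B>0_def)
  moreover have "|H V| \<le>o |UNIV :: 'a set|" if "V \<in> \<B>0" for V
  proof -
    have "nbhd0 T V" unfolding nbhd0_def using that \<B>(2) unfolding \<B>0_def by auto
    then have "finite (H V)"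
      unfolding H_def by (intro finite_small_characters precompact_finitely_covering[OF T(1)])
    then show ?thesis using inf by (rule finite_ordLeq_infinite)
  qed
  ultimately have "|\<Union>V\<in>\<B>0. H V| \<le>o |UNIV :: 'a set|"
    using inf by (intro card_of_UNION_ordLeq_infinite) auto
  moreover have "continuous_characters T \<subseteq> (\<Union>V\<in>\<B>0. H V)"
  proof
    fix \<phi> assume \<phi>: "\<phi> \<in> continuous_characters T"
    then have c: "character \<phi>" and "\<forall>\<epsilon>>0. nbhd0 T {x. cmod (\<phi> x - 1) \<le> \<epsilon>}"
      unfolding continuous_characters_def by simp_all
    from this(2) have "nbhd0 T {x. cmod (\<phi> x - 1) \<le> 1/4}" by (elim allE[of _ "1/4"]) simp
    then obtain U where U: "openin T U" "0 \<in> U" "U \<subseteq> {x. cmod (\<phi> x - 1) \<le> 1/4}"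
      unfolding nbhd0_def by (elim exE conjE) (rule that)
    obtain V where "V \<in> \<B>" "0 \<in> V" "V \<subseteq> U" using \<B>(3)[OF U(1,2)] by auto
    then show "\<phi> \<in> (\<Union>V\<in>\<B>0. H V)" using c U(3) unfolding \<B>0_def H_def by auto
  qed
  then have "|continuous_characters T| \<le>o |\<Union>V\<in>\<B>0. H V|" by (rule card_of_mono1)
  ultimately show ?thesis using ordLeq_transitive by auto
qed

lemma countable_if_ss_characterized:
  fixes T :: "'a::ab_group_add topology"
  assumes T: "precompact_group_topology T" "arhangelskii_group T" and ss: "ss_characterized T"
  shows "countable (UNIV :: 'a set)"
proof (rule ccontr)
  assume unc: "uncountable (UNIV :: 'a set)"
  obtain u where u: "TB_sequence u" "T = tau u" using ss unfolding ss_characterized_def by auto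
  have fin: "finest_precompact_null u T" unfolding u(2) by (rule finest_precompact_null_exists[OF u(1)])
  have "{\<phi>. character \<phi> \<and> (\<forall>z\<in>range u. \<phi> z = 1)} \<subseteq> continuous_characters T"
  proof
    fix \<phi> assume "\<phi> \<in> {\<phi>. character \<phi> \<and> (\<forall>z\<in>range u. \<phi> z = 1)}"
    then show "\<phi> \<in> continuous_characters T" by (intro character_continuous_finest[OF fin]) simp_all
  qed
  then have "|{\<phi>. character \<phi> \<and> (\<forall>z\<in>range u. \<phi> z = 1)}| \<le>o |continuous_characters T|"
    by (rule card_of_mono1)
  also have "|continuous_characters T| \<le>o |UNIV :: 'a set|"
    using unc countable_finite by (intro continuous_characters_ordLeq T) auto
  finally show False using many_annihilating_characters[OF unc, of "range u"] by simp
qed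

text \<open>The theorem of Birkhoff and Kakutani: the pseudonorm of a chain below the given base
  separates points and defines the topology.\<close>

lemma metrizable_if_countable_nbhd_base:
  fixes T :: "'a::ab_group_add topology"
  assumes gT: "group_topology T" and haus: "Hausdorff_space T"
    and U: "\<And>n::nat. nbhd0 T (U n)" "\<And>W. nbhd0 T W \<Longrightarrow> \<exists>n. U n \<subseteq> W"
  shows "metrizable_space T"
proof -
  have ts: "topspace T = UNIV" using gT unfolding group_topology_def by simp
  obtain V where V: "V 0 = UNIV" "\<And>n. nbhd0 T (V n)" "\<And>n x. x \<in> V n \<Longrightarrow> - x \<in> V n"
    "\<And>n x y z. x \<in> V (Suc n) \<Longrightarrow> y \<in> V (Suc n) \<Longrightarrow> z \<in> V (Suc n) \<Longrightarrow> x + y + z \<in> V n"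
    "\<And>n::nat. V (Suc n) \<subseteq> U n"
    using nbhd0_chain[OF gT, of U] U(1) by blast
  interpret nbhd_chain V by standard (use V nbhd0_zero in blast)+
  have ball_V: "V (Suc n) \<subseteq> {y. pnorm y < (1/2) ^ n}" for n
  proof
    fix y assume "y \<in> V (Suc n)"
    then have "pnorm y \<le> (1/2) ^ Suc n" by (rule pnorm_le)
    also have "\<dots> < (1/2) ^ n" by simp
    finally show "y \<in> {y. pnorm y < (1/2) ^ n}" by simp
  qed
  have nbhd: "nbhd0 T W \<longleftrightarrow> (\<exists>r>0. {y. pnorm y < r} \<subseteq> W)" for W
  proof
    assume "nbhd0 T W"
    then obtain n where n: "U n \<subseteq> W" using U(2) by auto
    have "{y. pnorm y < (1/2) ^ Suc n} \<subseteq> V (Suc n)" using pnorm_less by auto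
    then have "{y. pnorm y < (1/2) ^ Suc n} \<subseteq> W" using V(5)[of n] n by (meson order_trans)
    then show "\<exists>r>0. {y. pnorm y < r} \<subseteq> W" by (intro exI[of _ "(1/2) ^ Suc n"] conjI) simp_all
  next
    assume "\<exists>r>0. {y. pnorm y < r} \<subseteq> W"
    then obtain r where r: "r > 0" "{y. pnorm y < r} \<subseteq> W" by auto
    obtain n where "(1/2::real) ^ n < r" using real_arch_pow_inv[OF r(1), of "1/2"] by auto
    then have "V (Suc n) \<subseteq> W" using ball_V[of n] r(2) by fastforce
    then show "nbhd0 T W" by (rule nbhd0_mono[OF V(2)])
  qed
  have pnorm_pos: "x = 0" if "pnorm x = 0" for x
  proof (rule ccontr)
    assume "x \<noteq> 0"
    then obtain A B where AB: "openin T A" "openin T B" "0 \<in> A" "x \<in> B" "disjnt A B"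
      using haus unfolding Hausdorff_space_def ts by (metis UNIV_I)
    then have "nbhd0 T A" unfolding nbhd0_def by auto
    then obtain r where "r > 0" "{y. pnorm y < r} \<subseteq> A" unfolding nbhd by auto
    then have "x \<in> A" using that by auto
    then show False using AB(4,5) unfolding disjnt_def by auto
  qed
  interpret M: Metric_space UNIV "\<lambda>x y. pnorm (x - y)"
  proof
    show "0 \<le> pnorm (x - y)" for x y by (rule pnorm_nonneg)
    show "pnorm (x - y) = pnorm (y - x)" for x y using pnorm_uminus[of "x - y"] by simp
    show "pnorm (x - y) = 0 \<longleftrightarrow> x = y" for x y using pnorm_pos[of "x - y"] pnorm_zero by auto
    show "pnorm (x - z) \<le> pnorm (x - y) + pnorm (y - z)" for x y z
      using pnorm_triangle[of "x - y" "y - z"] by simp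
  qed
  have "openin T W \<longleftrightarrow> openin M.mtopology W" for W
  proof -
    have "(\<exists>r>0. {y. pnorm y < r} \<subseteq> {y. x + y \<in> W}) \<longleftrightarrow> (\<exists>r>0. M.mball x r \<subseteq> W)" for x
    proof -
      have "{y. pnorm y < r} \<subseteq> {y. x + y \<in> W} \<longleftrightarrow> M.mball x r \<subseteq> W" for r
      proof
        assume *: "{y. pnorm y < r} \<subseteq> {y. x + y \<in> W}"
        show "M.mball x r \<subseteq> W"
        proof
          fix z assume "z \<in> M.mball x r"
          then have "pnorm (z - x) < r" using pnorm_uminus[of "x - z"] by (simp add: M.in_mball)
          then have "x + (z - x) \<in> W" using * by auto
          then show "z \<in> W" by simp
        qed
      next
        assume *: "M.mball x r \<subseteq> W"
        show "{y. pnorm y < r} \<subseteq> {y. x + y \<in> W}"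
        proof
          fix y assume "y \<in> {y. pnorm y < r}"
          then have "x + y \<in> M.mball x r" using pnorm_uminus[of y] by (simp add: M.in_mball)
          then show "y \<in> {y. x + y \<in> W}" using * by auto
        qed
      qed
      then show ?thesis by simp
    qed
    then show ?thesis
      unfolding openin_iff_nbhd0[OF gT] nbhd M.openin_mtopology by (simp add: Ball_def)
  qed
  then have "T = M.mtopology" by (simp add: topology_eq)
  then show ?thesis using M.metrizable_space_mtopology by simp
qed

lemma metrizable_if_countable:
  fixes T :: "'a::ab_group_add topology"
  assumes T: "arhangelskii_group T" and count: "countable (UNIV :: 'a set)"
  shows "metrizable_space T"
proof -
  have gT: "group_topology T" and haus: "Hausdorff_space T"
    using T unfolding arhangelskii_group_def by simp_all
  obtain \<B> where \<B>: "|\<B>| \<le>o |UNIV :: 'a set|" "\<And>V. V \<in> \<B> \<Longrightarrow> openin T V"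
    "\<And>U x. openin T U \<Longrightarrow> x \<in> U \<Longrightarrow> \<exists>V\<in>\<B>. x \<in> V \<and> V \<subseteq> U"
    by (rule arhangelskii_base[OF T]) (rule that)
  obtain f where "inj_on f \<B>" "f ` \<B> \<subseteq> (UNIV :: 'a set)" using \<B>(1) unfolding card_of_ordLeq[symmetric] by auto
  then have "countable \<B>" using count countable_subset countable_image_inj_on by (metis subset_UNIV)
  define \<B>0 where "\<B>0 = {V \<in> \<B>. 0 \<in> V}"
  have "openin T UNIV" using openin_topspace[of T] gT unfolding group_topology_def by simp
  then have "\<B>0 \<noteq> {}" unfolding \<B>0_def using \<B>(3)[of UNIV 0] by auto
  moreover have "countable \<B>0" unfolding \<B>0_def using \<open>countable \<B>\<close> by simp
  ultimately have enum: "range (from_nat_into \<B>0) = \<B>0" by (rule range_from_nat_into)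
  show ?thesis
  proof (rule metrizable_if_countable_nbhd_base[OF gT haus])
    fix n
    have "from_nat_into \<B>0 n \<in> \<B>0" by (subst (2) enum[symmetric]) (rule rangeI)
    then show "nbhd0 T (from_nat_into \<B>0 n)" using \<B>(2) unfolding \<B>0_def nbhd0_def by auto
  next
    fix W assume "nbhd0 T W"
    then obtain U where U: "openin T U" "0 \<in> U" "U \<subseteq> W" unfolding nbhd0_def by auto
    obtain V where V: "V \<in> \<B>" "0 \<in> V" "V \<subseteq> U" using \<B>(3)[OF U(1,2)] by auto
    then have "V \<in> \<B>0" unfolding \<B>0_def by simp
    then have "V \<in> range (from_nat_into \<B>0)" by (simp only: enum)
    then obtain n where "V = from_nat_into \<B>0 n" by auto
    then show "\<exists>n. from_nat_into \<B>0 n \<subseteq> W" using V(3) U(3) by auto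
  qed
qed

unbundle no cardinal_syntax

theorem corollaryC3:
  fixes G :: "'a::ab_group_add topology"
  assumes "precompact_group_topology G"
    and "arhangelskii_group G"
  shows "ss_characterized G \<longleftrightarrow> metrizable_space G \<and> countable (topspace G)"
proof -
  have ts: "topspace G = UNIV"
    using precompactD(1)[OF assms(1)] unfolding group_topology_def by simp
  show ?thesis
    unfolding ts
  proof
    assume "ss_characterized G"
    then have "countable (UNIV :: 'a set)" by (rule countable_if_ss_characterized[OF assms])
    then show "metrizable_space G \<and> countable (UNIV :: 'a set)"
      using metrizable_if_countable[OF assms(2)] by simp
  next
    assume "metrizable_space G \<and> countable (UNIV :: 'a set)"
    then show "ss_characterized G" by (intro ss_characterizedI assms(1)) simp_all
  qed
qed

end
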